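(* Suppose $(M,+,<)$ is an ordered abelian group, $\mathscr{M}$ is a dp-minimal first order expansion of $(M,+,<)$, and $X$ is an $\mathscr{M}$-definable subset of $M$. Then there is a natural number $n$ and an $\mathscr{M}$-definable convex equivalence relation $E$ on $M$ such that $E$ has only finitely many finite classes and for every $a\in M$ there is a finite $B\subseteq M$ such that $$E_a\cap X=E_a\cap\Big[\bigcup_{b\in B}(b+nM)\Big],$$ where $E_a$ is the $E$-class of $a$.
   Context: "Definable" means first order definable with parameters. Ordered abelian groups are linearly ordered. A convex equivalence relation on $M$ is an equivalence relation all of whose classes are convex ($C\subseteq M$ is convex if $a<b<a'$ and $a,a'\in C$ imply $b\in C$). $nM=\{nx:x\in M\}$. Dp-minimality: let $T$ be a complete theory. A family $(I_t : t\in X)$ of infinite sequences (of elements or finite tuples) in a highly saturated model is mutually indiscernible over a small set $A$ if each $I_t$ is indiscernible over $A\cup\bigcup_{s\neq t} I_s$. $T$ is dp-minimal (dp-rank at most $1$) if for every highly saturated $\mathscr{N}\models T$, small $A$, pair $I_0,I_1$ of sequences mutually indiscernible over $A$, and single element $b\in\mathscr{N}$, at least one of $I_0,I_1$ is indiscernible over $Ab$. A structure is dp-minimal if its complete theory is. *)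

theory Defs
  imports Main
begin

unbundle cardinal_syntax

section \<open>First-order logic\<close>

record ('f, 'r) lang =
  farity :: "'f \<Rightarrow> nat"
  rarity :: "'r \<Rightarrow> nat"

datatype 'f trm = Var nat | App 'f "'f trm list"

datatype ('f, 'r) fm =
    Eq "'f trm" "'f trm"
  | Rel 'r "'f trm list"
  | Neg "('f, 'r) fm"
  | Conj "('f, 'r) fm" "('f, 'r) fm"
  | Ex nat "('f, 'r) fm"

primrec wf_trm :: "('f, 'r) lang \<Rightarrow> 'f trm \<Rightarrow> bool" where
  "wf_trm L (Var i) \<longleftrightarrow> True"
| "wf_trm L (App f ts) \<longleftrightarrow> length ts = farity L f \<and> (\<forall>b\<in>set (map (wf_trm L) ts). b)"

primrec wf_fm :: "('f, 'r) lang \<Rightarrow> ('f, 'r) fm \<Rightarrow> bool" where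
  "wf_fm L (Eq s t) \<longleftrightarrow> wf_trm L s \<and> wf_trm L t"
| "wf_fm L (Rel r ts) \<longleftrightarrow> length ts = rarity L r \<and> (\<forall>t\<in>set ts. wf_trm L t)"
| "wf_fm L (Neg p) \<longleftrightarrow> wf_fm L p"
| "wf_fm L (Conj p q) \<longleftrightarrow> wf_fm L p \<and> wf_fm L q"
| "wf_fm L (Ex i p) \<longleftrightarrow> wf_fm L p"

primrec fv_trm :: "'f trm \<Rightarrow> nat set" where
  "fv_trm (Var i) = {i}"
| "fv_trm (App f ts) = \<Union> (set (map fv_trm ts))"

primrec fv :: "('f, 'r) fm \<Rightarrow> nat set" where
  "fv (Eq s t) = fv_trm s \<union> fv_trm t"
| "fv (Rel r ts) = (\<Union>t\<in>set ts. fv_trm t)"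
| "fv (Neg p) = fv p"
| "fv (Conj p q) = fv p \<union> fv q"
| "fv (Ex i p) = fv p - {i}"

text \<open>Symbols are interpreted by functions on lists; only the values at lists of the right
  length with entries in the carrier matter.\<close>

record ('a, 'f, 'r) struct =
  univ :: "'a set"
  funs :: "'f \<Rightarrow> 'a list \<Rightarrow> 'a"
  rels :: "'r \<Rightarrow> 'a list \<Rightarrow> bool"

definition is_struct :: "('f, 'r) lang \<Rightarrow> ('a, 'f, 'r) struct \<Rightarrow> bool" where
  "is_struct L M \<longleftrightarrow> univ M \<noteq> {} \<and>
     (\<forall>f xs. length xs = farity L f \<and> set xs \<subseteq> univ M \<longrightarrow> funs M f xs \<in> univ M)"

primrec eval_trm :: "('a, 'f, 'r) struct \<Rightarrow> (nat \<Rightarrow> 'a) \<Rightarrow> 'f trm \<Rightarrow> 'a" where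
  "eval_trm M e (Var i) = e i"
| "eval_trm M e (App f ts) = funs M f (map (eval_trm M e) ts)"

primrec sat :: "('a, 'f, 'r) struct \<Rightarrow> (nat \<Rightarrow> 'a) \<Rightarrow> ('f, 'r) fm \<Rightarrow> bool" where
  "sat M e (Eq s t) \<longleftrightarrow> eval_trm M e s = eval_trm M e t"
| "sat M e (Rel r ts) \<longleftrightarrow> rels M r (map (eval_trm M e) ts)"
| "sat M e (Neg p) \<longleftrightarrow> \<not> sat M e p"
| "sat M e (Conj p q) \<longleftrightarrow> sat M e p \<and> sat M e q"
| "sat M e (Ex i p) \<longleftrightarrow> (\<exists>a\<in>univ M. sat M (e(i := a)) p)"

text \<open>\<open>holds M \<phi> xs\<close> assigns \<open>xs ! i\<close> to variable \<open>i\<close>. It is only used when the free variables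
  of \<open>\<phi>\<close> are below \<open>length xs\<close>, as expressed by \<open>fm_in\<close>. A formula \<open>\<phi>(x\<^sub>0, \<dots>, x\<^sub>k\<^sub>-\<^sub>1)\<close> with
  parameters is a pair of a formula \<open>\<phi>\<close> and a list \<open>ps\<close> of parameters that is
  assigned to the variables \<open>k, k + 1, \<dots>\<close>.\<close>

definition holds :: "('a, 'f, 'r) struct \<Rightarrow> ('f, 'r) fm \<Rightarrow> 'a list \<Rightarrow> bool" where
  "holds M \<phi> xs \<longleftrightarrow> sat M (\<lambda>i. xs ! i) \<phi>"

definition fm_in :: "('f, 'r) lang \<Rightarrow> nat \<Rightarrow> ('f, 'r) fm \<Rightarrow> bool" where
  "fm_in L k \<phi> \<longleftrightarrow> wf_fm L \<phi> \<and> fv \<phi> \<subseteq> {..<k}"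

definition definable :: "('f, 'r) lang \<Rightarrow> ('a, 'f, 'r) struct \<Rightarrow> nat \<Rightarrow> 'a list set \<Rightarrow> bool" where
  "definable L M k S \<longleftrightarrow> (\<exists>\<phi> ps. set ps \<subseteq> univ M \<and> fm_in L (k + length ps) \<phi> \<and>
     S = {xs. length xs = k \<and> set xs \<subseteq> univ M \<and> holds M \<phi> (xs @ ps)})"

definition definable_set :: "('f, 'r) lang \<Rightarrow> ('a, 'f, 'r) struct \<Rightarrow> 'a set \<Rightarrow> bool" where
  "definable_set L M X \<longleftrightarrow> definable L M 1 {[x] |x. x \<in> X}"

definition definable_rel :: "('f, 'r) lang \<Rightarrow> ('a, 'f, 'r) struct \<Rightarrow> ('a \<times> 'a) set \<Rightarrow> bool" where
  "definable_rel L M E \<longleftrightarrow> definable L M 2 {[x, y] |x y. (x, y) \<in> E}"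

definition theory_of :: "('f, 'r) lang \<Rightarrow> ('a, 'f, 'r) struct \<Rightarrow> ('f, 'r) fm set" where
  "theory_of L M = {\<phi>. fm_in L 0 \<phi> \<and> holds M \<phi> []}"

definition models :: "('f, 'r) lang \<Rightarrow> ('a, 'f, 'r) struct \<Rightarrow> ('f, 'r) fm set \<Rightarrow> bool" where
  "models L M T \<longleftrightarrow> is_struct L M \<and> (\<forall>\<phi>\<in>T. holds M \<phi> [])"

section \<open>Saturation\<close>

definition saturated :: "('f, 'r) lang \<Rightarrow> 'k rel \<Rightarrow> ('a, 'f, 'r) struct \<Rightarrow> bool" where
  "saturated L \<kappa> N \<longleftrightarrow> (\<forall>A p. A \<subseteq> univ N \<and> |A| <o \<kappa> \<and>
     p \<subseteq> {(\<phi>, ps). set ps \<subseteq> A \<and> fm_in L (1 + length ps) \<phi>} \<and>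
     (\<forall>q. q \<subseteq> p \<and> finite q \<longrightarrow> (\<exists>x\<in>univ N. \<forall>(\<phi>, ps)\<in>q. holds N \<phi> (x # ps)))
     \<longrightarrow> (\<exists>x\<in>univ N. \<forall>(\<phi>, ps)\<in>p. holds N \<phi> (x # ps)))"

text \<open>\<open>N\<close> is highly saturated, with \<open>\<kappa>\<close> as the bound on the size of small sets: \<open>\<kappa>\<close> is a
  cardinal greater than \<open>|L| + \<aleph>\<^sub>0\<close>, where \<open>|L|\<close> is the number of symbols of the language.\<close>

definition highly_saturated ::
    "('f, 'r) lang \<Rightarrow> 'k rel \<Rightarrow> ('a, 'f, 'r) struct \<Rightarrow> bool" where
  "highly_saturated L \<kappa> N \<longleftrightarrow>
     Card_order \<kappa> \<and> |UNIV :: ('f + 'r + nat) set| <o \<kappa> \<and> saturated L \<kappa> N"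

section \<open>Indiscernibles and dp-minimality\<close>

text \<open>Sequences are indexed by \<open>nat\<close>. A tuple is a list, and an element is a list of length 1.\<close>

definition tuple_seq :: "('a, 'f, 'r) struct \<Rightarrow> (nat \<Rightarrow> 'a list) \<Rightarrow> bool" where
  "tuple_seq N I \<longleftrightarrow> (\<exists>m. \<forall>i. length (I i) = m \<and> set (I i) \<subseteq> univ N)"

definition indiscernible ::
    "('f, 'r) lang \<Rightarrow> ('a, 'f, 'r) struct \<Rightarrow> 'a set \<Rightarrow> (nat \<Rightarrow> 'a list) \<Rightarrow> bool" where
  "indiscernible L N A I \<longleftrightarrow> (\<forall>\<phi> ps is js.
     set ps \<subseteq> A \<and> sorted_wrt (<) is \<and> sorted_wrt (<) js \<and> length is = length js \<and>
     fm_in L (length (concat (map I is) @ ps)) \<phi>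
     \<longrightarrow> (holds N \<phi> (concat (map I is) @ ps) \<longleftrightarrow> holds N \<phi> (concat (map I js) @ ps)))"

definition mutually_indiscernible ::
    "('f, 'r) lang \<Rightarrow> ('a, 'f, 'r) struct \<Rightarrow> 'a set \<Rightarrow> 't set \<Rightarrow> ('t \<Rightarrow> nat \<Rightarrow> 'a list) \<Rightarrow> bool" where
  "mutually_indiscernible L N A X I \<longleftrightarrow>
     (\<forall>t\<in>X. indiscernible L N (A \<union> (\<Union>s\<in>X - {t}. \<Union>i. set (I s i))) (I t))"

text \<open>HOL cannot quantify over models of all sizes inside a definition, so the models in
  \<open>dp_minimal_theory\<close> have their elements, and \<open>\<kappa>\<close> its field, in the following type of cardinality
  \<open>2\<close> to the power \<open>|L| + \<aleph>\<^sub>0\<close>. This loses nothing. A complete theory has a model of at most that size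
  that is saturated for the successor of \<open>|L| + \<aleph>\<^sub>0\<close>. A counterexample to the defining condition in
  any model remains one for a finite subset of \<open>A\<close>, and its (countable) type is then
  realized in every highly saturated model of the theory. Conversely, a counterexample in a highly
  saturated model remains one in all elementary extensions.\<close>

type_synonym ('f, 'r) big = "('f + 'r + nat) set"

definition dp_minimal_theory :: "('f, 'r) lang \<Rightarrow> ('f, 'r) fm set \<Rightarrow> bool" where
  "dp_minimal_theory L T \<longleftrightarrow>
     (\<forall>(N :: (('f, 'r) big, 'f, 'r) struct) (\<kappa> :: ('f, 'r) big rel).
        models L N T \<and> highly_saturated L \<kappa> N \<longrightarrow>
        (\<forall>A (I :: nat \<Rightarrow> nat \<Rightarrow> ('f, 'r) big list) b.
           A \<subseteq> univ N \<and> |A| <o \<kappa> \<and> (\<forall>t\<in>{0, 1}. tuple_seq N (I t)) \<and>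
           mutually_indiscernible L N A {0, 1} I \<and> b \<in> univ N
           \<longrightarrow> (\<exists>t\<in>{0, 1}. indiscernible L N (insert b A) (I t))))"

definition dp_minimal :: "('f, 'r) lang \<Rightarrow> ('a, 'f, 'r) struct \<Rightarrow> bool" where
  "dp_minimal L M \<longleftrightarrow> dp_minimal_theory L (theory_of L M)"

section \<open>Expansions of ordered abelian groups\<close>

definition expands_ordered_group ::
    "('f, 'r) lang \<Rightarrow> ('a::linordered_ab_group_add, 'f, 'r) struct \<Rightarrow> bool" where
  "expands_ordered_group L M \<longleftrightarrow> is_struct L M \<and> univ M = UNIV \<and>
     (\<exists>f. farity L f = 2 \<and> (\<forall>x y. funs M f [x, y] = x + y)) \<and>
     (\<exists>r. rarity L r = 2 \<and> (\<forall>x y. rels M r [x, y] \<longleftrightarrow> x < y))"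

definition order_convex :: "'a::linorder set \<Rightarrow> bool" where
  "order_convex C \<longleftrightarrow> (\<forall>a\<in>C. \<forall>a'\<in>C. \<forall>b. a < b \<and> b < a' \<longrightarrow> b \<in> C)"

definition convex_equiv :: "('a::linorder \<times> 'a) set \<Rightarrow> bool" where
  "convex_equiv E \<longleftrightarrow> equiv UNIV E \<and> (\<forall>C\<in>UNIV // E. order_convex C)"

definition multiples :: "nat \<Rightarrow> 'a::comm_monoid_add set" where
  "multiples n = range (\<lambda>x. \<Sum>i<n. x)"

end

theory Submission
  imports Defs "HOL-Library.Ramsey"
begin

text \<open>
  All uses of dp-minimality go through one consequence, \<open>no_pattern\<close>: for a definable binary relation
  \<open>P\<close> there cannot be, for every \<open>N\<close>, elements \<open>a\<^sub>0, \<dots>, a\<^sub>N\<^sub>-\<^sub>1\<close> and cut points \<open>h\<^sub>0 < \<dots> < h\<^sub>N\<close> such that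
  any two of the sets \<open>P(a\<^sub>i, _)\<close> differ inside each interval \<open>[h\<^sub>j, h\<^sub>j\<^sub>+\<^sub>1)\<close>. Otherwise Ramsey's theorem and
  compactness turn the \<open>a\<^sub>i\<close> and the \<open>h\<^sub>j\<close> into mutually indiscernible sequences of a saturated model
  with an element \<open>b\<close> of \<open>[h\<^sub>0, h\<^sub>1)\<close> at which \<open>P(a\<^sub>0, _)\<close> and \<open>P(a\<^sub>1, _)\<close> differ, and over \<open>b\<close> neither
  sequence is indiscernible.

  The saturated model has to live on the type \<open>big\<close>. Its elements are named by the datatype \<open>cst\<close>,
  which contains a constant \<open>Wit p\<close> for every enumeration \<open>p\<close> of at most \<open>|L| + \<aleph>\<^sub>0\<close> formulas with
  earlier constants as parameters; trees of this shape are coded by subsets of \<open>'f + 'r + nat\<close>. An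
  ultrafilter on the assignments of the constants in \<open>M\<close>, chosen so that \<open>Wit p\<close> realizes \<open>p\<close> whenever
  \<open>p\<close> is finitely satisfiable (\<open>deciding_family\<close>), makes the constants into a model: a Los theorem holds
  and every small type is realized (\<open>Los\<close>, \<open>saturated_N\<close>).

  In the group, \<open>nM\<close> has finite index for \<open>n > 0\<close> (\<open>finite_index\<close>). Let two points be equivalent if,
  between them, no coset \<open>h + nM\<close> changes the answer to the question whether its last elements
  belong to \<open>X\<close>. This is a definable convex equivalence relation, and on each class \<open>X\<close> is a union of
  cosets of \<open>nM\<close> (\<open>same_run_mem\<close>). It remains to find \<open>n\<close> for which only finitely many points have a
  finite class.

  If there is a least positive element \<open>u\<close>, then the germs at infinity of the sets \<open>X - x\<close> along
  \<open>u, 2u, 3u, \<dots>\<close> are finite in number, whence \<open>X\<close> is eventually periodic on each coset of \<open>\<int>u\<close>, in both directions and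
  with one period \<open>n\<close>. The set \<open>D\<close> of points where the period fails is definable and meets each
  coset of \<open>\<int>u\<close> in a finite set. If it were infinite, suitable translates of \<open>D\<close> by multiples of \<open>u\<close>
  would form a pattern (\<open>sparse_False\<close>). So \<open>D\<close> is finite, and a point with a finite class lies between
  two points of \<open>D\<close>, up to \<open>n\<close> steps.

  Otherwise the order is dense. Again the germs at \<open>0\<^sup>+\<close> of the sets \<open>X - x\<close> are finite in number, and every
  interval has a subinterval on whose points they are compared with representatives at a uniform
  distance (\<open>uniform_radius\<close>). If there are \<open>k\<close> germs, the pigeonhole principle applied to
  \<open>x, x + s, \<dots>, x + ks\<close> shows that \<open>X\<close> is invariant under \<open>k!M\<close> on a smaller interval. So the points
  near which \<open>X\<close> is not \<open>k!M\<close>-invariant form a nowhere dense definable set, and such a set is finite,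
  again by \<open>sparse_False\<close>. Near any other point the cosets of \<open>k!M\<close> are dense or absent, and a whole
  interval lies in one class.
\<close>


section \<open>Renaming variables\<close>

primrec ren_trm :: "(nat \<Rightarrow> nat) \<Rightarrow> 'f trm \<Rightarrow> 'f trm" where
  "ren_trm r (Var i) = Var (r i)"
| "ren_trm r (App f ts) = App f (map (ren_trm r) ts)"

primrec ren :: "(nat \<Rightarrow> nat) \<Rightarrow> ('f, 'r) fm \<Rightarrow> ('f, 'r) fm" where
  "ren r (Eq s t) = Eq (ren_trm r s) (ren_trm r t)"
| "ren r (Rel R ts) = Rel R (map (ren_trm r) ts)"
| "ren r (Neg p) = Neg (ren r p)"
| "ren r (Conj p q) = Conj (ren r p) (ren r q)"
| "ren r (Ex i p) = Ex (r i) (ren r p)"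

lemma eval_ren_trm: "eval_trm M e (ren_trm r t) = eval_trm M (\<lambda>i. e (r i)) t"
proof (induction t)
  case (App f ts)
  then have "map (\<lambda>t. eval_trm M e (ren_trm r t)) ts = map (eval_trm M (\<lambda>i. e (r i))) ts"
    by (simp add: map_eq_conv)
  then show ?case unfolding ren_trm.simps eval_trm.simps list.map_comp comp_def by (rule arg_cong)
qed simp

lemma wf_ren_trm: "wf_trm L (ren_trm r t) \<longleftrightarrow> wf_trm L t"
  by (induction t) auto

lemma fv_ren_trm: "fv_trm (ren_trm r t) = r ` fv_trm t"
  by (induction t) auto

lemma sat_ren: "inj r \<Longrightarrow> sat M e (ren r \<phi>) \<longleftrightarrow> sat M (\<lambda>i. e (r i)) \<phi>"
proof (induction \<phi> arbitrary: e)
  case (Rel R ts)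
  then show ?case by (simp add: eval_ren_trm comp_def)
next
  case (Ex i p)
  have "(\<lambda>j. (e(r i := a)) (r j)) = (\<lambda>j. e (r j))(i := a)" for a
    using Ex.prems by (auto simp: fun_eq_iff inj_eq)
  then show ?case unfolding ren.simps sat.simps Ex.IH[OF Ex.prems] by simp
qed (auto simp: eval_ren_trm)

lemma wf_ren: "wf_fm L (ren r \<phi>) \<longleftrightarrow> wf_fm L \<phi>"
  by (induction \<phi>) (auto simp: wf_ren_trm)

lemma fv_ren: "inj r \<Longrightarrow> fv (ren r \<phi>) = r ` fv \<phi>"
  by (induction \<phi>) (auto simp: fv_ren_trm inj_eq)

lemma eval_trm_cong: "(\<And>i. i \<in> fv_trm t \<Longrightarrow> e i = e' i) \<Longrightarrow> eval_trm M e t = eval_trm M e' t"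
proof (induction t)
  case (App f ts)
  then have "map (eval_trm M e) ts = map (eval_trm M e') ts"
    by (auto simp: map_eq_conv)
  then show ?case by (simp only: eval_trm.simps)
qed simp

lemma sat_cong: "(\<And>i. i \<in> fv \<phi> \<Longrightarrow> e i = e' i) \<Longrightarrow> sat M e \<phi> \<longleftrightarrow> sat M e' \<phi>"
proof (induction \<phi> arbitrary: e e')
  case (Eq s t)
  then show ?case using eval_trm_cong[of s e e' M] eval_trm_cong[of t e e' M] by auto
next
  case (Rel R ts)
  then have "map (eval_trm M e) ts = map (eval_trm M e') ts"
    by (auto simp: map_eq_conv intro!: eval_trm_cong)
  then show ?case by (simp only: sat.simps)
next
  case (Neg p)
  show ?case using Neg.IH[of e e'] Neg.prems by simp
next
  case (Conj p q)
  show ?case using Conj.IH(1)[of e e'] Conj.IH(2)[of e e'] Conj.prems by simp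
next
  case (Ex i p)
  have "sat M (e(i := a)) p \<longleftrightarrow> sat M (e'(i := a)) p" for a
    by (rule Ex.IH) (use Ex.prems in auto)
  then show ?case by simp
qed

lemma finite_fv_trm: "finite (fv_trm t)"
  by (induction t) auto

lemma finite_fv: "finite (fv \<phi>)"
  by (induction \<phi>) (auto simp: finite_fv_trm)

section \<open>Counting formulas\<close>

text \<open>Prefix codes: a code determines the term at its beginning and what follows.\<close>

primrec code_trm :: "'f trm \<Rightarrow> ('f + 'r + nat) list" where
  "code_trm (Var i) = [Inr (Inr i)]"
| "code_trm (App f ts) = Inl f # Inr (Inr (length ts)) # concat (map code_trm ts)"

lemma code_trms_inject:
  fixes u u' :: "('f + 'r + nat) list"
  assumes "\<And>t t' (u :: ('f + 'r + nat) list) u'. t \<in> set ts \<Longrightarrow> code_trm t @ u = code_trm t' @ u' \<Longrightarrow> t = t' \<and> u = u'"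
    and "concat (map code_trm ts) @ u = concat (map code_trm ts') @ u'" "length ts = length ts'"
  shows "ts = ts' \<and> u = u'"
  using assms(3,1,2)
proof (induction ts ts' rule: list_induct2)
  case (Cons t ts t' ts')
  have "t = t' \<and> concat (map code_trm ts) @ u = concat (map code_trm ts') @ u'"
    using Cons.prems(1)[of t "concat (map code_trm ts) @ u" t' "concat (map code_trm ts') @ u'"]
      Cons.prems(2) by simp
  moreover have "ts = ts' \<and> u = u'"
    by (rule Cons.IH) (use calculation Cons.prems(1) in auto)
  ultimately show ?case by simp
qed simp

lemma code_trm_inject:
  fixes u u' :: "('f + 'r + nat) list"
  shows "code_trm t @ u = code_trm t' @ u' \<Longrightarrow> t = t' \<and> u = u'"
proof (induction t arbitrary: t' u u')
  case (Var i)
  then show ?case by (cases t') auto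
next
  case (App f ts)
  from App.prems obtain ts' where t': "t' = App f ts'" by (cases t') auto
  have "concat (map code_trm ts) @ u = concat (map code_trm ts') @ u'" "length ts = length ts'"
    using App.prems unfolding t' by auto
  from code_trms_inject[OF App.IH this] show ?case unfolding t' by blast
qed

primrec code_fm :: "('f, 'r) fm \<Rightarrow> ('f + 'r + nat) list" where
  "code_fm (Eq s t) = Inr (Inr 0) # code_trm s @ code_trm t"
| "code_fm (Rel R ts) = Inr (Inl R) # Inr (Inr (length ts)) # concat (map code_trm ts)"
| "code_fm (Neg p) = Inr (Inr 1) # code_fm p"
| "code_fm (Conj p q) = Inr (Inr 2) # code_fm p @ code_fm q"
| "code_fm (Ex i p) = Inr (Inr 3) # Inr (Inr i) # code_fm p"

lemma code_fm_inject:
  fixes u u' :: "('f + 'r + nat) list"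
  shows "code_fm p @ u = code_fm p' @ u' \<Longrightarrow> p = p' \<and> u = u'"
proof (induction p arbitrary: p' u u')
  case (Eq s t)
  then obtain s' t' where "p' = Eq s' t'" by (cases p') auto
  then have "code_trm s @ code_trm t @ u = code_trm s' @ code_trm t' @ u'" using Eq by simp
  from code_trm_inject[OF this] code_trm_inject[of t u t' u'] \<open>p' = Eq s' t'\<close> show ?case by blast
next
  case (Rel R ts)
  then obtain ts' where p': "p' = Rel R ts'" by (cases p') auto
  have "concat (map code_trm ts) @ u = concat (map code_trm ts') @ u'" "length ts = length ts'"
    using Rel.prems unfolding p' by auto
  from code_trms_inject[OF code_trm_inject this] show ?case unfolding p' by blast
next
  case (Neg p)
  from Neg.prems obtain q where "p' = Neg q" by (cases p') auto
  with Neg.prems Neg.IH[of u q u'] show ?case by simp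
next
  case (Conj p q)
  from Conj.prems obtain p1 p2 where "p' = Conj p1 p2" by (cases p') auto
  then have "code_fm p @ code_fm q @ u = code_fm p1 @ code_fm p2 @ u'" using Conj.prems by simp
  from Conj.IH(1)[OF this] Conj.IH(2)[of u p2 u'] \<open>p' = Conj p1 p2\<close> show ?case by blast
next
  case (Ex i p)
  from Ex.prems obtain j q where "p' = Ex j q" by (cases p') auto
  with Ex.prems Ex.IH[of u q u'] show ?case by simp
qed

lemma inj_code_fm: "inj (code_fm :: ('f, 'r) fm \<Rightarrow> ('f + 'r + nat) list)"
  by (rule injI) (metis append_Nil2 code_fm_inject)

lemma infinite_symbols: "infinite (UNIV :: ('f + 'r + nat) set)"
  by (simp add: finite_Plus_UNIV_iff)

lemma inj_pair_infinite:
  assumes "infinite (UNIV :: 'x set)"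
  shows "\<exists>g :: 'x \<times> 'x \<Rightarrow> 'x. inj g"
proof -
  have "|(UNIV :: 'x set) \<times> (UNIV :: 'x set)| =o |UNIV :: 'x set|"
    using assms by (rule card_of_Times_same_infinite)
  then have "|UNIV :: ('x \<times> 'x) set| \<le>o |UNIV :: 'x set|"
    unfolding UNIV_Times_UNIV by (rule ordIso_imp_ordLeq)
  then obtain g :: "'x \<times> 'x \<Rightarrow> 'x" where "inj g"
    using card_of_ordLeq[of "UNIV :: ('x \<times> 'x) set" "UNIV :: 'x set"] by blast
  then show ?thesis by blast
qed

lemma inj_list_infinite:
  assumes "infinite (UNIV :: 'x set)"
  shows "\<exists>g :: 'x list \<Rightarrow> 'x. inj g"
proof -
  obtain \<pi> :: "'x \<times> 'x \<Rightarrow> 'x" where \<pi>: "inj \<pi>" using inj_pair_infinite[OF assms] by blast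
  obtain \<nu> :: "nat \<Rightarrow> 'x" where \<nu>: "inj \<nu>" using infinite_countable_subset[OF assms] by blast
  define f where "f = rec_list (\<nu> 0) (\<lambda>x xs y. \<pi> (x, y))"
  have f: "f [] = \<nu> 0" "f (x # xs) = \<pi> (x, f xs)" for x xs
    by (simp_all add: f_def)
  have "length xs = length ys \<Longrightarrow> f xs = f ys \<Longrightarrow> xs = ys" for xs ys
    by (induction xs ys rule: list_induct2) (auto simp: f inj_eq[OF \<pi>])
  then have "inj (\<lambda>xs. \<pi> (\<nu> (length xs), f xs))"
    by (intro injI) (simp add: inj_eq[OF \<pi>] inj_eq[OF \<nu>])
  then show ?thesis by blast
qed

lemma inj_fm: "\<exists>g :: ('f, 'r) fm \<Rightarrow> 'f + 'r + nat. inj g"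
proof -
  obtain g :: "('f + 'r + nat) list \<Rightarrow> 'f + 'r + nat" where "inj g"
    using inj_list_infinite[OF infinite_symbols] by blast
  then have "inj (g \<circ> code_fm)" using inj_code_fm by (rule inj_compose)
  then show ?thesis by blast
qed

section \<open>Constants for realizations of types\<close>

text \<open>\<open>Wit p\<close> is meant to realize the type \<open>{\<phi>(x, cs). (\<phi>, cs) \<in> range p}\<close>. By the recursion, the
  constants in \<open>p\<close> are different from \<open>Wit p\<close>. The constants \<open>Base i j\<close> carry the configuration that the
  model is to contain.\<close>

datatype ('f, 'r) cst =
    Base nat nat
  | Wit "'f + 'r + nat \<Rightarrow> ('f, 'r) fm \<times> ('f, 'r) cst list"

text \<open>A constant is determined by the labels along its paths when it is regarded as a tree. The formulas
  of \<open>Wit p\<close> and the lengths of its parameter lists are attached to the paths \<open>[(x, 0)]\<close>. At these paths, the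
  children of \<open>Wit p\<close> contribute only \<open>Inr\<close> labels, so nothing is confused.\<close>

inductive node :: "(('f + 'r + nat) \<times> nat) list \<Rightarrow> (('f, 'r) fm \<times> nat) + (nat \<times> nat) \<Rightarrow> ('f, 'r) cst \<Rightarrow> bool" where
  base: "node [] (Inr (i, j)) (Base i j)"
| label: "node [(x, 0)] (Inl (fst (p x), length (snd (p x)))) (Wit p)"
| child: "k < length (snd (p x)) \<Longrightarrow> node \<pi> l (snd (p x) ! k) \<Longrightarrow> node ((x, k) # \<pi>) l (Wit p)"

inductive_simps node_Base: "node \<pi> l (Base i j)"
inductive_simps node_Wit: "node \<pi> l (Wit p)"

lemma not_node_Nil_Inl: "\<not> node [] (Inl z) c"
  by (cases c) (auto simp: node_Base node_Wit)

lemma node_Wit_Inl: "node [(x, 0)] (Inl z) (Wit p) \<longleftrightarrow> z = (fst (p x), length (snd (p x)))"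
  by (auto simp: node_Wit not_node_Nil_Inl)

lemma node_Wit_Cons:
  assumes "k < length (snd (p x))"
  shows "node \<pi> l (snd (p x) ! k) \<longleftrightarrow> node ((x, k) # \<pi>) l (Wit p) \<and> \<not> (\<pi> = [] \<and> (\<exists>z. l = Inl z))"
  using assms by (auto simp: node_Wit not_node_Nil_Inl)

lemma node_inject: "(\<And>\<pi> l. node \<pi> l c \<longleftrightarrow> node \<pi> l d) \<Longrightarrow> c = d"
proof (induction c arbitrary: d)
  case (Base i j)
  have "node [] (Inr (i, j)) d" using Base base by metis
  then show ?case by (cases d) (auto simp: node_Base node_Wit)
next
  case (Wit p)
  obtain q where d: "d = Wit q"
  proof (cases d)
    case (Base i j)
    have "node [] (Inr (i, j)) (Wit p)" using Wit.prems Base base by metis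
    then show ?thesis by (auto simp: node_Wit)
  qed
  have lab: "fst (p x) = fst (q x) \<and> length (snd (p x)) = length (snd (q x))" for x
    using Wit.prems[of "[(x, 0)]" "Inl (fst (p x), length (snd (p x)))"] by (simp add: d node_Wit_Inl)
  have "snd (p x) = snd (q x)" for x
  proof (rule nth_equalityI)
    show "length (snd (p x)) = length (snd (q x))" using lab by blast
    fix k assume k: "k < length (snd (p x))"
    show "snd (p x) ! k = snd (q x) ! k"
    proof (rule Wit.IH)
      show "p x \<in> range p" by simp
      show "snd (p x) \<in> Basic_BNFs.snds (p x)" by (simp add: snds.simps)
      show "snd (p x) ! k \<in> set (snd (p x))" using k by simp
      show "node \<pi> l (snd (p x) ! k) \<longleftrightarrow> node \<pi> l (snd (q x) ! k)" for \<pi> l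
        using node_Wit_Cons[of k p x \<pi> l] node_Wit_Cons[of k q x \<pi> l] k lab[of x]
          Wit.prems[of "(x, k) # \<pi>" l] d by simp
    qed
  qed
  with lab have "p = q" by (intro ext prod_eqI) auto
  then show ?case by (simp add: d)
qed

text \<open>Paths and labels are coded by symbols, so a constant becomes a set of symbols.\<close>

lemma inj_cst: "\<exists>g :: ('f, 'r) cst \<Rightarrow> ('f, 'r) big. inj g"
proof -
  obtain \<pi> :: "('f + 'r + nat) \<times> ('f + 'r + nat) \<Rightarrow> 'f + 'r + nat" where \<pi>: "inj \<pi>"
    using inj_pair_infinite[OF infinite_symbols] by blast
  obtain lc :: "('f + 'r + nat) list \<Rightarrow> 'f + 'r + nat" where l: "inj lc"
    using inj_list_infinite[OF infinite_symbols] by blast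
  obtain \<gamma> :: "('f, 'r) fm \<Rightarrow> 'f + 'r + nat" where g: "inj \<gamma>" using inj_fm by blast
  define \<nu> where "\<nu> k = (Inr (Inr k) :: 'f + 'r + nat)" for k
  define P where "P \<rho> = lc (map (\<lambda>(x, k). \<pi> (x, \<nu> k)) \<rho>)" for \<rho> :: "(('f + 'r + nat) \<times> nat) list"
  define Q where "Q = case_sum (\<lambda>(\<phi>, k). lc [\<gamma> \<phi>, \<nu> k]) (\<lambda>(i, j). lc [\<nu> i, \<nu> j, \<nu> 0])"
  have "inj P"
  proof (rule injI)
    fix \<rho> \<sigma> assume "P \<rho> = P \<sigma>"
    then have "map (\<lambda>(x, k). \<pi> (x, \<nu> k)) \<rho> = map (\<lambda>(x, k). \<pi> (x, \<nu> k)) \<sigma>"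
      by (simp add: P_def inj_eq[OF l])
    moreover have "inj (\<lambda>(x, k). \<pi> (x, \<nu> k))"
      by (rule injI) (simp add: \<nu>_def inj_eq[OF \<pi>] split: prod.splits)
    ultimately show "\<rho> = \<sigma>" by (simp add: inj_map_eq_map)
  qed
  have "inj Q"
    by (rule injI) (simp add: Q_def \<nu>_def inj_eq[OF l] inj_eq[OF g] split: sum.splits prod.splits)
  define G where "G c = {\<pi> (P \<rho>, Q l) |\<rho> l. node \<rho> l c}" for c
  have "\<pi> (P \<rho>, Q l) \<in> G c \<longleftrightarrow> node \<rho> l c" for \<rho> l c
    by (simp add: G_def inj_eq[OF \<pi>] inj_eq[OF \<open>inj P\<close>] inj_eq[OF \<open>inj Q\<close>])
  then have "inj G" by (intro injI node_inject) blast
  then show ?thesis by blast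
qed

section \<open>Ultrafilters\<close>

definition fip :: "'w set set \<Rightarrow> bool" where
  "fip F \<longleftrightarrow> (\<forall>\<Delta>. finite \<Delta> \<and> \<Delta> \<subseteq> F \<longrightarrow> \<Inter>\<Delta> \<noteq> {})"

text \<open>These two properties characterize ultrafilters; closure under intersections and supersets follows.\<close>

definition ultra :: "'w set set \<Rightarrow> bool" where
  "ultra U \<longleftrightarrow> fip U \<and> (\<forall>Y. Y \<in> U \<or> - Y \<in> U)"

lemma fipD: "fip F \<Longrightarrow> finite \<Delta> \<Longrightarrow> \<Delta> \<subseteq> F \<Longrightarrow> \<Inter>\<Delta> \<noteq> {}"
  by (auto simp: fip_def)

lemma fip_Union_chain:
  assumes "subset.chain A C" "C \<noteq> {}" "\<And>F. F \<in> C \<Longrightarrow> fip F"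
  shows "fip (\<Union>C)"
  unfolding fip_def
proof (intro allI impI, elim conjE)
  fix \<Delta> assume \<Delta>: "finite \<Delta>" "\<Delta> \<subseteq> \<Union>C"
  then obtain F where "F \<in> C" "\<Delta> \<subseteq> F"
    using finite_subset_Union_chain[OF \<Delta> assms(2,1)] by blast
  then show "\<Inter>\<Delta> \<noteq> {}"
    using assms(3) fipD \<Delta>(1) by blast
qed

lemma not_fip_insert:
  assumes "\<not> fip (insert Y F)"
  shows "\<exists>\<Delta>. finite \<Delta> \<and> \<Delta> \<subseteq> F \<and> \<Inter>\<Delta> \<inter> Y = {}"
proof -
  obtain \<Delta> where \<Delta>: "finite \<Delta>" "\<Delta> \<subseteq> insert Y F" "\<Inter>\<Delta> = {}"
    using assms by (auto simp: fip_def)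
  then have "finite (\<Delta> - {Y})" "\<Delta> - {Y} \<subseteq> F" "\<Inter>(\<Delta> - {Y}) \<inter> Y = {}"
    by (simp, blast, blast)
  then show ?thesis by blast
qed

lemma ultra_extension:
  assumes "fip F"
  shows "\<exists>U. F \<subseteq> U \<and> ultra U"
proof -
  let ?A = "{G. F \<subseteq> G \<and> fip G}"
  have "\<exists>U\<in>?A. \<forall>X\<in>?A. U \<subseteq> X \<longrightarrow> X = U"
  proof (rule subset_Zorn_nonempty)
    show "?A \<noteq> {}" using assms by auto
    fix C assume C: "C \<noteq> {}" "subset.chain ?A C"
    then have sub: "\<And>G. G \<in> C \<Longrightarrow> G \<in> ?A" by (auto simp: subset.chain_def)
    show "\<Union>C \<in> ?A"
      using sub C(1) fip_Union_chain[OF C(2,1)] by blast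
  qed
  then obtain U where U: "F \<subseteq> U" "fip U" and max: "\<And>X. fip X \<Longrightarrow> U \<subseteq> X \<Longrightarrow> X = U"
    by (metis (mono_tags, lifting) mem_Collect_eq order.trans)
  have "Y \<in> U \<or> - Y \<in> U" for Y
  proof (rule ccontr)
    assume "\<not> (Y \<in> U \<or> - Y \<in> U)"
    then have "\<not> fip (insert Y U)" "\<not> fip (insert (- Y) U)"
      using max[of "insert Y U"] max[of "insert (- Y) U"] by auto
    then obtain \<Delta> \<Delta>' where "finite \<Delta>" "\<Delta> \<subseteq> U" "\<Inter>\<Delta> \<inter> Y = {}" "finite \<Delta>'" "\<Delta>' \<subseteq> U" "\<Inter>\<Delta>' \<inter> - Y = {}"
      using not_fip_insert by metis
    then have "finite (\<Delta> \<union> \<Delta>')" "\<Delta> \<union> \<Delta>' \<subseteq> U" "\<Inter>(\<Delta> \<union> \<Delta>') = {}"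
      by (simp_all add: Inter_Un_distrib) blast
    with U(2) show False using fipD by blast
  qed
  with U show ?thesis by (auto simp: ultra_def)
qed

lemma ultra_fip: "ultra U \<Longrightarrow> fip U"
  by (simp add: ultra_def)

lemma ultra_superset:
  assumes "ultra U" "finite \<Delta>" "\<Delta> \<subseteq> U" "\<Inter>\<Delta> \<subseteq> Y"
  shows "Y \<in> U"
proof (rule ccontr)
  assume "Y \<notin> U"
  then have "- Y \<in> U" using assms(1) by (auto simp: ultra_def)
  then have "insert (- Y) \<Delta> \<subseteq> U" "finite (insert (- Y) \<Delta>)" using assms by auto
  moreover have "\<Inter>(insert (- Y) \<Delta>) = {}" using assms(4) by auto
  ultimately show False using assms(1) fipD unfolding ultra_def by blast
qed

lemma ultra_mono: "ultra U \<Longrightarrow> Y \<in> U \<Longrightarrow> Y \<subseteq> Z \<Longrightarrow> Z \<in> U"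
  using ultra_superset[of U "{Y}" Z] by auto

lemma ultra_Int_iff: "ultra U \<Longrightarrow> Y \<inter> Z \<in> U \<longleftrightarrow> Y \<in> U \<and> Z \<in> U"
proof -
  assume U: "ultra U"
  have "Y \<inter> Z \<in> U" if "Y \<in> U" "Z \<in> U"
    by (rule ultra_superset[OF U, of "{Y, Z}"]) (use that in auto)
  then show ?thesis using ultra_mono[OF U] by (meson Int_lower1 Int_lower2)
qed

lemma ultra_UNIV: "ultra U \<Longrightarrow> UNIV \<in> U"
  using ultra_superset[of U "{}" UNIV] by auto

lemma ultra_Compl_iff: "ultra U \<Longrightarrow> - Y \<in> U \<longleftrightarrow> Y \<notin> U"
  using fipD[OF ultra_fip, of U "{Y, - Y}"] ultra_def[of U] by simp blast

lemma ultra_conj: "ultra U \<Longrightarrow> {e. P e \<and> Q e} \<in> U \<longleftrightarrow> {e. P e} \<in> U \<and> {e. Q e} \<in> U"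
  using ultra_Int_iff[of U "{e. P e}" "{e. Q e}"] by (simp add: Collect_conj_eq)

lemma ultra_not: "ultra U \<Longrightarrow> {e. \<not> P e} \<in> U \<longleftrightarrow> {e. P e} \<notin> U"
  using ultra_Compl_iff[of U "{e. P e}"] by (simp add: Collect_neg_eq)

lemma ultra_imp: "ultra U \<Longrightarrow> {e. P e} \<in> U \<Longrightarrow> (\<And>e. P e \<Longrightarrow> Q e) \<Longrightarrow> {e. Q e} \<in> U"
  using ultra_mono[of U "{e. P e}" "{e. Q e}"] by auto

lemma ultra_iff:
  assumes "ultra U" "{e. R e} \<in> U" "\<And>e. R e \<Longrightarrow> P e \<longleftrightarrow> Q e"
  shows "{e. P e} \<in> U \<longleftrightarrow> {e. Q e} \<in> U"
proof -
  have "{e. P e \<and> R e} = {e. Q e \<and> R e}" using assms(3) by auto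
  then show ?thesis using ultra_conj[OF assms(1)] assms(2) by metis
qed

section \<open>Families of assignments that decide all small types\<close>

definition supported :: "'c set \<Rightarrow> ('c \<Rightarrow> 'a) set \<Rightarrow> bool" where
  "supported S Y \<longleftrightarrow> (\<forall>e e'. (\<forall>c\<in>S. e c = e' c) \<longrightarrow> e \<in> Y \<longrightarrow> e' \<in> Y)"

definition witness_set ::
    "('a, 'f, 'r) struct \<Rightarrow> ('f + 'r + nat \<Rightarrow> ('f, 'r) fm \<times> ('f, 'r) cst list) \<Rightarrow> 'f + 'r + nat \<Rightarrow> (('f, 'r) cst \<Rightarrow> 'a) set" where
  "witness_set M p x = {e. holds M (fst (p x)) (e (Wit p) # map e (snd (p x)))}"

definition solution_set ::
    "('a, 'f, 'r) struct \<Rightarrow> ('f + 'r + nat \<Rightarrow> ('f, 'r) fm \<times> ('f, 'r) cst list) \<Rightarrow> ('f + 'r + nat) set \<Rightarrow> (('f, 'r) cst \<Rightarrow> 'a) set" where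
  "solution_set M p P = {e. \<exists>a. \<forall>x\<in>P. holds M (fst (p x)) (a # map e (snd (p x)))}"

text \<open>Either \<open>F\<close> says that \<open>Wit p\<close> realizes \<open>p\<close>, or finitely many sets of \<open>F\<close> exclude a solution of some
  finite part of \<open>p\<close>. Both alternatives survive when \<open>F\<close> grows, which makes unions of chains possible.\<close>

definition decides ::
    "('a, 'f, 'r) struct \<Rightarrow> (('f, 'r) cst \<Rightarrow> 'a) set set \<Rightarrow> ('f + 'r + nat \<Rightarrow> ('f, 'r) fm \<times> ('f, 'r) cst list) \<Rightarrow> bool" where
  "decides M F p \<longleftrightarrow> range (witness_set M p) \<subseteq> F \<or>
     (\<exists>\<Delta> P. finite \<Delta> \<and> \<Delta> \<subseteq> F \<and> finite P \<and> \<Inter>\<Delta> \<inter> solution_set M p P = {})"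

lemma decides_mono: "decides M F p \<Longrightarrow> F \<subseteq> G \<Longrightarrow> decides M G p"
  unfolding decides_def by (meson subset_trans)

lemma supported_mono: "supported S Y \<Longrightarrow> S \<subseteq> T \<Longrightarrow> supported T Y"
  unfolding supported_def by (meson subsetD)

lemma supported_witness_set:
  fixes M :: "('a, 'f, 'r) struct"
  assumes "\<And>x. set (snd (p x)) \<subseteq> S" "Wit p \<in> S"
  shows "supported S (witness_set M p x)"
  unfolding supported_def
proof (intro allI impI)
  fix e e' :: "('f, 'r) cst \<Rightarrow> 'a"
  assume eq: "\<forall>c\<in>S. e c = e' c" and e: "e \<in> witness_set M p x"
  have "map e (snd (p x)) = map e' (snd (p x))" "e (Wit p) = e' (Wit p)"
    using eq assms by (auto simp: subset_iff)
  with e show "e' \<in> witness_set M p x" by (simp add: witness_set_def)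
qed

text \<open>If \<open>p(Wit p)\<close> is inconsistent with \<open>F\<close>, then \<open>F\<close> refutes \<open>p\<close>: the constant \<open>Wit p\<close> is fresh, so any
  solution of a finite part of \<open>p\<close> can be made its value.\<close>

lemma decides_of_inconsistent:
  assumes F: "fip F" "\<And>Y. Y \<in> F \<Longrightarrow> supported S Y"
    and p: "\<And>x. set (snd (p x)) \<subseteq> S" "Wit p \<notin> S"
    and nf: "\<not> fip (F \<union> range (witness_set M p))"
  shows "decides M F p"
proof -
  obtain \<Delta> where \<Delta>: "finite \<Delta>" "\<Delta> \<subseteq> F \<union> range (witness_set M p)" "\<Inter>\<Delta> = {}"
    using nf by (auto simp: fip_def)
  then have "\<Delta> - F \<subseteq> range (witness_set M p)" "finite (\<Delta> - F)" by auto
  then obtain P where P: "finite P" "\<Delta> - F = witness_set M p ` P"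
    by (meson finite_subset_image)
  have "e \<notin> solution_set M p P" if e: "e \<in> \<Inter>(\<Delta> \<inter> F)" for e
  proof
    assume "e \<in> solution_set M p P"
    then obtain a where a: "\<And>x. x \<in> P \<Longrightarrow> holds M (fst (p x)) (a # map e (snd (p x)))"
      by (auto simp: solution_set_def)
    let ?e = "e(Wit p := a)"
    have agree: "\<forall>c\<in>S. e c = ?e c" using p(2) by auto
    have "?e \<in> Y" if "Y \<in> \<Delta>" for Y
    proof (cases "Y \<in> F")
      case True
      then have "e \<in> Y" using that e by auto
      then show ?thesis using F(2)[OF True] agree unfolding supported_def by blast
    next
      case False
      then have "Y \<in> witness_set M p ` P" using P(2) that by blast
      then obtain x where x: "x \<in> P" "Y = witness_set M p x" by blast
      have "map ?e (snd (p x)) = map e (snd (p x))"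
        using p by (auto simp: map_eq_conv subset_iff)
      then have "?e \<in> witness_set M p x"
        using a[OF x(1)] unfolding witness_set_def mem_Collect_eq by (simp only: fun_upd_same)
      then show ?thesis by (simp only: x(2))
    qed
    then have "?e \<in> \<Inter>\<Delta>" by blast
    with \<Delta>(3) show False by blast
  qed
  then have "\<Inter>(\<Delta> \<inter> F) \<inter> solution_set M p P = {}" by auto
  moreover have "finite (\<Delta> \<inter> F)" using \<Delta>(1) by simp
  ultimately show ?thesis unfolding decides_def using P(1) by blast
qed

definition good :: "('a, 'f, 'r) struct \<Rightarrow> ('f, 'r) cst set \<Rightarrow> (('f, 'r) cst \<Rightarrow> 'a) set set \<Rightarrow> bool" where
  "good M S F \<longleftrightarrow> fip F \<and> (\<forall>Y\<in>F. supported S Y) \<and>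
     (\<forall>p. Wit p \<in> S \<longrightarrow> (\<forall>x. set (snd (p x)) \<subseteq> S) \<and> decides M F p)"

lemma good_extend:
  assumes good: "good M S F" and p: "\<And>x. set (snd (p x)) \<subseteq> S" "Wit p \<notin> S"
  shows "\<exists>G. F \<subseteq> G \<and> good M (insert (Wit p) S) G"
proof (cases "fip (F \<union> range (witness_set M p))")
  case True
  let ?G = "F \<union> range (witness_set M p)"
  have "supported (insert (Wit p) S) Y" if "Y \<in> ?G" for Y
    using that
  proof
    assume "Y \<in> F"
    then show ?thesis using good supported_mono unfolding good_def by blast
  next
    assume "Y \<in> range (witness_set M p)"
    then show ?thesis using supported_witness_set[of p "insert (Wit p) S"] p(1) by blast
  qed
  moreover have "decides M ?G q" if "q = p \<or> Wit q \<in> S" for q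
    using that
  proof
    assume "q = p"
    then show ?thesis by (auto simp: decides_def)
  next
    assume "Wit q \<in> S"
    then have "decides M F q" using good by (auto simp: good_def)
    then show ?thesis by (rule decides_mono) blast
  qed
  ultimately have "good M (insert (Wit p) S) ?G"
    using True good p(1) unfolding good_def by blast
  then show ?thesis by blast
next
  case False
  have "decides M F p"
    by (rule decides_of_inconsistent[OF _ _ p False]) (use good in \<open>auto simp: good_def\<close>)
  then have "good M (insert (Wit p) S) F"
    using good p(1) supported_mono[of S _ "insert (Wit p) S"] unfolding good_def by blast
  then show ?thesis by blast
qed

lemma good_chain:
  assumes ne: "C \<noteq> {}"
    and chain: "\<And>SF TG. SF \<in> C \<Longrightarrow> TG \<in> C \<Longrightarrow>
      fst SF \<subseteq> fst TG \<and> snd SF \<subseteq> snd TG \<or> fst TG \<subseteq> fst SF \<and> snd TG \<subseteq> snd SF"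
    and good: "\<And>SF. SF \<in> C \<Longrightarrow> good M (fst SF) (snd SF)"
  shows "good M (\<Union>(fst ` C)) (\<Union>(snd ` C))"
  unfolding good_def
proof (intro conjI ballI allI impI)
  have "subset.chain UNIV (snd ` C)"
  proof -
    have "B \<subseteq> B' \<or> B' \<subseteq> B" if "B \<in> snd ` C" "B' \<in> snd ` C" for B B'
    proof -
      from that(1) obtain SF where "SF \<in> C" "B = snd SF" by (elim imageE) blast
      moreover from that(2) obtain TG where "TG \<in> C" "B' = snd TG" by (elim imageE) blast

      ultimately show ?thesis using chain[of SF TG] by auto
    qed
    then show ?thesis by (auto simp: subset.chain_def)
  qed
  then show "fip (\<Union>(snd ` C))"
    by (rule fip_Union_chain) (use ne good in \<open>auto simp: good_def\<close>)
next
  fix Y assume "Y \<in> \<Union>(snd ` C)"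
  then obtain SF where "SF \<in> C" "Y \<in> snd SF" by blast
  then show "supported (\<Union>(fst ` C)) Y"
    using good[of SF] supported_mono[of "fst SF" Y "\<Union>(fst ` C)"] by (auto simp: good_def)
next
  fix p x assume "Wit p \<in> \<Union>(fst ` C)"
  then show "set (snd (p x)) \<subseteq> \<Union>(fst ` C)"
    using good by (fastforce simp: good_def)
next
  fix p assume "Wit p \<in> \<Union>(fst ` C)"
  then obtain SF where "SF \<in> C" "Wit p \<in> fst SF" by blast
  then show "decides M (\<Union>(snd ` C)) p"
    using good[of SF] decides_mono[of M "snd SF" p "\<Union>(snd ` C)"] by (auto simp: good_def)
qed

text \<open>A maximal pair of a set \<open>S\<close> of constants and a good family \<open>F\<close> supported by \<open>S\<close> has \<open>S = UNIV\<close>, by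
  induction on constants: once the constants in \<open>p\<close> are in \<open>S\<close>, the pair can be extended by \<open>Wit p\<close>. For
  Zorn's lemma, a pair is coded as a disjoint sum.\<close>

lemma deciding_family:
  fixes M :: "('a, 'f, 'r) struct"
  assumes F0: "fip F0" "\<And>Y. Y \<in> F0 \<Longrightarrow> supported {Base i j |i j. True} Y"
  shows "\<exists>F. F0 \<subseteq> F \<and> fip F \<and> (\<forall>p. decides M F p)"
proof -
  define B :: "('f, 'r) cst set" where "B = {Base i j |i j. True}"
  define A where "A = {Inl ` S \<union> Inr ` F |S F. B \<subseteq> S \<and> F0 \<subseteq> F \<and> good M S F}"
  have vim: "Inl -` (Inl ` S \<union> Inr ` F) = S" "Inr -` (Inl ` S \<union> Inr ` F) = F"
    for S :: "('f, 'r) cst set" and F :: "(('f, 'r) cst \<Rightarrow> 'a) set set" by auto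
  have "\<exists>Z\<in>A. \<forall>X\<in>A. Z \<subseteq> X \<longrightarrow> X = Z"
  proof (rule subset_Zorn_nonempty)
    have "good M B F0" using F0 by (auto simp: good_def B_def)
    then show "A \<noteq> {}" by (auto simp: A_def)
    fix C assume C: "C \<noteq> {}" "subset.chain A C"
    define C' where "C' = (\<lambda>Z. (Inl -` Z, Inr -` Z)) ` C"
    have inA: "B \<subseteq> Inl -` Z \<and> F0 \<subseteq> Inr -` Z \<and> good M (Inl -` Z) (Inr -` Z)" if "Z \<in> C" for Z
    proof -
      have "Z \<in> A" using C(2) that by (auto simp: subset.chain_def)
      then obtain S F where "Z = Inl ` S \<union> Inr ` F" "B \<subseteq> S" "F0 \<subseteq> F" "good M S F"
        by (auto simp: A_def)
      then show ?thesis by (simp only: vim)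
    qed
    have "good M (\<Union>(fst ` C')) (\<Union>(snd ` C'))"
    proof (rule good_chain)
      show "C' \<noteq> {}" using C(1) by (simp add: C'_def)
      fix SF TG assume "SF \<in> C'" "TG \<in> C'"
      then obtain Z Z' where "Z \<in> C" "Z' \<in> C" "SF = (Inl -` Z, Inr -` Z)" "TG = (Inl -` Z', Inr -` Z')"
        by (auto simp: C'_def)
      moreover have "Z \<subseteq> Z' \<or> Z' \<subseteq> Z"
        using C(2) \<open>Z \<in> C\<close> \<open>Z' \<in> C\<close> by (auto simp: subset.chain_def)
      ultimately show "fst SF \<subseteq> fst TG \<and> snd SF \<subseteq> snd TG \<or> fst TG \<subseteq> fst SF \<and> snd TG \<subseteq> snd SF"
        by auto
    next
      fix SF assume "SF \<in> C'"
      then show "good M (fst SF) (snd SF)" using inA by (auto simp: C'_def)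
    qed
    moreover have "\<Union>C = Inl ` \<Union>(fst ` C') \<union> Inr ` \<Union>(snd ` C')"
    proof (intro equalityI subsetI)
      fix z assume "z \<in> \<Union>C"
      then show "z \<in> Inl ` \<Union>(fst ` C') \<union> Inr ` \<Union>(snd ` C')"
        by (cases z) (auto simp: C'_def)
    qed (auto simp: C'_def)
    moreover have "B \<subseteq> \<Union>(fst ` C')" "F0 \<subseteq> \<Union>(snd ` C')"
      using C(1) inA by (fastforce simp: C'_def)+
    ultimately show "\<Union>C \<in> A" unfolding A_def by blast
  qed
  then obtain S F where SF: "B \<subseteq> S" "F0 \<subseteq> F" "good M S F"
    and max: "\<And>T G. B \<subseteq> T \<Longrightarrow> F0 \<subseteq> G \<Longrightarrow> good M T G \<Longrightarrow> S \<subseteq> T \<Longrightarrow> F \<subseteq> G \<Longrightarrow> T = S"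
  proof -
    fix thesis assume *: "\<And>S F. B \<subseteq> S \<Longrightarrow> F0 \<subseteq> F \<Longrightarrow> good M S F \<Longrightarrow>
      (\<And>T G. B \<subseteq> T \<Longrightarrow> F0 \<subseteq> G \<Longrightarrow> good M T G \<Longrightarrow> S \<subseteq> T \<Longrightarrow> F \<subseteq> G \<Longrightarrow> T = S) \<Longrightarrow> thesis"
      and "\<exists>Z\<in>A. \<forall>X\<in>A. Z \<subseteq> X \<longrightarrow> X = Z"
    then obtain Z where Z: "Z \<in> A" "\<forall>X\<in>A. Z \<subseteq> X \<longrightarrow> X = Z" by blast
    then obtain S F where Z_def: "Z = Inl ` S \<union> Inr ` F" and SF: "B \<subseteq> S" "F0 \<subseteq> F" "good M S F"
      by (auto simp: A_def)
    show thesis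
    proof (rule *[OF SF])
      fix T G assume TG: "B \<subseteq> T" "F0 \<subseteq> G" "good M T G" "S \<subseteq> T" "F \<subseteq> G"
      then have "Inl ` T \<union> Inr ` G \<in> A" unfolding A_def by blast
      moreover have "Z \<subseteq> Inl ` T \<union> Inr ` G" using TG unfolding Z_def by blast
      ultimately have "Inl ` T \<union> Inr ` G = Z" using Z(2) by blast
      then have "Inl -` (Inl ` T \<union> Inr ` G) = Inl -` (Inl ` S \<union> Inr ` F)" unfolding Z_def by simp
      then show "T = S" by (simp only: vim)
    qed
  qed
  have all: "c \<in> S" for c
  proof (induction c)
    case (Base i j)
    then show ?case using SF(1) by (auto simp: B_def)
  next
    case (Wit p)
    have sub: "set (snd (p x)) \<subseteq> S" for x
    proof
      fix c assume "c \<in> set (snd (p x))"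
      moreover have "p x \<in> range p" "snd (p x) \<in> Basic_BNFs.snds (p x)" by (simp_all add: snds.simps)
      ultimately show "c \<in> S" using Wit by blast
    qed
    show ?case
    proof (rule ccontr)
      assume "Wit p \<notin> S"
      from good_extend[OF SF(3) sub this]
      obtain G where "F \<subseteq> G" "good M (insert (Wit p) S) G" by (elim exE conjE)
      moreover from this have "F0 \<subseteq> G" "B \<subseteq> insert (Wit p) S" using SF by auto
      ultimately have "insert (Wit p) S = S" using max[of "insert (Wit p) S" G] by blast
      with \<open>Wit p \<notin> S\<close> show False by blast
    qed
  qed
  have "decides M F p" for p using SF(3) all[of "Wit p"] unfolding good_def by blast
  with SF show ?thesis unfolding good_def by blast
qed

section \<open>The saturated model\<close>

lemma map_eq_ae:
  assumes "ultra U" "list_all2 (\<lambda>c d. {e. e c = e d} \<in> U) cs ds"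
  shows "{e. map e cs = map e ds} \<in> U"
  using assms(2)
proof (induction rule: list_all2_induct)
  case Nil
  then show ?case using ultra_UNIV[OF assms(1)] by simp
next
  case (Cons c cs d ds)
  then show ?case using ultra_conj[OF assms(1)] by simp
qed

text \<open>The constants modulo equality almost everywhere, moved to another type by \<open>h\<close>.\<close>

locale term_model =
  fixes L :: "('f, 'r) lang" and M :: "('a, 'f, 'r) struct"
    and U :: "(('f, 'r) cst \<Rightarrow> 'a) set set" and h :: "('f, 'r) cst \<Rightarrow> 'n"
  assumes univ: "univ M = UNIV" and U: "ultra U" and dec: "\<And>p. decides M U p"
    and h: "\<And>c d. h c = h d \<longleftrightarrow> {e. e c = e d} \<in> U"
begin

definition N :: "('n, 'f, 'r) struct" where
  "N = \<lparr>univ = range h,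
    funs = \<lambda>f xs. h (SOME d. \<exists>cs. map h cs = xs \<and> {e. e d = funs M f (map e cs)} \<in> U),
    rels = \<lambda>R xs. \<exists>cs. map h cs = xs \<and> {e. rels M R (map e cs)} \<in> U\<rparr>"

lemma univ_N: "univ N = range h" by (simp add: N_def)

lemma map_h_eq: "map h cs = map h ds \<Longrightarrow> {e. map e cs = map e ds} \<in> U"
proof (rule map_eq_ae[OF U])
  assume eq: "map h cs = map h ds"
  then have len: "length cs = length ds" by (rule map_eq_imp_length_eq)
  have "h (cs ! i) = h (ds ! i)" if "i < length cs" for i
    using arg_cong[OF eq, of "\<lambda>xs. xs ! i"] that len by simp
  then show "list_all2 (\<lambda>c d. {e. e c = e d} \<in> U) cs ds"
    using len by (simp add: list_all2_conv_all_nth h)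
qed

text \<open>If no finite part of \<open>p\<close> lacks solutions almost everywhere, then \<open>p\<close> is not refuted, so it is
  realized by \<open>Wit p\<close>.\<close>

lemma realize:
  assumes "\<And>P. finite P \<Longrightarrow> solution_set M p P \<in> U"
  shows "{e. holds M (fst (p x)) (e (Wit p) # map e (snd (p x)))} \<in> U"
proof -
  have "\<Inter>\<Delta> \<inter> solution_set M p P \<noteq> {}" if "finite \<Delta>" "\<Delta> \<subseteq> U" "finite P" for \<Delta> P
    using fipD[OF ultra_fip[OF U], of "insert (solution_set M p P) \<Delta>"] assms[OF that(3)] that
    by (simp add: Int_commute)
  then have "range (witness_set M p) \<subseteq> U" using dec[of p] unfolding decides_def by blast
  then show ?thesis unfolding witness_set_def by blast
qed

lemma witness:
  assumes "{e. \<exists>a. holds M \<phi> (a # map e cs)} \<in> U"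
  shows "\<exists>c. {e. holds M \<phi> (e c # map e cs)} \<in> U"
proof -
  let ?p = "\<lambda>_. (\<phi>, cs)"
  have "solution_set M ?p P \<in> U" for P
    by (rule ultra_mono[OF U assms]) (auto simp: solution_set_def)
  then show ?thesis using realize[of ?p undefined] by auto
qed

lemma witness_fun:
  assumes "length cs = farity L f"
  shows "\<exists>d. {e. e d = funs M f (map e cs)} \<in> U"
proof -
  let ?\<phi> = "Eq (Var 0) (App f (map Var [1..<Suc (length cs)])) :: ('f, 'r) fm"
  have map_upt: "map ((!) (a # xs)) [1..<Suc (length xs)] = xs" for a :: 'a and xs
    by (rule nth_equalityI) (auto simp del: upt_Suc)
  have *: "holds M ?\<phi> (a # map e cs) \<longleftrightarrow> a = funs M f (map e cs)" for a e
    using map_upt[of a "map e cs"] by (simp add: holds_def comp_def del: upt_Suc)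
  have "{e. \<exists>a. holds M ?\<phi> (a # map e cs)} \<in> U"
    unfolding * using ultra_UNIV[OF U] by simp
  from witness[OF this] show ?thesis unfolding * by simp
qed

lemma funs_N:
  assumes "length cs = farity L f" "{e. e d = funs M f (map e cs)} \<in> U"
  shows "funs N f (map h cs) = h d"
proof -
  let ?P = "\<lambda>d'. \<exists>cs'. map h cs' = map h cs \<and> {e. e d' = funs M f (map e cs')} \<in> U"
  have "?P (SOME d'. ?P d')" by (rule someI[of ?P d]) (use assms in blast)
  then obtain cs' where cs': "map h cs' = map h cs" "{e. e (SOME d'. ?P d') = funs M f (map e cs')} \<in> U"
    by blast
  have "{e. (map e cs' = map e cs \<and> e (SOME d'. ?P d') = funs M f (map e cs')) \<and> e d = funs M f (map e cs)} \<in> U"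
    using map_h_eq[OF cs'(1)] cs'(2) assms(2) ultra_conj[OF U] by simp
  then have "{e. e (SOME d'. ?P d') = e d} \<in> U"
    by (rule ultra_imp[OF U]) auto
  then show ?thesis by (simp add: N_def h)
qed

lemma rels_N: "rels N R (map h cs) \<longleftrightarrow> {e. rels M R (map e cs)} \<in> U"
proof
  assume "rels N R (map h cs)"
  then obtain cs' where cs': "map h cs' = map h cs" "{e. rels M R (map e cs')} \<in> U"
    by (auto simp: N_def)
  show "{e. rels M R (map e cs)} \<in> U"
    using ultra_iff[OF U map_h_eq[OF cs'(1)], of "\<lambda>e. rels M R (map e cs')" "\<lambda>e. rels M R (map e cs)"] cs'(2)
    by simp
qed (auto simp: N_def)

lemma is_struct_N: "is_struct L N"
  unfolding is_struct_def
proof (intro conjI allI impI)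
  show "univ N \<noteq> {}" by (simp add: univ_N)
  fix f xs assume xs: "length xs = farity L f \<and> set xs \<subseteq> univ N"
  then have "xs \<in> lists (range h)" by (auto simp: univ_N)
  then obtain cs where cs: "xs = map h cs" by (auto simp: lists_image)
  then obtain d where "{e. e d = funs M f (map e cs)} \<in> U" using witness_fun xs by fastforce
  then show "funs N f xs \<in> univ N" using funs_N xs cs by (auto simp: univ_N)
qed

lemma Los_terms:
  assumes "\<forall>t\<in>set ts. \<exists>c. eval_trm N (\<lambda>i. h (a i)) t = h c \<and> {e. eval_trm M (\<lambda>i. e (a i)) t = e c} \<in> U"
  shows "\<exists>cs. map (eval_trm N (\<lambda>i. h (a i))) ts = map h cs \<and> {e. map (eval_trm M (\<lambda>i. e (a i))) ts = map e cs} \<in> U"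
  using assms
proof (induction ts)
  case Nil
  then show ?case using ultra_UNIV[OF U] by simp
next
  case (Cons t ts)
  then obtain cs where cs: "map (eval_trm N (\<lambda>i. h (a i))) ts = map h cs"
    "{e. map (eval_trm M (\<lambda>i. e (a i))) ts = map e cs} \<in> U" by auto
  from Cons.prems obtain c where c: "eval_trm N (\<lambda>i. h (a i)) t = h c" "{e. eval_trm M (\<lambda>i. e (a i)) t = e c} \<in> U"
    by auto
  have "map (eval_trm N (\<lambda>i. h (a i))) (t # ts) = map h (c # cs)" using cs c by simp
  moreover have "{e. map (eval_trm M (\<lambda>i. e (a i))) (t # ts) = map e (c # cs)} \<in> U"
    using cs(2) c(2) ultra_conj[OF U] by simp
  ultimately show ?case by blast
qed

lemma Los_term:
  "wf_trm L t \<Longrightarrow> \<exists>c. eval_trm N (\<lambda>i. h (a i)) t = h c \<and> {e. eval_trm M (\<lambda>i. e (a i)) t = e c} \<in> U"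
proof (induction t)
  case (Var i)
  then show ?case using ultra_UNIV[OF U] by auto
next
  case (App f ts)
  then have "\<forall>t\<in>set ts. \<exists>c. eval_trm N (\<lambda>i. h (a i)) t = h c \<and> {e. eval_trm M (\<lambda>i. e (a i)) t = e c} \<in> U"
    by simp
  then obtain cs where cs: "map (eval_trm N (\<lambda>i. h (a i))) ts = map h cs"
    "{e. map (eval_trm M (\<lambda>i. e (a i))) ts = map e cs} \<in> U"
    using Los_terms[of ts a] by blast
  have len: "length cs = farity L f"
    using App.prems map_eq_imp_length_eq[OF cs(1)] by simp
  then obtain d where d: "{e. e d = funs M f (map e cs)} \<in> U" using witness_fun by blast
  have "{e. map (eval_trm M (\<lambda>i. e (a i))) ts = map e cs \<and> e d = funs M f (map e cs)} \<in> U"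
    using cs(2) d by (simp only: ultra_conj[OF U] simp_thms)
  then have "{e. eval_trm M (\<lambda>i. e (a i)) (App f ts) = e d} \<in> U"
    by (rule ultra_imp[OF U]) (simp only: eval_trm.simps)
  moreover have "eval_trm N (\<lambda>i. h (a i)) (App f ts) = h d"
    using funs_N[OF len d] cs(1) by (simp only: eval_trm.simps)
  ultimately show ?case by blast
qed

text \<open>Witnesses are provided for the variable \<open>0\<close>, so the quantified variable is moved to the front.\<close>

lemma holds_ren_front:
  assumes "fv \<phi> \<subseteq> {..<k}"
  shows "holds K (ren (\<lambda>j. if j = i then 0 else Suc j) \<phi>) (x # map b [0..<k]) \<longleftrightarrow> sat K (b(i := x)) \<phi>"
proof -
  have "inj (\<lambda>j. if j = i then 0 else Suc j)" by (auto simp: inj_def)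
  then show ?thesis
    unfolding holds_def by (subst sat_ren) (auto intro!: sat_cong dest: subsetD[OF assms])
qed

lemma Los: "wf_fm L \<phi> \<Longrightarrow> sat N (\<lambda>i. h (a i)) \<phi> \<longleftrightarrow> {e. sat M (\<lambda>i. e (a i)) \<phi>} \<in> U"
proof (induction \<phi> arbitrary: a)
  case (Eq s t)
  have "wf_trm L s" using Eq by simp
  from Los_term[OF this, of a] obtain c where c: "eval_trm N (\<lambda>i. h (a i)) s = h c \<and>
    {e. eval_trm M (\<lambda>i. e (a i)) s = e c} \<in> U" ..
  have "wf_trm L t" using Eq by simp
  from Los_term[OF this, of a] obtain d where d: "eval_trm N (\<lambda>i. h (a i)) t = h d \<and>
    {e. eval_trm M (\<lambda>i. e (a i)) t = e d} \<in> U" ..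
  have "{e. eval_trm M (\<lambda>i. e (a i)) s = e c \<and> eval_trm M (\<lambda>i. e (a i)) t = e d} \<in> U"
    using c d by (simp only: ultra_conj[OF U] simp_thms)
  then have "{e. e c = e d} \<in> U \<longleftrightarrow> {e. eval_trm M (\<lambda>i. e (a i)) s = eval_trm M (\<lambda>i. e (a i)) t} \<in> U"
    by (rule ultra_iff[OF U]) auto
  then show ?case using c d h by simp
next
  case (Rel R ts)
  then have "\<forall>t\<in>set ts. wf_trm L t" by simp
  then obtain cs where cs: "map (eval_trm N (\<lambda>i. h (a i))) ts = map h cs"
    "{e. map (eval_trm M (\<lambda>i. e (a i))) ts = map e cs} \<in> U"
    using Los_terms[of ts a] Los_term[of _ a] by blast
  have "{e. rels M R (map e cs)} \<in> U \<longleftrightarrow> {e. rels M R (map (eval_trm M (\<lambda>i. e (a i))) ts)} \<in> U"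
    by (rule ultra_iff[OF U cs(2)]) simp
  then show ?case using cs rels_N by (simp only: sat.simps)
next
  case (Neg p)
  then show ?case using ultra_not[OF U] by simp
next
  case (Conj p q)
  then show ?case using ultra_conj[OF U] by simp
next
  case (Ex i p)
  have upd: "(\<lambda>j. g (a j))(i := g c) = (\<lambda>j. g ((a(i := c)) j))" for g :: "('f, 'r) cst \<Rightarrow> 'z" and c
    by auto
  have IH: "sat N ((\<lambda>j. h (a j))(i := h c)) p \<longleftrightarrow> {e. sat M ((\<lambda>j. e (a j))(i := e c)) p} \<in> U" for c
    unfolding upd using Ex by simp
  obtain k where k: "fv p \<subseteq> {..<k}"
    using finite_fv[of p] finite_nat_iff_bounded by blast
  let ?r = "\<lambda>j. if j = i then 0 else Suc j" and ?cs = "map a [0..<k]"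
  have front: "holds M (ren ?r p) (x # map e ?cs) \<longleftrightarrow> sat M ((\<lambda>j. e (a j))(i := x)) p" for x e
    using holds_ren_front[OF k, of M i x "\<lambda>j. e (a j)"] by (simp add: comp_def)
  show ?case
  proof
    assume "sat N (\<lambda>i. h (a i)) (Ex i p)"
    then obtain c where "{e. sat M ((\<lambda>j. e (a j))(i := e c)) p} \<in> U"
      using IH by (auto simp: univ_N)
    then show "{e. sat M (\<lambda>i. e (a i)) (Ex i p)} \<in> U"
      by (rule ultra_imp[OF U]) (auto simp: univ)
  next
    assume "{e. sat M (\<lambda>i. e (a i)) (Ex i p)} \<in> U"
    then have "{e. \<exists>x. holds M (ren ?r p) (x # map e ?cs)} \<in> U"
      unfolding front by (simp add: univ)
    from witness[OF this] obtain c where "sat N ((\<lambda>j. h (a j))(i := h c)) p"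
      unfolding front IH by blast
    then show "sat N (\<lambda>i. h (a i)) (Ex i p)" by (auto simp: univ_N)
  qed
qed

lemma Los_holds:
  assumes "fm_in L (length cs) \<phi>"
  shows "holds N \<phi> (map h cs) \<longleftrightarrow> {e. holds M \<phi> (map e cs)} \<in> U"
proof -
  have "holds K \<phi> (map g cs) \<longleftrightarrow> sat K (\<lambda>i. g (cs ! i)) \<phi>"
    for K :: "('z, 'f, 'r) struct" and g
    unfolding holds_def using assms by (intro sat_cong) (auto simp: fm_in_def)
  from this[of N h] this[of M] show ?thesis using Los[of \<phi> "\<lambda>i. cs ! i"] assms by (simp add: fm_in_def)
qed

end

context term_model
begin

text \<open>A type over fewer than \<open>(|L| + \<aleph>\<^sub>0)\<^sup>+\<close> parameters has at most \<open>|L| + \<aleph>\<^sub>0\<close> formulas. It can therefore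
  be enumerated by a function \<open>p\<close> as in \<open>Wit p\<close>.\<close>

lemma saturated_N: "saturated L (cardSuc |UNIV :: ('f + 'r + nat) set| ) N"
  unfolding saturated_def
proof (intro allI impI, elim conjE)
  fix A :: "'n set" and p :: "(('f, 'r) fm \<times> 'n list) set"
  assume A: "A \<subseteq> univ N" and small: "|A| <o cardSuc |UNIV :: ('f + 'r + nat) set|"
    and p: "p \<subseteq> {(\<phi>, ps). set ps \<subseteq> A \<and> fm_in L (1 + length ps) \<phi>}"
    and sat: "\<forall>q. q \<subseteq> p \<and> finite q \<longrightarrow> (\<exists>x\<in>univ N. \<forall>(\<phi>, ps)\<in>q. holds N \<phi> (x # ps))"
  have "|A| \<le>o |UNIV :: ('f + 'r + nat) set|"
    using small cardSuc_ordLeq_ordLess[OF card_of_Card_order card_of_Card_order] by blast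
  then obtain j :: "'n \<Rightarrow> 'f + 'r + nat" where j: "inj_on j A"
    unfolding card_of_ordLeq[symmetric] by blast
  obtain \<pi> :: "('f + 'r + nat) \<times> ('f + 'r + nat) \<Rightarrow> 'f + 'r + nat" where \<pi>: "inj \<pi>"
    using inj_pair_infinite[OF infinite_symbols] by blast
  obtain lc :: "('f + 'r + nat) list \<Rightarrow> 'f + 'r + nat" where lc: "inj lc"
    using inj_list_infinite[OF infinite_symbols] by blast
  obtain \<gamma> :: "('f, 'r) fm \<Rightarrow> 'f + 'r + nat" where \<gamma>: "inj \<gamma>" using inj_fm by blast
  define G where "G = (\<lambda>(\<phi>, ps). \<pi> (\<gamma> \<phi>, lc (map j ps)))"
  have G: "inj_on G p"
  proof (rule inj_onI)
    fix u v assume uv: "u \<in> p" "v \<in> p" "G u = G v"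
    obtain \<phi> ps \<psi> qs where [simp]: "u = (\<phi>, ps)" "v = (\<psi>, qs)" by (cases u, cases v) auto
    have "\<phi> = \<psi>" "map j ps = map j qs"
      using uv(3) by (simp_all add: G_def inj_eq[OF \<pi>] inj_eq[OF \<gamma>] inj_eq[OF lc])
    moreover have "inj_on j (set ps \<union> set qs)"
      by (rule inj_on_subset[OF j]) (use p uv in auto)
    ultimately show "u = v" using inj_on_map_eq_map by auto
  qed
  show "\<exists>x\<in>univ N. \<forall>(\<phi>, ps)\<in>p. holds N \<phi> (x # ps)"
  proof (cases "p = {}")
    case True
    then show ?thesis by (auto simp: univ_N)
  next
    case False
    then obtain p0 where p0: "p0 \<in> p" by blast
    define s where "s x = (if x \<in> G ` p then inv_into p G x else p0)" for x
    have s_in: "s x \<in> p" for x using p0 by (auto simp: s_def inv_into_into)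
    have s_onto: "\<exists>x. s x = u" if "u \<in> p" for u
      using that G by (intro exI[of _ "G u"]) (simp add: s_def)
    define k where "k = inv h"
    have k: "map h (map k ps) = ps" if "set ps \<subseteq> univ N" for ps
      using that by (auto simp: k_def univ_N f_inv_into_f subset_iff intro!: map_idI)
    have s_wf: "fm_in L (Suc (length (snd (s x)))) (fst (s x)) \<and> set (snd (s x)) \<subseteq> univ N" for x
      using s_in[of x] p A by (cases "s x") auto
    have los: "holds N (fst (s x)) (h c # snd (s x)) \<longleftrightarrow>
        {e. holds M (fst (s x)) (e c # map e (map k (snd (s x))))} \<in> U" for x c
    proof -
      have "map h (c # map k (snd (s x))) = h c # snd (s x)"
        using k[of "snd (s x)"] s_wf[of x] by (simp only: list.map)
      moreover have "fm_in L (length (c # map k (snd (s x)))) (fst (s x))"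
        using s_wf[of x] by simp
      ultimately show ?thesis
        using Los_holds[of "c # map k (snd (s x))" "fst (s x)"] by (simp only: list.map)
    qed
    define p' where "p' x = (fst (s x), map k (snd (s x)))" for x
    have sol: "solution_set M p' P \<in> U" if "finite P" for P
    proof -
      have "s ` P \<subseteq> p \<and> finite (s ` P)" using s_in that by auto
      from sat[rule_format, OF this] obtain y where
        y: "y \<in> univ N" "\<forall>(\<phi>, ps)\<in>s ` P. holds N \<phi> (y # ps)" ..
      then obtain c where c: "y = h c" by (auto simp: univ_N)
      have "holds N (fst (s x)) (h c # snd (s x))" if "x \<in> P" for x
        using y(2) that by (auto simp: c split_beta)
      then have *: "{e. holds M (fst (s x)) (e c # map e (map k (snd (s x))))} \<in> U" if "x \<in> P" for x
        using los that by blast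
      show ?thesis
        by (rule ultra_superset[OF U, of "(\<lambda>x. {e. holds M (fst (s x)) (e c # map e (map k (snd (s x))))}) ` P"])
          (use that * in \<open>auto simp: solution_set_def p'_def\<close>)
    qed
    have "holds N \<phi> (h (Wit p') # ps)" if up: "(\<phi>, ps) \<in> p" for \<phi> ps
    proof -
      obtain x where x: "s x = (\<phi>, ps)" using s_onto[OF up] by blast
      show ?thesis using realize[OF sol, of x] los[of x "Wit p'"] by (simp add: x p'_def)
    qed
    then show ?thesis by (auto simp: univ_N)
  qed
qed

lemma highly_saturated_N: "highly_saturated L (cardSuc |UNIV :: ('f + 'r + nat) set| ) N"
  unfolding highly_saturated_def
  using saturated_N cardSuc_Card_order[OF card_of_Card_order] cardSuc_greater[OF card_of_Card_order] by blast

lemma models_N: "models L N (theory_of L M)"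
  unfolding models_def theory_of_def
  using is_struct_N Los_holds[of "[]"] ultra_UNIV[OF U] by auto

end

lemma ultra_xor:
  assumes "ultra U" "{e. P e \<noteq> Q e} \<in> U"
  shows "{e. P e} \<in> U \<longleftrightarrow> {e. Q e} \<notin> U"
  using ultra_iff[OF assms(1,2), of P "\<lambda>e. \<not> Q e"] ultra_not[OF assms(1), of Q] by auto

section \<open>Homogeneous sets\<close>

lemma sorted_wrt_less_idem: "sorted_wrt (<) xs \<Longrightarrow> sorted_list_of_set (set xs) = (xs :: nat list)"
  by (simp add: sorted_list_of_set.idem_if_sorted_distinct strict_sorted_iff)

text \<open>Sets of size \<open>m\<close> are represented by their increasing enumerations, since formulas are evaluated at
  lists.\<close>

definition homogeneous :: "nat \<Rightarrow> (nat list \<Rightarrow> bool) \<Rightarrow> nat set \<Rightarrow> bool" where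
  "homogeneous m P H \<longleftrightarrow> (\<forall>xs ys. set xs \<subseteq> H \<and> set ys \<subseteq> H \<and> sorted_wrt (<) xs \<and> sorted_wrt (<) ys \<and>
     length xs = m \<and> length ys = m \<longrightarrow> (P xs \<longleftrightarrow> P ys))"

lemma homogeneous_mono: "homogeneous m P H \<Longrightarrow> H' \<subseteq> H \<Longrightarrow> homogeneous m P H'"
  unfolding homogeneous_def by (intro allI impI) (elim allE impE, auto)

lemma ramsey_one:
  "\<exists>N. \<forall>Z (P :: nat list \<Rightarrow> bool). finite Z \<and> card Z = N \<longrightarrow>
     (\<exists>H\<subseteq>Z. card H = n \<and> homogeneous m P H)"
proof -
  obtain N :: nat where N: "partn_lst {..<N} [n, n] m" using ramsey_full by blast
  show ?thesis
  proof (intro exI[of _ N] allI impI, elim conjE)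
    fix Z :: "nat set" and P :: "nat list \<Rightarrow> bool" assume Z: "finite Z" "card Z = N"
    then obtain g where g: "bij_betw g {..<N} Z"
      using ex_bij_betw_nat_finite[of Z] by (auto simp: atLeast0LessThan)
    define f where "f X = (if P (sorted_list_of_set (g ` X)) then 1 else 0 :: nat)" for X
    have "f \<in> nsets {..<N} m \<rightarrow> {..<2}" by (auto simp: f_def)
    then obtain i H where iH: "i < length [n, n]" "H \<in> nsets {..<N} ([n, n] ! i)" "f ` nsets H m \<subseteq> {i}"
      using partn_lstE[OF N, of f 2] by auto
    have n: "[n, n] ! i = n" using iH(1) by (auto simp: nth_Cons split: nat.splits)
    have H: "H \<subseteq> {..<N}" "card H = n" using iH(2) n by (auto simp: nsets_def)
    have inj: "inj_on g H" using g H(1) by (meson bij_betw_def inj_on_subset)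
    have P: "P xs \<longleftrightarrow> i = 1" if xs: "set xs \<subseteq> g ` H" "sorted_wrt (<) xs" "length xs = m" for xs
    proof -
      obtain X where X: "X \<subseteq> H" "set xs = g ` X" using xs(1) by (meson subset_imageE)
      have "card (set xs) = m" using xs(2,3) by (simp add: strict_sorted_iff distinct_card)
      then have "card X = m" using X inj by (metis card_image inj_on_subset)
      moreover have "finite X" using X(1) H(1) by (meson finite_lessThan finite_subset)
      ultimately have "X \<in> nsets H m" using X(1) by (auto simp: nsets_def)
      then have "f X = i" using iH(3) by auto
      then show ?thesis using sorted_wrt_less_idem[OF xs(2)] X(2) by (auto simp: f_def split: if_splits)
    qed
    show "\<exists>H\<subseteq>Z. card H = n \<and> homogeneous m P H"
    proof (intro exI[of _ "g ` H"] conjI)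
      show "g ` H \<subseteq> Z" using g H(1) by (auto simp: bij_betw_def)
      show "card (g ` H) = n" using inj H(2) by (simp add: card_image)
      show "homogeneous m P (g ` H)" using P unfolding homogeneous_def by blast
    qed
  qed
qed

text \<open>Finitely many colourings are made homogeneous one after the other; \<open>N\<close> depends on their arities
  only.\<close>

lemma ramsey_many:
  "\<exists>N. \<forall>Z (P :: nat \<Rightarrow> nat list \<Rightarrow> bool). finite Z \<and> card Z = N \<longrightarrow>
     (\<exists>H\<subseteq>Z. card H = n \<and> (\<forall>q<length ms. homogeneous (ms ! q) (P q) H))"
proof (induction ms arbitrary: n)
  case Nil
  then show ?case by (intro exI[of _ n]) auto
next
  case (Cons m ms)
  from Cons.IH[of n] obtain N1 where N1: "\<forall>Z (P :: nat \<Rightarrow> nat list \<Rightarrow> bool). finite Z \<and> card Z = N1 \<longrightarrow>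
     (\<exists>H\<subseteq>Z. card H = n \<and> (\<forall>q<length ms. homogeneous (ms ! q) (P q) H))" ..
  from ramsey_one[of N1 m] obtain N where N: "\<forall>Z (P :: nat list \<Rightarrow> bool). finite Z \<and> card Z = N \<longrightarrow>
     (\<exists>H\<subseteq>Z. card H = N1 \<and> homogeneous m P H)" ..
  show ?case
  proof (intro exI[of _ N] allI impI)
    fix Z :: "nat set" and P :: "nat \<Rightarrow> nat list \<Rightarrow> bool" assume Z: "finite Z \<and> card Z = N"
    obtain H1 where H1: "H1 \<subseteq> Z" "card H1 = N1" "homogeneous m (P 0) H1"
      using N[rule_format, OF Z, of "P 0"] by (elim exE conjE)
    have "finite H1 \<and> card H1 = N1" using H1 Z finite_subset by auto
    from N1[rule_format, OF this, of "\<lambda>q. P (Suc q)"]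
    obtain H where H: "H \<subseteq> H1" "card H = n" "\<forall>q<length ms. homogeneous (ms ! q) (P (Suc q)) H"
      by (elim exE conjE)
    have "homogeneous ((m # ms) ! q) (P q) H" if "q < length (m # ms)" for q
      using that H(3) homogeneous_mono[OF H1(3) H(1)] by (cases q) auto
    then show "\<exists>H\<subseteq>Z. card H = n \<and> (\<forall>q<length (m # ms). homogeneous ((m # ms) ! q) (P q) H)"
      using H H1(1) by (intro exI[of _ H]) auto
  qed
qed

section \<open>The forbidden pattern\<close>

text \<open>The constants \<open>Base 0 i\<close> and \<open>Base 1 j\<close> name the two sequences, \<open>Base 2 0\<close> the element \<open>b\<close>, and
  \<open>Base 3 k\<close> the parameters of the formula that defines \<open>P\<close>. The sets \<open>shift_set M d\<close> together express
  that the two sequences are mutually indiscernible over these parameters, and \<open>pattern_set\<close> that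
  \<open>b\<close> breaks both indiscernibilities.\<close>

definition shift_set :: "('a, 'f, 'r) struct \<Rightarrow> ('f, 'r) fm \<times> nat list \<times> nat list \<times> ('f, 'r) cst list \<times> nat \<Rightarrow> (('f, 'r) cst \<Rightarrow> 'a) set" where
  "shift_set M = (\<lambda>(\<phi>, is, js, ds, t).
     {e. holds M \<phi> (map e (map (Base t) is @ ds)) \<longleftrightarrow> holds M \<phi> (map e (map (Base t) js @ ds))})"

definition shift_data :: "(('f, 'r) fm \<times> nat list \<times> nat list \<times> ('f, 'r) cst list \<times> nat) set" where
  "shift_data = {(\<phi>, is, js, ds, t). t \<le> 1 \<and> sorted_wrt (<) is \<and> sorted_wrt (<) js \<and> length is = length js \<and>
     set ds \<subseteq> range (Base 3) \<union> range (Base (1 - t))}"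

definition pattern_set :: "nat \<Rightarrow> 'a list \<Rightarrow> ('a \<Rightarrow> 'a \<Rightarrow> bool) \<Rightarrow> (('f, 'r) cst \<Rightarrow> 'a::linorder) set" where
  "pattern_set k ps P = {e. map e (map (Base 3) [0..<k]) = ps \<and>
     P (e (Base 0 0)) (e (Base 2 0)) \<noteq> P (e (Base 0 1)) (e (Base 2 0)) \<and>
     e (Base 1 0) \<le> e (Base 2 0) \<and> e (Base 2 0) < e (Base 1 1)}"

fun assign :: "(nat \<Rightarrow> 'a) \<Rightarrow> (nat \<Rightarrow> 'a) \<Rightarrow> 'a \<Rightarrow> 'a list \<Rightarrow> ('f, 'r) cst \<Rightarrow> 'a" where
  "assign a h b ps (Base t i) = (if t = 0 then a i else if t = 1 then h i else if t = 2 then b else ps ! i)"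
| "assign a h b ps (Wit p) = b"

definition separated :: "('b \<Rightarrow> 'a::linorder \<Rightarrow> bool) \<Rightarrow> nat \<Rightarrow> (nat \<Rightarrow> 'b) \<Rightarrow> (nat \<Rightarrow> 'a) \<Rightarrow> bool" where
  "separated P N a h \<longleftrightarrow> (\<forall>j<N. h j < h (Suc j)) \<and>
     (\<forall>i i' j. i < i' \<and> i' < N \<and> j < N \<longrightarrow> (\<exists>b. h j \<le> b \<and> b < h (Suc j) \<and> P (a i) b \<noteq> P (a i') b))"

lemma separatedI:
  assumes "\<And>j. j < N \<Longrightarrow> h j < h (Suc j)"
    and "\<And>i i' j. i < i' \<Longrightarrow> i' < N \<Longrightarrow> j < N \<Longrightarrow> \<exists>b. h j \<le> b \<and> b < h (Suc j) \<and> P (a i) b \<noteq> P (a i') b"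
  shows "\<exists>a h. separated P N a h"
  unfolding separated_def
  by (rule exI[of _ a], rule exI[of _ h], intro conjI allI impI) (use assms in simp_all)

text \<open>Finitely many of the conditions mention indices below some \<open>n\<close> only. Ramsey's theorem provides
  \<open>2n\<close> homogeneous indices for a long finite pattern. The first \<open>n\<close> of them are used for the elements \<open>a\<^sub>i\<close>
  and the last \<open>n\<close> for the cut points \<open>h\<^sub>j\<close>: since all indices of one sequence lie on the same side of
  those of the other, moving indices within one half keeps the joint order type.\<close>

lemma pattern_fip:
  fixes M :: "('a::linorder, 'f, 'r) struct" and P :: "'a \<Rightarrow> 'a \<Rightarrow> bool"
  assumes pat: "\<And>N. \<exists>a h. separated P N a h"
  shows "fip (insert (pattern_set (length ps) ps P) (shift_set M ` shift_data))"
  unfolding fip_def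
proof (intro allI impI, elim conjE)
  fix \<Delta> :: "(('f, 'r) cst \<Rightarrow> 'a) set set"
  assume \<Delta>: "finite \<Delta>" "\<Delta> \<subseteq> insert (pattern_set (length ps) ps P) (shift_set M ` shift_data)"
  let ?X = "pattern_set (length ps) ps P :: (('f, 'r) cst \<Rightarrow> 'a) set"
  have "finite (\<Delta> - {?X})" "\<Delta> - {?X} \<subseteq> shift_set M ` shift_data" using \<Delta> by auto
  then obtain D where D: "D \<subseteq> shift_data" "finite D" "\<Delta> - {?X} = shift_set M ` D"
    by (meson finite_subset_image)
  obtain qs where qs: "set qs = D" using finite_list[OF D(2)] by blast
  define idx where "idx = (\<lambda>(\<phi> :: ('f, 'r) fm, is, js, ds, t :: nat).
     set is \<union> set js \<union> {i. \<exists>t. (Base t i :: ('f, 'r) cst) \<in> set ds})"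
  have fin_idx: "finite (idx q)" for q
  proof -
    obtain \<phi> "is" js ds t where q: "q = (\<phi>, is, js, ds, t)" by (cases q) auto
    have "{i. \<exists>t. (Base t i :: ('f, 'r) cst) \<in> set ds} \<subseteq> (\<lambda>c. case c of Base t i \<Rightarrow> i | Wit p \<Rightarrow> 0) ` set ds"
      by (force simp: image_iff)
    then have "finite {i. \<exists>t. (Base t i :: ('f, 'r) cst) \<in> set ds}"
      by (rule finite_subset) simp
    then show ?thesis by (simp add: q idx_def)
  qed
  have "finite (insert 1 (\<Union>q\<in>D. idx q))" using D(2) fin_idx by simp
  then obtain n where "insert 1 (\<Union>q\<in>D. idx q) \<subseteq> {..<n}"
    unfolding finite_nat_iff_bounded ..
  then have n: "\<And>i. i \<in> insert 1 (\<Union>q\<in>D. idx q) \<Longrightarrow> i < n" by blast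
  have n1: "1 < n" using n by blast
  define ms where "ms = map (\<lambda>(\<phi>, is, js, ds, t). length is + n) qs"
  from ramsey_many[of "2 * n" ms] obtain N where
    N: "\<forall>Z (P :: nat \<Rightarrow> nat list \<Rightarrow> bool). finite Z \<and> card Z = N \<longrightarrow>
     (\<exists>H\<subseteq>Z. card H = 2 * n \<and> (\<forall>q<length ms. homogeneous (ms ! q) (P q) H))" ..
  obtain a h where h: "\<And>j. j < N \<Longrightarrow> h j < h (Suc j)" and
    ah: "\<And>i i' j. i < i' \<Longrightarrow> i' < N \<Longrightarrow> j < N \<Longrightarrow> \<exists>b. h j \<le> b \<and> b < h (Suc j) \<and> P (a i) b \<noteq> P (a i') b"
    using pat[of N] unfolding separated_def by blast
  have h_mono: "i \<le> j \<Longrightarrow> j \<le> N \<Longrightarrow> h i \<le> h j" for i j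
  proof (induction j rule: dec_induct)
    case (step j)
    then show ?case using h[of j] by simp
  qed simp
  define Q where "Q = (\<lambda>q xs. case qs ! q of (\<phi>, is, js, ds, t) \<Rightarrow>
     if t = 0 then holds M \<phi> (map a (take (length is) xs) @ map (assign a (\<lambda>j. h (xs ! (length is + j))) (a 0) ps) ds)
     else holds M \<phi> (map h (drop n xs) @ map (assign (\<lambda>i. a (xs ! i)) h (a 0) ps) ds))"
  have "finite {..<N} \<and> card {..<N} = N" by simp
  from N[rule_format, OF this, of Q] obtain H where H: "H \<subseteq> {..<N}" "card H = 2 * n" and
    hom: "\<forall>q<length ms. homogeneous (ms ! q) (Q q) H" by (elim exE conjE)
  have finH: "finite H" using H(1) finite_subset by blast
  define s where "s i = sorted_list_of_set H ! i" for i
  have lenH: "length (sorted_list_of_set H) = 2 * n" using H(2) by simp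
  have s_less: "i < j \<Longrightarrow> j < 2 * n \<Longrightarrow> s i < s j" for i j
    using sorted_wrt_nth_less[OF strict_sorted_list_of_set[of H]] lenH by (simp add: s_def)
  have s_in: "i < 2 * n \<Longrightarrow> s i \<in> H" for i
    using nth_mem[of i "sorted_list_of_set H"] lenH finH by (simp add: s_def)
  have s_sorted: "sorted_wrt (<) (map s xs)" if "sorted_wrt (<) xs" "\<And>i. i \<in> set xs \<Longrightarrow> i < 2 * n" for xs
    using that by (auto simp: sorted_wrt_map intro!: sorted_wrt_mono_rel[OF _ that(1)] s_less)
  have "s 0 < s 1" "s 1 < N" "s n < N" "s n < s (Suc n)" "s (Suc n) < N"
    using n1 s_less[of 0 1] s_less[of n "Suc n"] s_in[of 1] s_in[of n] s_in[of "Suc n"] H(1) by auto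
  moreover from this obtain b where b: "h (s n) \<le> b" "b < h (Suc (s n))" "P (a (s 0)) b \<noteq> P (a (s 1)) b"
    using ah[of "s 0" "s 1" "s n"] by auto
  moreover have "h (Suc (s n)) \<le> h (s (Suc n))"
    using h_mono[of "Suc (s n)" "s (Suc n)"] calculation by simp
  ultimately have b_less: "b < h (s (Suc n))" by simp
  define e :: "('f, 'r) cst \<Rightarrow> 'a" where "e = assign (\<lambda>i. a (s i)) (\<lambda>j. h (s (n + j))) b ps"
  have e_simps: "e (Base 0 i) = a (s i)" "e (Base (Suc 0) j) = h (s (n + j))" "e (Base 2 k) = b" "e (Base 3 k) = ps ! k" for i j k
    by (simp_all add: e_def)
  have "e \<in> ?X"
    using b b_less by (simp add: pattern_set_def e_simps comp_def map_nth)
  moreover have "e \<in> shift_set M d" if "d \<in> D" for d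
  proof -
    obtain \<phi> "is" js ds t where d: "d = (\<phi>, is, js, ds, t)" by (cases d) auto
    have "d \<in> set qs" using that qs by simp
    then obtain q where q: "q < length qs" "qs ! q = d" by (auto simp: in_set_conv_nth)
    have dat: "t \<le> 1" "sorted_wrt (<) is" "sorted_wrt (<) js" "length is = length js"
      "set ds \<subseteq> range (Base 3) \<union> range (Base (1 - t))"
      using D(1) that by (auto simp: d shift_data_def)
    have "i < n" if "i \<in> idx d" for i using n[of i] that \<open>d \<in> D\<close> by blast
    then have bd: "\<And>i. i \<in> set is \<Longrightarrow> i < n" "\<And>i. i \<in> set js \<Longrightarrow> i < n" "\<And>t' i. Base t' i \<in> set ds \<Longrightarrow> i < n"
      by (auto simp: d idx_def)
    have q': "q < length ms" "ms ! q = length is + n" using q by (auto simp: ms_def d)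
    show ?thesis
    proof (cases "t = 0")
      case True
      define X where "X ks = map s (ks @ [n..<2 * n])" for ks
      have Qe: "Q q (X ks) \<longleftrightarrow> holds M \<phi> (map e (map (Base t) ks @ ds))"
        if "length ks = length is" for ks
      proof -
        have "map a (take (length is) (X ks)) = map e (map (Base t) ks)"
          using that by (simp add: X_def True e_simps)
        moreover have "map (assign a (\<lambda>j. h (X ks ! (length is + j))) (a 0) ps) ds = map e ds"
        proof (rule map_cong[OF refl])
          fix c assume c: "c \<in> set ds"
          then obtain t' i where c': "c = Base t' i" "t' = 3 \<or> t' = 1" using dat(5) True by auto
          then show "assign a (\<lambda>j. h (X ks ! (length is + j))) (a 0) ps c = e c"
            using bd(3)[of t' i] c that by (auto simp: e_simps X_def nth_append)
        qed
        moreover have "Q q (X ks) \<longleftrightarrow> holds M \<phi> (map a (take (length is) (X ks)) @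
            map (assign a (\<lambda>j. h (X ks ! (length is + j))) (a 0) ps) ds)"
          by (simp add: Q_def q d True)
        ultimately show ?thesis by (simp only: map_append)
      qed
      have srt: "sorted_wrt (<) (X ks)" "set (X ks) \<subseteq> H" "length (X ks) = length ks + n"
        if "sorted_wrt (<) ks" "\<And>i. i \<in> set ks \<Longrightarrow> i < n" for ks
      proof -
        show "sorted_wrt (<) (X ks)" unfolding X_def
          by (rule s_sorted) (use that in \<open>auto simp: sorted_wrt_append dest: that(2)\<close>)
        show "set (X ks) \<subseteq> H" using s_in that(2) by (fastforce simp: X_def)
      qed (simp add: X_def)
      have "Q q (X is) \<longleftrightarrow> Q q (X js)"
        by (rule hom[rule_format, OF q'(1), unfolded homogeneous_def, rule_format]) (use srt[OF dat(2) bd(1)] srt[OF dat(3) bd(2)] q' dat(4) in auto)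
      then show ?thesis using Qe[of "is"] Qe[of js] dat(4) by (simp add: shift_set_def d)
    next
      case False
      then have t: "t = 1" using dat(1) by simp
      define X where "X ks = map s ([0..<n] @ map ((+) n) ks)" for ks
      have Qe: "Q q (X ks) \<longleftrightarrow> holds M \<phi> (map e (map (Base t) ks @ ds))"
        if "length ks = length is" for ks
      proof -
        have "map h (drop n (X ks)) = map e (map (Base t) ks)"
          using that by (simp add: X_def t e_simps)
        moreover have "map (assign (\<lambda>i. a (X ks ! i)) h (a 0) ps) ds = map e ds"
        proof (rule map_cong[OF refl])
          fix c assume c: "c \<in> set ds"
          then obtain t' i where c': "c = Base t' i" "t' = 3 \<or> t' = 0" using dat(5) t by auto
          then show "assign (\<lambda>i. a (X ks ! i)) h (a 0) ps c = e c"
            using bd(3)[of t' i] c by (auto simp: e_simps X_def nth_append)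
        qed
        moreover have "Q q (X ks) \<longleftrightarrow> holds M \<phi> (map h (drop n (X ks)) @
            map (assign (\<lambda>i. a (X ks ! i)) h (a 0) ps) ds)"
          by (simp add: Q_def q d t)
        ultimately show ?thesis by (simp only: map_append)
      qed
      have srt: "sorted_wrt (<) (X ks)" "set (X ks) \<subseteq> H" "length (X ks) = length ks + n"
        if "sorted_wrt (<) ks" "\<And>i. i \<in> set ks \<Longrightarrow> i < n" for ks
      proof -
        show "sorted_wrt (<) (X ks)" unfolding X_def
          by (rule s_sorted) (use that in \<open>auto simp: sorted_wrt_append sorted_wrt_map dest: that(2)\<close>)
        show "set (X ks) \<subseteq> H" using s_in that(2) by (fastforce simp: X_def)
      qed (simp add: X_def)
      have "Q q (X is) \<longleftrightarrow> Q q (X js)"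
        by (rule hom[rule_format, OF q'(1), unfolded homogeneous_def, rule_format]) (use srt[OF dat(2) bd(1)] srt[OF dat(3) bd(2)] q' dat(4) in auto)
      then show ?thesis using Qe[of "is"] Qe[of js] dat(4) by (simp add: shift_set_def d)
    qed
  qed
  ultimately have "e \<in> Y" if Y: "Y \<in> \<Delta>" for Y
  proof (cases "Y = ?X")
    case False
    then have "Y \<in> shift_set M ` D" using Y D(3) by blast
    with \<open>\<And>d. d \<in> D \<Longrightarrow> e \<in> shift_set M d\<close> show ?thesis by blast
  qed simp
  then show "\<Inter>\<Delta> \<noteq> {}" by blast
qed

lemma supported_Base:
  fixes \<Phi> :: "(nat \<Rightarrow> nat \<Rightarrow> 'a) \<Rightarrow> bool"
  shows "supported {Base i j |i j. True} {e :: ('f, 'r) cst \<Rightarrow> 'a. \<Phi> (\<lambda>i j. e (Base i j))}"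
  unfolding supported_def
proof (intro allI impI)
  fix e e' :: "('f, 'r) cst \<Rightarrow> 'a"
  assume "\<forall>c\<in>{Base i j |i j. True}. e c = e' c" "e \<in> {e. \<Phi> (\<lambda>i j. e (Base i j))}"
  moreover from this have "(\<lambda>i j. e (Base i j)) = (\<lambda>i j. e' (Base i j))" by fastforce
  ultimately show "e' \<in> {e. \<Phi> (\<lambda>i j. e (Base i j))}" by simp
qed

lemma supported_pattern:
  fixes M :: "('a::linorder, 'f, 'r) struct"
  assumes "Y \<in> insert (pattern_set k ps P) (shift_set M ` shift_data)"
  shows "supported {Base i j |i j. True} Y"
  using assms
proof
  assume "Y = pattern_set k ps P"
  then show ?thesis
    using supported_Base[of "\<lambda>b. map (b 3) [0..<k] = ps \<and> P (b 0 0) (b 2 0) \<noteq> P (b 0 1) (b 2 0) \<and>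
      b 1 0 \<le> b 2 0 \<and> b 2 0 < b 1 1"] by (simp add: pattern_set_def comp_def)
next
  assume "Y \<in> shift_set M ` shift_data"
  then obtain \<phi> "is" js ds t where Y: "Y = shift_set M (\<phi>, is, js, ds, t)" and "(\<phi>, is, js, ds, t) \<in> shift_data"
    by (auto simp: image_iff)
  then have ds: "set ds \<subseteq> {Base i j |i j. True}" by (auto simp: shift_data_def)
  show ?thesis
    unfolding supported_def
  proof (intro allI impI)
    fix e e' :: "('f, 'r) cst \<Rightarrow> 'a"
    assume eq: "\<forall>c\<in>{Base i j |i j. True}. e c = e' c" and e: "e \<in> Y"
    have "map e (map (Base t) ks @ ds) = map e' (map (Base t) ks @ ds)" for ks
      using eq ds by (intro map_cong[OF refl]) auto
    with e show "e' \<in> Y" by (simp only: Y shift_set_def prod.case mem_Collect_eq)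
  qed
qed

lemma not_indiscernible_pair:
  assumes ind: "indiscernible L N A I" and ps: "set ps \<subseteq> A"
    and \<phi>: "fm_in L (length (I 0 @ ps)) \<phi>" and len: "length (I 1) = length (I 0)"
    and ne: "holds N \<phi> (I 0 @ ps) \<noteq> holds N \<phi> (I 1 @ ps)"
  shows False
  using ind[unfolded indiscernible_def, rule_format, of ps "[0]" "[1]" \<phi>] assms by auto

theorem no_pattern:
  fixes L :: "('f, 'r) lang" and M :: "('a::linordered_ab_group_add, 'f, 'r) struct"
  assumes ex: "expands_ordered_group L M" and dp: "dp_minimal L M"
    and P: "definable_rel L M {(a, b). P a b}"
    and pat: "\<And>N. \<exists>a h. separated P N a h"
  shows False
proof -
  have univ: "univ M = UNIV" using ex by (simp add: expands_ordered_group_def)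
  from P[unfolded definable_rel_def definable_def] obtain \<phi> where "\<exists>ps. set ps \<subseteq> univ M \<and>
    fm_in L (2 + length ps) \<phi> \<and> {[x, y] |x y. (x, y) \<in> {(a, b). P a b}} =
      {xs. length xs = 2 \<and> set xs \<subseteq> univ M \<and> holds M \<phi> (xs @ ps)}" ..
  then obtain ps where ps: "set ps \<subseteq> univ M \<and>
    fm_in L (2 + length ps) \<phi> \<and> {[x, y] |x y. (x, y) \<in> {(a, b). P a b}} =
      {xs. length xs = 2 \<and> set xs \<subseteq> univ M \<and> holds M \<phi> (xs @ ps)}" ..
  then have \<phi>: "fm_in L (2 + length ps) \<phi>" by (elim conjE)
  from ps have def: "{[x, y] |x y. (x, y) \<in> {(a, b). P a b}} =
      {xs. length xs = 2 \<and> set xs \<subseteq> univ M \<and> holds M \<phi> (xs @ ps)}" by (elim conjE)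
  have P_iff: "P x y \<longleftrightarrow> holds M \<phi> ([x, y] @ ps)" for x y
  proof -
    have "P x y \<longleftrightarrow> [x, y] \<in> {[x, y] |x y. (x, y) \<in> {(a, b). P a b}}" by simp
    also have "\<dots> \<longleftrightarrow> holds M \<phi> ([x, y] @ ps)" unfolding def by (simp add: univ)
    finally show ?thesis .
  qed
  obtain r where r: "rarity L r = 2" "\<And>x y. rels M r [x, y] \<longleftrightarrow> x < y"
    using ex by (auto simp: expands_ordered_group_def)
  define X where "X = (pattern_set (length ps) ps P :: (('f, 'r) cst \<Rightarrow> 'a) set)"
  define F0 where "F0 = insert X (shift_set M ` shift_data)"
  have fip: "fip F0" unfolding F0_def X_def by (rule pattern_fip[OF pat])
  have "supported {Base i j |i j. True} Y" if "Y \<in> F0" for Y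
    using that unfolding F0_def X_def by (rule supported_pattern)
  from deciding_family[OF fip this, of M] obtain F where F: "F0 \<subseteq> F \<and> fip F \<and> (\<forall>p. decides M F p)" ..
  obtain U where U: "F \<subseteq> U" "ultra U" using ultra_extension[of F] F by blast
  obtain g :: "('f, 'r) cst \<Rightarrow> ('f, 'r) big" where g: "inj g" using inj_cst by blast
  \<comment> \<open>\<open>h\<close> picks a representative of each class of constants modulo \<open>U\<close> and codes it in \<open>big\<close>.\<close>
  define h where "h c = g (SOME d. {e. e d = e c} \<in> U)" for c
  have rep: "{e. e (SOME d. {e. e d = e c} \<in> U) = e c} \<in> U" for c
    by (rule someI[of "\<lambda>d. {e. e d = e c} \<in> U" c]) (simp add: ultra_UNIV[OF U(2)])
  have h: "h c = h d \<longleftrightarrow> {e. e c = e d} \<in> U" for c d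
  proof
    assume "h c = h d"
    then have eq: "(SOME d. {e. e d = e c} \<in> U) = (SOME b. {e. e b = e d} \<in> U)"
      by (simp add: h_def inj_eq[OF g])
    have "{e. e (SOME d. {e. e d = e c} \<in> U) = e c \<and> e (SOME d. {e. e d = e c} \<in> U) = e d} \<in> U"
      using rep[of c] rep[of d] unfolding eq by (simp only: ultra_conj[OF U(2)] simp_thms)
    then show "{e. e c = e d} \<in> U" by (rule ultra_imp[OF U(2)]) (elim conjE, rule trans[OF sym])
  next
    assume cd: "{e. e c = e d} \<in> U"
    have "(\<lambda>b. {e. e b = e c} \<in> U) = (\<lambda>b. {e. e b = e d} \<in> U)"
      by (rule ext, rule ultra_iff[OF U(2) cd]) simp
    then show "h c = h d" by (simp add: h_def)
  qed
  interpret T: term_model L M U h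
  proof
    show "decides M U p" for p using F decides_mono[of M F p U] U(1) by simp
  qed (use univ U(2) h in auto)
  have F0U: "Y \<in> F0 \<Longrightarrow> Y \<in> U" for Y using F U(1) by blast
  have XU: "X \<in> U" using F0U by (simp add: F0_def)
  define pc where "pc = map (Base 3 :: nat \<Rightarrow> ('f, 'r) cst) [0..<length ps]"
  define A where "A = h ` set pc"
  define I where "I t i = [h (Base t i)]" for t i
  have concat_I: "concat (map (I t) is) = map h (map (Base t) is)" for t "is"
    by (induction "is") (simp_all add: I_def)
  have ind: "indiscernible L T.N (A \<union> (\<Union>s\<in>{0, 1} - {t}. \<Union>i. set (I s i))) (I t)" if t: "t \<in> {0, 1}" for t
    unfolding indiscernible_def
  proof (intro allI impI, elim conjE)
    fix \<psi> qs and "is" js :: "nat list"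
    assume qs: "set qs \<subseteq> A \<union> (\<Union>s\<in>{0, 1} - {t}. \<Union>i. set (I s i))"
      and srt: "sorted_wrt (<) is" "sorted_wrt (<) js" "length is = length js"
      and \<psi>: "fm_in L (length (concat (map (I t) is) @ qs)) \<psi>"
    have t': "{0, 1} - {t} = {1 - t}" using t by auto
    have "set qs \<subseteq> A \<union> (\<Union>i. set (I (1 - t) i))" using qs unfolding t' by (simp only: UN_insert UN_empty Un_empty_right)
    also have "\<dots> = h ` (set pc \<union> range (Base (1 - t)))"
      unfolding A_def I_def image_Un by (intro arg_cong2[of _ _ _ _ "(\<union>)"] refl) auto
    finally have "set qs \<subseteq> h ` (set pc \<union> range (Base (1 - t)))" .
    then have "qs \<in> map h ` lists (set pc \<union> range (Base (1 - t)))"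
      unfolding lists_image[symmetric] in_lists_conv_set subset_iff by (intro ballI) (elim allE impE)
    then obtain ds where "ds \<in> lists (set pc \<union> range (Base (1 - t)))" "qs = map h ds"
      by (elim imageE)
    then have ds: "set ds \<subseteq> set pc \<union> range (Base (1 - t))" "qs = map h ds" by auto
    have "set ds \<subseteq> range (Base 3) \<union> range (Base (1 - t))" using ds(1) by (auto simp: pc_def)
    then have "(\<psi>, is, js, ds, t) \<in> shift_data" using srt t by (auto simp: shift_data_def)
    then have "shift_set M (\<psi>, is, js, ds, t) \<in> U" by (intro F0U) (simp add: F0_def)
    then have "{e. holds M \<psi> (map e (map (Base t) is @ ds))} \<in> U \<longleftrightarrow> {e. holds M \<psi> (map e (map (Base t) js @ ds))} \<in> U"
      unfolding shift_set_def prod.case by (rule ultra_iff[OF U(2)])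
    moreover have "holds T.N \<psi> (concat (map (I t) ks) @ qs) \<longleftrightarrow> {e. holds M \<psi> (map e (map (Base t) ks @ ds))} \<in> U"
      if "length ks = length is" for ks
    proof -
      have "fm_in L (length (map (Base t) ks @ ds)) \<psi>"
        using \<psi> that unfolding concat_I ds(2) by simp
      from T.Los_holds[OF this] show ?thesis unfolding concat_I ds(2) by (simp only: map_append)
    qed
    ultimately show "holds T.N \<psi> (concat (map (I t) is) @ qs) \<longleftrightarrow> holds T.N \<psi> (concat (map (I t) js) @ qs)"
      using srt(3) by metis
  qed
  have small: "|A| <o cardSuc |UNIV :: ('f + 'r + nat) set|" if "finite A" for A :: "('f, 'r) big set"
  proof -
    have "|A| <o |UNIV :: ('f + 'r + nat) set|"
      by (rule finite_ordLess_infinite[OF card_of_Well_order card_of_Well_order])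
        (simp_all add: Field_card_of that finite_Plus_UNIV_iff)
    then show ?thesis using cardSuc_greater[OF card_of_Card_order] ordLess_transitive by blast
  qed
  have I_sub: "\<forall>t\<in>{0, 1}. tuple_seq T.N (I t)"
    by (auto simp: tuple_seq_def I_def T.univ_N)
  have "\<exists>t\<in>{0, 1}. indiscernible L T.N (insert (h (Base 2 0)) A) (I t)"
  proof (rule dp[unfolded dp_minimal_def dp_minimal_theory_def, rule_format])
    show "models L T.N (theory_of L M) \<and> highly_saturated L (cardSuc |UNIV :: ('f + 'r + nat) set| ) T.N"
      using T.models_N T.highly_saturated_N by blast
    show "A \<subseteq> univ T.N \<and> |A| <o cardSuc |UNIV :: ('f + 'r + nat) set| \<and> (\<forall>t\<in>{0, 1}. tuple_seq T.N (I t)) \<and>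
      mutually_indiscernible L T.N A {0, 1} I \<and> h (Base 2 0) \<in> univ T.N"
      using I_sub small[of A] ind unfolding mutually_indiscernible_def
      by (auto simp: A_def T.univ_N)
  qed
  then show False
  proof (elim bexE insertE emptyE)
    \<comment> \<open>\<open>P\<close> distinguishes the first two members of \<open>I 0\<close> at \<open>b\<close>.\<close>
    fix t assume ind: "indiscernible L T.N (insert (h (Base 2 0)) A) (I t)" and t: "t = 0"
    let ?c = "\<lambda>i. [Base 0 i, Base 2 0] @ pc"
    have los: "holds T.N \<phi> (I t i @ map h (Base 2 0 # pc)) \<longleftrightarrow> {e. holds M \<phi> (map e (?c i))} \<in> U" for i
      using T.Los_holds[of "?c i" \<phi>] \<phi> by (simp add: I_def t pc_def)
    have ne: "{e. holds M \<phi> (map e (?c 0)) \<noteq> holds M \<phi> (map e (?c 1))} \<in> U"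
      by (rule ultra_mono[OF U(2) XU]) (auto simp: X_def pattern_set_def pc_def P_iff comp_def)
    have "holds T.N \<phi> (I t 0 @ map h (Base 2 0 # pc)) \<noteq> holds T.N \<phi> (I t 1 @ map h (Base 2 0 # pc))"
      using ultra_xor[OF U(2) ne] unfolding los by (rule ssubst) simp
    then show False
      by (rule not_indiscernible_pair[OF ind, rotated 3]) (use \<phi> in \<open>auto simp: A_def I_def pc_def\<close>)
  next
    \<comment> \<open>\<open>b\<close> lies between the first two members of \<open>I 1\<close>.\<close>
    fix t assume ind: "indiscernible L T.N (insert (h (Base 2 0)) A) (I t)" and t: "t = 1"
    let ?c = "\<lambda>i. [Base 1 i, Base 2 0]"
    let ?\<psi> = "Rel r [Var 1, Var 0] :: ('f, 'r) fm"
    have \<psi>: "fm_in L (Suc (Suc 0)) ?\<psi>" by (auto simp: fm_in_def r)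
    have los: "holds T.N ?\<psi> (I t i @ [h (Base 2 0)]) \<longleftrightarrow> {e. e (Base 2 0) < e (Base 1 i)} \<in> U" for i
      using T.Los_holds[of "?c i" ?\<psi>] \<psi> by (simp add: I_def t holds_def r)
    have ne: "{e. (e (Base 2 0) < e (Base 1 0)) \<noteq> (e (Base 2 0) < e (Base 1 1))} \<in> U"
      by (rule ultra_mono[OF U(2) XU]) (auto simp: X_def pattern_set_def)
    have "holds T.N ?\<psi> (I t 0 @ [h (Base 2 0)]) \<noteq> holds T.N ?\<psi> (I t 1 @ [h (Base 2 0)])"
      using ultra_xor[OF U(2) ne] unfolding los by (rule ssubst) simp
    then show False
      by (rule not_indiscernible_pair[OF ind, rotated 3]) (use \<psi> in \<open>auto simp: I_def\<close>)
  qed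
qed

section \<open>Definable predicates\<close>

text \<open>Variables with even numbers are the arguments of a predicate and those with odd numbers hold
  parameters. So there is always room for further parameters and for bound variables.\<close>

definition mix :: "(nat \<Rightarrow> 'a) \<Rightarrow> (nat \<Rightarrow> 'a) \<Rightarrow> nat \<Rightarrow> 'a" where
  "mix e g v = (if even v then e (v div 2) else g (v div 2))"

lemma mix_simps [simp]: "mix e g (2 * i) = e i" "mix e g (Suc (2 * i)) = g i"
  by (simp_all add: mix_def)

lemma mix_0_1 [simp]: "mix e g 0 = e 0" "mix e g (Suc 0) = g 0"
  by (simp_all add: mix_def)

locale group_expansion =
  fixes L :: "('f, 'r) lang" and M :: "('a::linordered_ab_group_add, 'f, 'r) struct"
  assumes expands: "expands_ordered_group L M"
begin

lemma univ_M: "univ M = UNIV" using expands by (simp add: expands_ordered_group_def)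

definition definable_pred :: "((nat \<Rightarrow> 'a) \<Rightarrow> bool) \<Rightarrow> bool" where
  "definable_pred \<Phi> \<longleftrightarrow> (\<exists>\<phi> g. wf_fm L \<phi> \<and> (\<forall>e. \<Phi> e \<longleftrightarrow> sat M (mix e g) \<phi>))"

text \<open>The graph is definable; the value is the new variable \<open>0\<close>, as in de Bruijn notation.\<close>

definition definable_fun :: "((nat \<Rightarrow> 'a) \<Rightarrow> 'a) \<Rightarrow> bool" where
  "definable_fun t \<longleftrightarrow> definable_pred (\<lambda>e. e 0 = t (\<lambda>i. e (Suc i)))"

lemma predI: "wf_fm L \<phi> \<Longrightarrow> (\<And>e. \<Phi> e \<longleftrightarrow> sat M (mix e g) \<phi>) \<Longrightarrow> definable_pred \<Phi>"
  unfolding definable_pred_def by blast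

lemma pred_not: "definable_pred \<Phi> \<Longrightarrow> definable_pred (\<lambda>e. \<not> \<Phi> e)"
  unfolding definable_pred_def by (metis sat.simps(3) wf_fm.simps(3))

lemma pred_conj:
  assumes "definable_pred \<Phi>" "definable_pred \<Psi>"
  shows "definable_pred (\<lambda>e. \<Phi> e \<and> \<Psi> e)"
proof -
  obtain \<phi> g where \<phi>: "wf_fm L \<phi>" "\<And>e. \<Phi> e \<longleftrightarrow> sat M (mix e g) \<phi>" using assms(1) unfolding definable_pred_def by blast
  obtain \<psi> k where \<psi>: "wf_fm L \<psi>" "\<And>e. \<Psi> e \<longleftrightarrow> sat M (mix e k) \<psi>" using assms(2) unfolding definable_pred_def by blast
  define r where "r v = (if even v then v else Suc (2 * (2 * (v div 2))))" for v :: nat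
  define s where "s v = (if even v then v else Suc (2 * Suc (2 * (v div 2))))" for v :: nat
  have inj: "inj r" "inj s"
    by (rule injI; simp add: r_def s_def split: if_splits; presburger)+
  have "mix e (mix g k) (r v) = mix e g v" "mix e (mix g k) (s v) = mix e k v" for e v
  proof -
    have "odd v \<Longrightarrow> (v - Suc 0) div 2 = v div 2" by presburger
    then show "mix e (mix g k) (r v) = mix e g v" "mix e (mix g k) (s v) = mix e k v"
      by (simp_all add: r_def s_def del: mult_Suc_right) (simp_all add: mix_def)
  qed
  then have "(\<lambda>i. mix e (mix g k) (r i)) = mix e g" "(\<lambda>i. mix e (mix g k) (s i)) = mix e k" for e by auto
  then show ?thesis
    by (intro predI[of "Conj (ren r \<phi>) (ren s \<psi>)" _ "mix g k"]) (simp_all add: wf_ren sat_ren inj \<phi> \<psi>)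
qed

lemma pred_disj: "definable_pred \<Phi> \<Longrightarrow> definable_pred \<Psi> \<Longrightarrow> definable_pred (\<lambda>e. \<Phi> e \<or> \<Psi> e)"
  using pred_not[OF pred_conj[OF pred_not pred_not], of \<Phi> \<Psi>] by simp

lemma pred_imp: "definable_pred \<Phi> \<Longrightarrow> definable_pred \<Psi> \<Longrightarrow> definable_pred (\<lambda>e. \<Phi> e \<longrightarrow> \<Psi> e)"
  using pred_not[OF pred_conj[OF _ pred_not], of \<Phi> \<Psi>] by simp

lemma pred_iff: "definable_pred \<Phi> \<Longrightarrow> definable_pred \<Psi> \<Longrightarrow> definable_pred (\<lambda>e. \<Phi> e \<longleftrightarrow> \<Psi> e)"
  using pred_conj[OF pred_imp pred_imp, of \<Phi> \<Psi> \<Psi> \<Phi>] by (simp add: iff_conv_conj_imp)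

text \<open>In this form, the rule reduces a predicate written with HOL quantifiers to its atoms by plain
  resolution: the bound element becomes variable \<open>0\<close> and the other variables are shifted.\<close>

lemma pred_ex:
  assumes "definable_pred (\<lambda>e. Q (e 0) (\<lambda>i. e (Suc i)))"
  shows "definable_pred (\<lambda>e. \<exists>a. Q a e)"
proof -
  obtain \<phi> g where \<phi>: "wf_fm L \<phi>" "\<And>e. Q (e 0) (\<lambda>i. e (Suc i)) \<longleftrightarrow> sat M (mix e g) \<phi>"
    using assms unfolding definable_pred_def by blast
  define r where "r v = (if v = 0 then 1 else if even v then v - 2 else v + 2)" for v :: nat
  have inj: "inj r"
    by (rule injI; simp add: r_def split: if_splits; presburger)
  define g' where "g' = case_nat undefined g"
  have "((mix e g')(1 := a)) (r v) = mix (case_nat a e) g v" for a e v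
  proof (cases "even v")
    case True
    then obtain i where i: "v = 2 * i" by blast
    then show ?thesis by (cases i) (simp_all add: r_def mix_def)
  next
    case False
    then obtain i where i: "v = Suc (2 * i)" by (metis oddE Suc_eq_plus1)
    have "r v = Suc (2 * Suc i)" by (simp add: r_def i)
    then show ?thesis by (simp add: i g'_def del: mult_Suc_right)
  qed
  then have env: "(\<lambda>v. ((mix e g')(1 := a)) (r v)) = mix (case_nat a e) g" for a e by (rule ext)
  have Q: "Q a e \<longleftrightarrow> sat M (mix (case_nat a e) g) \<phi>" for a e
    using \<phi>(2)[of "case_nat a e"] by simp
  have "(\<exists>a. Q a e) \<longleftrightarrow> sat M (mix e g') (Ex 1 (ren r \<phi>))" for e
    unfolding sat.simps sat_ren[OF inj] env Q univ_M by simp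
  then show ?thesis by (intro predI[of "Ex 1 (ren r \<phi>)" _ g']) (simp_all add: wf_ren \<phi>(1) del: sat.simps)
qed

lemma pred_all:
  assumes "definable_pred (\<lambda>e. Q (e 0) (\<lambda>i. e (Suc i)))"
  shows "definable_pred (\<lambda>e. \<forall>a. Q a e)"
  using pred_not[OF pred_ex[OF pred_not[OF assms]]] by simp

lemma pred_ren:
  assumes "definable_pred \<Phi>" "inj f"
  shows "definable_pred (\<lambda>e. \<Phi> (\<lambda>i. e (f i)))"
proof -
  obtain \<phi> g where \<phi>: "wf_fm L \<phi>" "\<And>e. \<Phi> e \<longleftrightarrow> sat M (mix e g) \<phi>" using assms(1) unfolding definable_pred_def by blast
  define r where "r v = (if even v then 2 * f (v div 2) else v)" for v :: nat
  have inj: "inj r"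
  proof (rule injI)
    fix x y assume eq: "r x = r y"
    have "even (r v) \<longleftrightarrow> even v" for v by (simp add: r_def)
    with eq have par: "even x \<longleftrightarrow> even y" by metis
    show "x = y"
    proof (cases "even x")
      case True
      then have "x div 2 = y div 2" using eq par assms(2) by (simp add: r_def inj_eq)
      with True par show ?thesis by presburger
    qed (use eq par in \<open>simp add: r_def\<close>)
  qed
  have "mix e g (r v) = mix (\<lambda>i. e (f i)) g v" for e v by (simp add: r_def mix_def)
  then have "(\<lambda>v. mix e g (r v)) = mix (\<lambda>i. e (f i)) g" for e by (rule ext)
  then show ?thesis
    by (intro predI[of "ren r \<phi>" _ g]) (simp_all add: wf_ren sat_ren inj \<phi>)
qed

lemma pred_eq_var: "definable_pred (\<lambda>e. e i = e j)"
  by (rule predI[of "Eq (Var (2 * i)) (Var (2 * j))"]) simp_all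

lemma pred_eq_const: "definable_pred (\<lambda>e. e i = c)"
  by (rule predI[of "Eq (Var (2 * i)) (Var (Suc (2 * 0)))" _ "\<lambda>_. c"]) (simp_all del: mult_0_right)

lemma pred_less_var: "definable_pred (\<lambda>e. e i < e j)"
proof -
  obtain r where r: "rarity L r = 2" "\<And>x y. rels M r [x, y] \<longleftrightarrow> x < y"
    using expands by (auto simp: expands_ordered_group_def)
  then show ?thesis by (intro predI[of "Rel r [Var (2 * i), Var (2 * j)]"]) simp_all
qed

lemma pred_plus_var: "definable_pred (\<lambda>e. e i = e j + e k)"
proof -
  obtain f where f: "farity L f = 2" "\<And>x y. funs M f [x, y] = x + y"
    using expands by (auto simp: expands_ordered_group_def)
  then show ?thesis by (intro predI[of "Eq (Var (2 * i)) (App f [Var (2 * j), Var (2 * k)])"]) simp_all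
qed

lemma fun_ren3:
  assumes "definable_fun t" "k < 3"
  shows "definable_pred (\<lambda>e. e k = t (\<lambda>i. e (Suc (Suc (Suc i)))))"
proof -
  have "definable_pred (\<lambda>e. e 0 = t (\<lambda>i. e (Suc i)))" using assms(1) by (simp add: definable_fun_def)
  moreover have "inj (\<lambda>i. case i of 0 \<Rightarrow> k | Suc j \<Rightarrow> Suc (Suc (Suc j)))"
    using assms(2) by (auto simp: inj_def split: nat.splits)
  ultimately show ?thesis
    by (drule_tac pred_ren) (assumption, simp)
qed

lemma pred_subst3:
  assumes P: "definable_pred (\<lambda>e. P (e 0) (e 1) (e 2))" and t: "definable_fun r" "definable_fun s" "definable_fun t"
  shows "definable_pred (\<lambda>e. P (r e) (s e) (t e))"
proof -
  have "inj (\<lambda>i. if i = 0 then 2 else if i = 2 then 0 else i :: nat)" by (auto simp: inj_def)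
  from pred_ren[OF P this] have "definable_pred (\<lambda>e. P (e (Suc (Suc 0))) (e (Suc 0)) (e 0))" by (simp add: numeral_2_eq_2)
  then have "definable_pred (\<lambda>e. \<exists>a b c. a = r e \<and> b = s e \<and> c = t e \<and> P a b c)"
    by (intro pred_ex pred_conj fun_ren3 t) simp_all
  then show ?thesis by simp
qed

lemma pred_subst2: "definable_pred (\<lambda>e. P (e 0) (e 1)) \<Longrightarrow> definable_fun s \<Longrightarrow> definable_fun t \<Longrightarrow> definable_pred (\<lambda>e. P (s e) (t e))"
  using pred_subst3[of "\<lambda>a b c. P a b"] by blast

lemma pred_subst1: "definable_pred (\<lambda>e. P (e 0)) \<Longrightarrow> definable_fun t \<Longrightarrow> definable_pred (\<lambda>e. P (t e))"
  using pred_subst3[of "\<lambda>a b c. P a"] by blast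

lemma fun_var: "definable_fun (\<lambda>e. e i)"
  unfolding definable_fun_def by (rule pred_eq_var)

lemma fun_const: "definable_fun (\<lambda>e. c)"
  unfolding definable_fun_def by (rule pred_eq_const)

lemma fun_shift: "definable_fun t \<Longrightarrow> definable_fun (\<lambda>e. t (\<lambda>i. e (Suc i)))"
proof -
  assume "definable_fun t"
  then have "definable_pred (\<lambda>e. e 0 = t (\<lambda>i. e (Suc i)))" by (simp add: definable_fun_def)
  moreover have "inj (\<lambda>i. case i of 0 \<Rightarrow> 0 | Suc j \<Rightarrow> Suc (Suc j))"
    by (auto simp: inj_def split: nat.splits)
  ultimately show ?thesis unfolding definable_fun_def
    by (drule_tac pred_ren) (assumption, simp)
qed

lemma fun_add: "definable_fun s \<Longrightarrow> definable_fun t \<Longrightarrow> definable_fun (\<lambda>e. s e + t e)"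
  unfolding definable_fun_def[of "\<lambda>e. s e + t e"]
  using pred_subst3[of "\<lambda>a b c. a = b + c" "\<lambda>e. e 0", OF pred_plus_var fun_var fun_shift fun_shift] by blast

lemma fun_diff: "definable_fun s \<Longrightarrow> definable_fun t \<Longrightarrow> definable_fun (\<lambda>e. s e - t e)"
proof -
  assume st: "definable_fun s" "definable_fun t"
  have "definable_pred (\<lambda>e. e 1 = e 0 + e 2)" by (rule pred_plus_var)
  then have "definable_pred (\<lambda>e. e 0 = e 1 - e 2)" by (simp add: eq_diff_eq eq_commute)
  from pred_subst3[of "\<lambda>a b c. a = b - c" "\<lambda>e. e 0", OF this fun_var fun_shift fun_shift] st show ?thesis
    unfolding definable_fun_def[of "\<lambda>e. s e - t e"] by blast
qed

lemma pred_less: "definable_fun s \<Longrightarrow> definable_fun t \<Longrightarrow> definable_pred (\<lambda>e. s e < t e)"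
  using pred_subst2[of "(<)", OF pred_less_var] by blast

lemma pred_le: "definable_fun s \<Longrightarrow> definable_fun t \<Longrightarrow> definable_pred (\<lambda>e. s e \<le> t e)"
  using pred_not[OF pred_less, of t s] by (simp add: not_less)

lemma pred_eq: "definable_fun s \<Longrightarrow> definable_fun t \<Longrightarrow> definable_pred (\<lambda>e. s e = t e)"
  using pred_subst2[of "(=)", OF pred_eq_var] by blast

lemma pred_finite_bex:
  assumes "finite Y" "\<And>y. y \<in> Y \<Longrightarrow> definable_pred (Q y)"
  shows "definable_pred (\<lambda>e. \<exists>y\<in>Y. Q y e)"
  using assms
proof (induction Y rule: finite_induct)
  case empty
  then show ?case using pred_not[OF pred_eq[OF fun_var[of 0] fun_var[of 0]]] by simp
next
  case (insert y Y)
  then show ?case using pred_disj[of "Q y" "\<lambda>e. \<exists>y\<in>Y. Q y e"] by simp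
qed

lemma pred_definable_set:
  assumes "definable_set L M X"
  shows "definable_pred (\<lambda>e. e 0 \<in> X)"
proof -
  from assms[unfolded definable_set_def definable_def] obtain \<phi> where "\<exists>ps. set ps \<subseteq> univ M \<and>
    fm_in L (1 + length ps) \<phi> \<and> {[x] |x. x \<in> X} =
      {xs. length xs = 1 \<and> set xs \<subseteq> univ M \<and> holds M \<phi> (xs @ ps)}" ..
  then obtain ps where ps: "set ps \<subseteq> univ M \<and>
    fm_in L (1 + length ps) \<phi> \<and> {[x] |x. x \<in> X} =
      {xs. length xs = 1 \<and> set xs \<subseteq> univ M \<and> holds M \<phi> (xs @ ps)}" ..
  then have \<phi>: "fm_in L (1 + length ps) \<phi>" by (elim conjE)
  from ps have def: "{[x] |x. x \<in> X} =
      {xs. length xs = 1 \<and> set xs \<subseteq> univ M \<and> holds M \<phi> (xs @ ps)}" by (elim conjE)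
  have X_iff: "x \<in> X \<longleftrightarrow> holds M \<phi> (x # ps)" for x
  proof -
    have "x \<in> X \<longleftrightarrow> [x] \<in> {[x] |x. x \<in> X}" by simp
    also have "\<dots> \<longleftrightarrow> holds M \<phi> (x # ps)" unfolding def by (simp add: univ_M)
    finally show ?thesis .
  qed
  define r where "r v = (if v = 0 then 0 else 2 * v - 1)" for v :: nat
  have inj: "inj r" unfolding inj_def r_def by presburger
  have "mix e ((!) ps) (r v) = (e 0 # ps) ! v" for e v
    by (cases v) (simp_all add: r_def mix_def)
  then have "(\<lambda>v. mix e ((!) ps) (r v)) = (!) (e 0 # ps)" for e by (rule ext)
  then show ?thesis using \<phi>
    by (intro predI[of "ren r \<phi>" _ "(!) ps"]) (simp_all add: wf_ren sat_ren inj X_iff holds_def fm_in_def)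
qed

lemma definable_rel_of_pred:
  assumes "definable_pred (\<lambda>e. P (e 0) (e 1))"
  shows "definable_rel L M {(a, b). P a b}"
proof -
  obtain \<phi> g where \<phi>: "wf_fm L \<phi>" "\<And>e. P (e 0) (e 1) \<longleftrightarrow> sat M (mix e g) \<phi>"
    using assms unfolding definable_pred_def by blast
  obtain m where m: "fv \<phi> \<subseteq> {..<m}" using finite_fv[of \<phi>] unfolding finite_nat_iff_bounded ..
  \<comment> \<open>The variables \<open>0\<close> and \<open>2\<close> are the arguments \<open>e 0\<close> and \<open>e 1\<close>; all others become parameters.\<close>
  define r where "r v = (if v = 0 then 0 else if v = 2 then 1 else v + 2)" for v :: nat
  have inj: "inj r" unfolding inj_def r_def by presburger
  define ps where "ps = map (mix (\<lambda>_. 0) g) [0..<m]"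
  have P_iff: "P x y \<longleftrightarrow> holds M (ren r \<phi>) ([x, y] @ ps)" for x y
  proof -
    let ?e = "\<lambda>i. if i = 0 then x else if i = 1 then y else 0"
    have "sat M (\<lambda>v. ([x, y] @ ps) ! r v) \<phi> \<longleftrightarrow> sat M (mix ?e g) \<phi>"
    proof (rule sat_cong)
      fix v assume "v \<in> fv \<phi>"
      then have "v < m" using m by auto
      moreover have "v div 2 = 1 \<longleftrightarrow> v = 2" "v div 2 = 0 \<longleftrightarrow> v = 0" if "even v" using that by presburger+
      ultimately show "([x, y] @ ps) ! r v = mix ?e g v"
        by (auto simp: r_def ps_def mix_def)
    qed
    then show ?thesis using \<phi>(2)[of ?e] by (simp add: holds_def sat_ren[OF inj])
  qed
  have "r ` fv \<phi> \<subseteq> {..<2 + m}" using m by (auto simp: r_def)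
  then have "fm_in L (2 + length ps) (ren r \<phi>)"
    by (simp add: fm_in_def wf_ren fv_ren[OF inj] \<phi>(1) ps_def)
  moreover have "{[x, y] |x y. (x, y) \<in> {(a, b). P a b}} =
      {xs. length xs = 2 \<and> set xs \<subseteq> univ M \<and> holds M (ren r \<phi>) (xs @ ps)}"
    using P_iff by (auto simp: univ_M length_Suc_conv numeral_2_eq_2)
  ultimately show ?thesis unfolding definable_rel_def definable_def univ_M by blast
qed

end

section \<open>Multiples in ordered abelian groups\<close>

text \<open>The multiple \<open>n x\<close>, in the form in which \<open>multiples\<close> uses it.\<close>

definition nmult :: "nat \<Rightarrow> 'a::comm_monoid_add \<Rightarrow> 'a" where
  "nmult n x = (\<Sum>i<n. x)"

lemma nmult_simps [simp]: "nmult 0 x = 0" "nmult (Suc n) x = nmult n x + x" "nmult n 0 = 0"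
  by (simp_all add: nmult_def)

lemma nmult_add: "nmult (m + n) x = nmult m x + nmult n x"
  by (induction n) (simp_all add: add.assoc)

lemma nmult_plus: "nmult n (x + y) = nmult n x + nmult n y"
  by (simp add: nmult_def sum.distrib)

lemma nmult_mult: "nmult (m * n) x = nmult m (nmult n x)"
  by (induction m) (simp_all add: nmult_add add.commute)

lemma nmult_uminus: "nmult n (- x) = - nmult n (x :: 'a::ab_group_add)"
  by (simp add: nmult_def sum_negf)

lemma nmult_diff: "m \<le> n \<Longrightarrow> nmult (n - m) x = nmult n x - nmult m (x :: 'a::ab_group_add)"
  using nmult_add[of "n - m" m x] by simp

lemma nmult_nonneg: "0 \<le> x \<Longrightarrow> 0 \<le> nmult n (x :: 'a::linordered_ab_group_add)"
  by (induction n) simp_all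

lemma nmult_mono: "m \<le> n \<Longrightarrow> 0 \<le> x \<Longrightarrow> nmult m x \<le> nmult n (x :: 'a::linordered_ab_group_add)"
  using nmult_diff[of m n x] nmult_nonneg[of x "n - m"] by simp

lemma nmult_strict: "0 < x \<Longrightarrow> 0 < n \<Longrightarrow> 0 < nmult n (x :: 'a::linordered_ab_group_add)"
  using nmult_mono[of 1 n x] by (auto intro: less_le_trans)

lemma nmult_strict_mono: "m < n \<Longrightarrow> 0 < x \<Longrightarrow> nmult m x < nmult n (x :: 'a::linordered_ab_group_add)"
  using nmult_diff[of m n x] nmult_strict[of x "n - m"] by simp

lemma multiples_iff: "x \<in> multiples n \<longleftrightarrow> (\<exists>y. x = nmult n y)"
  by (auto simp: multiples_def nmult_def)

lemma multiples_nmult: "nmult n y \<in> multiples n"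
  by (auto simp: multiples_iff)

lemma multiples_0: "0 \<in> multiples n"
  using multiples_nmult[of n 0] by simp

lemma multiples_add: "x \<in> multiples n \<Longrightarrow> y \<in> multiples n \<Longrightarrow> x + y \<in> multiples n"
  by (auto simp: multiples_iff simp flip: nmult_plus)

lemma multiples_uminus: "x \<in> multiples n \<Longrightarrow> - x \<in> multiples (n :: nat)" for x :: "'a::ab_group_add"
  by (auto simp: multiples_iff simp flip: nmult_uminus)

lemma multiples_diff: "x \<in> multiples n \<Longrightarrow> y \<in> multiples n \<Longrightarrow> x - y \<in> multiples n" for x :: "'a::ab_group_add"
  using multiples_add[of x n "- y"] multiples_uminus[of y n] by simp

lemma multiples_cong_trans: "x - y \<in> multiples n \<Longrightarrow> y - z \<in> multiples n \<Longrightarrow> x - z \<in> multiples n"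
  for x :: "'a::ab_group_add"
  using multiples_add[of "x - y" n "y - z"] by simp

lemma multiples_cong_sym: "x - y \<in> multiples n \<Longrightarrow> y - x \<in> multiples n" for x :: "'a::ab_group_add"
  using multiples_uminus[of "x - y" n] by simp

section \<open>Convex equivalence relations from cosets\<close>

text \<open>The last elements of the coset \<open>h + nM\<close> up to \<open>x\<close> belong to \<open>X\<close>. For \<open>x\<close> in the coset this says
  that \<open>x \<in> X\<close>, but it makes sense for all \<open>x\<close>, and so its truth value can be compared at any two
  points.\<close>

definition coset_run :: "nat \<Rightarrow> 'a::linordered_ab_group_add set \<Rightarrow> 'a \<Rightarrow> 'a \<Rightarrow> bool" where
  "coset_run n X h x \<longleftrightarrow> (\<exists>a. a - h \<in> multiples n \<and> a \<in> X \<and> a \<le> x \<and>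
     (\<forall>b. b - h \<in> multiples n \<and> a \<le> b \<and> b \<le> x \<longrightarrow> b \<in> X))"

definition same_run :: "nat \<Rightarrow> 'a::linordered_ab_group_add set \<Rightarrow> 'a \<Rightarrow> 'a \<Rightarrow> bool" where
  "same_run n X x y \<longleftrightarrow> (\<forall>h z. x \<le> z \<and> z \<le> y \<or> y \<le> z \<and> z \<le> x \<longrightarrow> (coset_run n X h z \<longleftrightarrow> coset_run n X h x))"

definition run_rel :: "nat \<Rightarrow> 'a::linordered_ab_group_add set \<Rightarrow> ('a \<times> 'a) set" where
  "run_rel n X = {(x, y). same_run n X x y}"

lemma same_run_refl: "same_run n X x x"
  unfolding same_run_def by (metis order_antisym)

lemma same_run_sym: "same_run n X x y \<Longrightarrow> same_run n X y x"
  unfolding same_run_def by (metis order_refl linear)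

lemma same_run_trans:
  assumes "same_run n X x y" "same_run n X y z"
  shows "same_run n X x z"
  unfolding same_run_def
proof (intro allI impI)
  fix h w assume w: "x \<le> w \<and> w \<le> z \<or> z \<le> w \<and> w \<le> x"
  have yx: "coset_run n X h y \<longleftrightarrow> coset_run n X h x"
    using assms(1) linear[of x y] unfolding same_run_def by blast
  have "(x \<le> w \<and> w \<le> y \<or> y \<le> w \<and> w \<le> x) \<or> (y \<le> w \<and> w \<le> z \<or> z \<le> w \<and> w \<le> y)"
    using w by (meson linear order_trans)
  then show "coset_run n X h w \<longleftrightarrow> coset_run n X h x"
    using assms yx unfolding same_run_def by blast
qed

lemma same_run_between: "same_run n X x y \<Longrightarrow> x \<le> z \<Longrightarrow> z \<le> y \<Longrightarrow> same_run n X x z"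
  unfolding same_run_def by (meson order_trans order_antisym)

lemma convex_equiv_run_rel: "convex_equiv (run_rel n X)"
proof -
  have eq: "equiv UNIV (run_rel n X)"
    by (rule equivI)
      (auto simp: refl_on_def sym_def trans_def run_rel_def intro: same_run_refl same_run_sym same_run_trans)
  have "order_convex C" if "C \<in> UNIV // run_rel n X" for C
  proof -
    from that obtain x where C: "C = run_rel n X `` {x}" by (rule quotientE)
    show ?thesis
      unfolding order_convex_def
    proof (intro ballI allI impI, elim conjE)
      fix a a' b assume a: "a \<in> C" "a' \<in> C" and b: "a < b" "b < a'"
      have "same_run n X x a" "same_run n X x a'" using a by (auto simp: C run_rel_def)
      then have "same_run n X a a'" using same_run_sym same_run_trans by blast
      then have "same_run n X a b" using b by (intro same_run_between[of n X a a' b]) auto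
      then show "b \<in> C" using \<open>same_run n X x a\<close> same_run_trans by (auto simp: C run_rel_def)
    qed
  qed
  with eq show ?thesis by (simp add: convex_equiv_def)
qed

lemma same_run_mem:
  assumes "same_run n X b z" "b \<in> X" "z - b \<in> multiples n"
  shows "z \<in> X"
proof -
  have "coset_run n X b b"
    unfolding coset_run_def by (rule exI[of _ b]) (use assms(2) multiples_0 in \<open>auto dest: order_antisym\<close>)
  then have "coset_run n X b z" using assms(1) linear[of b z] unfolding same_run_def by blast
  then show ?thesis using assms(3) unfolding coset_run_def by blast
qed

text \<open>If \<open>X\<close> is \<open>nM\<close>-invariant on the convex set \<open>C\<close>, then a coset that meets \<open>C\<close> is contained in \<open>X\<close> or
  disjoint from it there, and this answer is visible from all points of \<open>C'\<close>, as the coset has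
  elements of \<open>C\<close> below each of them. For a coset that misses \<open>C\<close>, the answer is determined below \<open>C\<close>.\<close>

lemma same_runI:
  assumes C: "\<And>a b c. a \<in> C \<Longrightarrow> c \<in> C \<Longrightarrow> a \<le> b \<Longrightarrow> b \<le> c \<Longrightarrow> b \<in> C"
    and C': "\<And>a b c. a \<in> C' \<Longrightarrow> c \<in> C' \<Longrightarrow> a \<le> b \<Longrightarrow> b \<le> c \<Longrightarrow> b \<in> C'" "C' \<subseteq> C"
    and inv: "\<And>x y. x \<in> C \<Longrightarrow> y \<in> C \<Longrightarrow> x - y \<in> multiples n \<Longrightarrow> x \<in> X \<Longrightarrow> y \<in> X"
    and coin: "\<And>z w. z \<in> C' \<Longrightarrow> w \<in> C \<Longrightarrow> \<exists>w'\<in>C. w' - w \<in> multiples n \<and> w' \<le> z"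
    and x: "x \<in> C'" "y \<in> C'"
  shows "same_run n X x y"
proof -
  have run: "coset_run n X h z'" if run: "coset_run n X h z" and z: "z \<in> C'" "z' \<in> C'" for h z z'
  proof -
    obtain a where a: "a - h \<in> multiples n" "a \<in> X" "a \<le> z"
      "\<And>b. b - h \<in> multiples n \<Longrightarrow> a \<le> b \<Longrightarrow> b \<le> z \<Longrightarrow> b \<in> X"
      using run unfolding coset_run_def by blast
    have zC: "z \<in> C" "z' \<in> C" using z C'(2) by auto
    show ?thesis
    proof (cases "\<exists>w\<in>C. w - h \<in> multiples n")
      case True
      then obtain w where w: "w \<in> C" "w - h \<in> multiples n" by blast
      obtain w1 where w1: "w1 \<in> C" "w1 - w \<in> multiples n" "w1 \<le> z" using coin[OF z(1) w(1)] by blast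
      obtain w2 where w2: "w2 \<in> C" "w2 - w \<in> multiples n" "w2 \<le> z'" using coin[OF z(2) w(1)] by blast
      have h1: "w1 - h \<in> multiples n" and h2: "w2 - h \<in> multiples n"
        using w1(2) w2(2) w(2) multiples_cong_trans by blast+
      have "w1 \<in> X"
      proof (cases "a \<le> w1")
        case True
        then show ?thesis using a(4) h1 w1(3) by blast
      next
        case False
        then have "a \<in> C" using C[OF w1(1) zC(1), of a] a(3) by simp
        moreover have "a - w1 \<in> multiples n" using a(1) h1 multiples_cong_trans multiples_cong_sym by blast
        ultimately show ?thesis using inv[OF _ w1(1)] a(2) by blast
      qed
      have "b \<in> X" if "b - h \<in> multiples n" "w2 \<le> b" "b \<le> z'" for b
      proof -
        have "b \<in> C" using C[OF w2(1) zC(2)] that by blast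
        moreover have "w1 - b \<in> multiples n" using that(1) h1 multiples_cong_trans multiples_cong_sym by blast
        ultimately show ?thesis using inv[OF w1(1)] \<open>w1 \<in> X\<close> by blast
      qed
      then show ?thesis
        using h2 w2(3) unfolding coset_run_def by (intro exI[of _ w2]) auto
    next
      case False
      then have "a \<notin> C" using a(1) by blast
      have "a \<le> z'"
        using C[OF zC(2) zC(1), of a] a(3) \<open>a \<notin> C\<close> by (meson linear)
      moreover have "b \<in> X" if b: "b - h \<in> multiples n" "a \<le> b" "b \<le> z'" for b
      proof (cases "b \<le> z")
        case True
        then show ?thesis using a(4) b by blast
      next
        case False
        then have "b \<in> C" using C[OF zC(1) zC(2), of b] b(3) by simp
        then show ?thesis using b(1) \<open>\<not> (\<exists>w\<in>C. w - h \<in> multiples n)\<close> by blast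
      qed
      ultimately show ?thesis using a(1,2) unfolding coset_run_def by (intro exI[of _ a]) auto
    qed
  qed
  show ?thesis
    unfolding same_run_def
  proof (intro allI impI)
    fix h z assume "x \<le> z \<and> z \<le> y \<or> y \<le> z \<and> z \<le> x"
    then have "z \<in> C'" using C'(1)[of x y z] C'(1)[of y x z] x by blast
    then show "coset_run n X h z \<longleftrightarrow> coset_run n X h x" using run x(1) by blast
  qed
qed

section \<open>Consequences of dp-minimality\<close>

lemma greedy_sequence:
  assumes "\<And>G. finite G \<Longrightarrow> \<exists>x. Q x \<and> (\<forall>g\<in>G. R g x)"
  shows "\<exists>s :: nat \<Rightarrow> 'b. \<forall>j. Q (s j) \<and> (\<forall>i<j. R (s i) (s j))"
proof -
  obtain F where F: "\<And>G. finite G \<Longrightarrow> Q (F G) \<and> (\<forall>g\<in>G. R g (F G))"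
    using assms by metis
  define l where "l = rec_nat [] (\<lambda>n xs. xs @ [F (set xs)])"
  have l: "l 0 = []" "l (Suc n) = l n @ [F (set (l n))]" for n by (simp_all add: l_def)
  define s where "s n = F (set (l n))" for n
  have "set (l n) = s ` {..<n}" for n
    by (induction n) (simp_all add: l s_def lessThan_Suc)
  then have sj: "F (s ` {..<j}) = s j" for j using s_def[of j] by simp
  have "Q (s j) \<and> (\<forall>i<j. R (s i) (s j))" for j
    using F[of "s ` {..<j}"] unfolding sj by simp
  then show ?thesis by blast
qed

lemma finite_representatives:
  assumes "\<And>s :: nat \<Rightarrow> 'b. (\<And>i j. i < j \<Longrightarrow> \<not> R (s i) (s j)) \<Longrightarrow> False"
  shows "\<exists>Y. finite Y \<and> (\<forall>x. \<exists>y\<in>Y. R y x)"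
proof (rule ccontr)
  assume nex: "\<not> ?thesis"
  have "\<exists>x. True \<and> (\<forall>g\<in>G. \<not> R g x)" if "finite G" for G using that nex by blast
  from greedy_sequence[of "\<lambda>_. True", OF this] obtain s :: "nat \<Rightarrow> 'b" where "\<forall>j. True \<and> (\<forall>i<j. \<not> R (s i) (s j))" ..
  then show False by (intro assms[of s]) simp
qed

lemma pigeonhole_le:
  assumes "finite Y" "\<And>i. i \<le> card Y \<Longrightarrow> f i \<in> Y"
  shows "\<exists>i i'. i < i' \<and> i' \<le> card Y \<and> f i = f i'"
proof -
  have "\<not> inj_on f {..card Y}"
  proof
    assume "inj_on f {..card Y}"
    then have "card {..card Y} \<le> card Y" using assms by (intro card_inj_on_le[of f]) auto
    then show False by simp
  qed
  then show ?thesis unfolding inj_on_def by (metis atMost_iff linorder_neqE_nat)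
qed

lemma increasing_enumeration:
  fixes S :: "'b::linorder set"
  assumes "finite S" "card S = Suc N"
  shows "\<exists>e. (\<forall>j\<le>N. e j \<in> S) \<and> (\<forall>j<N. e j < e (Suc j))"
proof (intro exI conjI allI impI)
  let ?e = "(!) (sorted_list_of_set S)"
  show "?e j \<in> S" if "j \<le> N" for j
    using nth_mem[of j "sorted_list_of_set S"] assms that by simp
  show "?e j < ?e (Suc j)" if "j < N" for j
    using sorted_wrt_nth_less[OF strict_sorted_list_of_set[of S], of j "Suc j"] assms that by simp
qed

locale dp_minimal_expansion = group_expansion L M
  for L :: "('f, 'r) lang" and M :: "('a::linordered_ab_group_add, 'f, 'r) struct" +
  assumes dp: "dp_minimal L M"
begin

lemma pattern_False:
  assumes "definable_pred (\<lambda>e. P (e 0) (e 1))"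
    and "\<And>N. \<exists>a h. separated P N a h"
  shows False
  using no_pattern[OF expands dp definable_rel_of_pred[OF assms(1)] assms(2)] .

lemma fun_nmult: "definable_fun t \<Longrightarrow> definable_fun (\<lambda>e. nmult n (t e))"
proof (induction n)
  case 0
  show ?case using fun_const[of 0] by simp
next
  case (Suc n)
  then show ?case using fun_add[of "\<lambda>e. nmult n (t e)" t] by simp
qed

lemma pred_multiples: "definable_fun t \<Longrightarrow> definable_pred (\<lambda>e. t e \<in> multiples n)"
proof -
  assume t: "definable_fun t"
  have "definable_pred (\<lambda>e. e 0 \<in> multiples n)"
    unfolding multiples_iff by (intro pred_ex pred_eq fun_nmult fun_var)
  from pred_subst1[OF this t] show ?thesis .
qed

lemmas pred_intros = pred_ex pred_all pred_conj pred_disj pred_imp pred_iff pred_not pred_less pred_le pred_eq pred_multiples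
  fun_add fun_diff fun_nmult fun_var fun_const

text \<open>If the \<open>s\<^sub>i\<close> lie in different cosets and have absolute value below \<open>c\<close>, then \<open>(2j + 1) n c + s\<^sub>i\<close> is in
  the coset of \<open>s\<^sub>i\<close> and between \<open>2j n c\<close> and \<open>2(j + 1) n c\<close>. So all these intervals meet all the cosets.\<close>

lemma finite_index:
  assumes n: "0 < n"
  shows "\<exists>G :: 'a set. finite G \<and> (\<forall>x. \<exists>g\<in>G. x - g \<in> multiples n)"
proof (rule finite_representatives)
  fix s :: "nat \<Rightarrow> 'a" assume s: "\<And>i j. i < j \<Longrightarrow> s j - s i \<notin> multiples n"
  show False
  proof (rule pattern_False[of "\<lambda>a b. b - a \<in> multiples n"])
    show "definable_pred (\<lambda>e. e 1 - e 0 \<in> multiples n)" by (intro pred_intros)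
    fix N
    have "(0 :: 'a) \<in> multiples n" by (rule multiples_0)
    then have "s 1 \<noteq> s 0" using s[of 0 1] by (intro notI) simp
    then have p: "0 < max (s 1 - s 0) (s 0 - s 1)" by (auto simp: less_max_iff_disj)
    define m where "m i = max (s i) (- s i)" for i
    define c where "c = Max (m ` {..N}) + max (s 1 - s 0) (s 0 - s 1)"
    have "m i < c" if "i \<le> N" for i
    proof -
      have "m i \<le> Max (m ` {..N})" using that by (intro Max_ge) auto
      then show ?thesis unfolding c_def using add_le_less_mono[OF _ p] by fastforce
    qed
    then have c: "s i < c" "- s i < c" if "i \<le> N" for i
      using that unfolding m_def by simp_all
    have "0 < c"
    proof (rule ccontr)
      assume "\<not> 0 < c"
      then have "c \<le> 0" by simp
      then have "s 0 < 0" "- s 0 < 0" using less_le_trans[OF c(1)[of 0]] less_le_trans[OF c(2)[of 0]] by blast+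
      then show False by simp
    qed
    define h where "h j = nmult (2 * j) (nmult n c)" for j
    have nc: "c \<le> nmult n c" using nmult_mono[of 1 n c] n \<open>0 < c\<close> by simp
    have h_Suc: "h (Suc j) = h j + nmult n c + nmult n c" for j
      by (simp add: h_def add.assoc)
    have h_less: "h j < h (Suc j)" for j
      using nmult_strict_mono[of "2 * j" "2 * Suc j" "nmult n c"] \<open>0 < c\<close> nc by (simp add: h_def)
    have diff: "\<exists>b. h j \<le> b \<and> b < h (Suc j) \<and> (b - s i \<in> multiples n) \<noteq> (b - s i' \<in> multiples n)"
      if "i < i'" "i' < N" for i i' j
    proof (intro exI conjI)
      let ?m = "h j + nmult n c"
      have "i \<le> N" using that by simp
      then have "- c \<le> s i" "s i < nmult n c" using c[of i] nc by (auto simp: minus_less_iff intro: less_le_trans)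
      then show "h j \<le> ?m + s i" "?m + s i < h (Suc j)"
        using add_mono[OF nc \<open>- c \<le> s i\<close>] by (simp_all add: h_Suc add.assoc)
      have m: "?m \<in> multiples n"
        unfolding h_def using multiples_nmult[of n "nmult (2 * j) c + c"]
        by (simp add: nmult_plus mult.commute flip: nmult_mult)
      have "\<not> (?m + s i) - s i' \<in> multiples n"
      proof
        assume "?m + s i - s i' \<in> multiples n"
        from multiples_diff[OF m this] have "s i' - s i \<in> multiples n" by (simp add: algebra_simps)
        then show False using s that by blast
      qed
      then show "(?m + s i - s i \<in> multiples n) \<noteq> (?m + s i - s i' \<in> multiples n)" using m by simp
    qed
    show "\<exists>a h. separated (\<lambda>a b :: 'a. b - a \<in> multiples n) N a h"
      by (rule separatedI[where a = s and h = h]) (rule h_less, rule diff)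
  qed
qed

text \<open>A pattern of translates of \<open>D\<close>: the point \<open>e\<^sub>j + t\<^sub>i\<^sub>'\<close> lies in \<open>D + t\<^sub>i\<^sub>'\<close> and not in \<open>D + t\<^sub>i\<close>, and the
  cut points are the \<open>e\<^sub>j\<close>.\<close>

lemma sparse_False:
  assumes D: "definable_pred (\<lambda>e. e 0 \<in> D)"
    and pat: "\<And>N. \<exists>e t. (\<forall>j\<le>N. e j \<in> D) \<and> (\<forall>j<N. e j < e (Suc j)) \<and>
      (\<forall>i<N. 0 \<le> t i) \<and> (\<forall>i<N. \<forall>j<N. e j + t i < e (Suc j)) \<and>
      (\<forall>i i' j. i < i' \<and> i' < N \<and> j < N \<longrightarrow> e j + (t i' - t i) \<notin> D)"
  shows False
proof (rule pattern_False[of "\<lambda>a b. b - a \<in> D"])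
  show "definable_pred (\<lambda>e. e 1 - e 0 \<in> D)" by (intro pred_subst1[OF D] pred_intros)
  fix N
  from pat[of N] obtain e t where "\<forall>j\<le>N. e j \<in> D" "\<forall>j<N. e j < e (Suc j)" "\<forall>i<N. 0 \<le> t i"
    "\<forall>i<N. \<forall>j<N. e j + t i < e (Suc j)"
    "\<forall>i i' j. i < i' \<and> i' < N \<and> j < N \<longrightarrow> e j + (t i' - t i) \<notin> D"
    by (elim exE conjE)
  then have e: "\<And>j. j \<le> N \<Longrightarrow> e j \<in> D" "\<And>j. j < N \<Longrightarrow> e j < e (Suc j)"
    and t: "\<And>i. i < N \<Longrightarrow> 0 \<le> t i" "\<And>i j. i < N \<Longrightarrow> j < N \<Longrightarrow> e j + t i < e (Suc j)"
    and D: "\<And>i i' j. i < i' \<Longrightarrow> i' < N \<Longrightarrow> j < N \<Longrightarrow> e j + (t i' - t i) \<notin> D"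
    by simp_all
  have diff: "\<exists>b. e j \<le> b \<and> b < e (Suc j) \<and> (b - t i \<in> D) \<noteq> (b - t i' \<in> D)" if "i < i'" "i' < N" "j < N" for i i' j
  proof (intro exI conjI)
    show "e j \<le> e j + t i'" using t(1) that by simp
    show "e j + t i' < e (Suc j)" using t(2) that by simp
    show "(e j + t i' - t i \<in> D) \<noteq> (e j + t i' - t i' \<in> D)"
      using D[OF that] e(1)[of j] that by (simp add: add_diff_eq)
  qed
  show "\<exists>a h. separated (\<lambda>a b. b - a \<in> D) N a h"
    by (rule separatedI[where a = t and h = e]) (erule e(2), rule diff)
qed

lemma definable_run_rel:
  assumes X: "definable_pred (\<lambda>e. e 0 \<in> X)"
  shows "definable_rel L M (run_rel n X)"
  unfolding run_rel_def
proof (rule definable_rel_of_pred)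
  show "definable_pred (\<lambda>e. same_run n X (e 0) (e 1))"
    unfolding same_run_def coset_run_def by (intro pred_intros pred_subst1[OF X])
qed

text \<open>Finitely many finite classes are left if finitely many points have a finite class. On one class,
  \<open>B\<close> consists of one point of \<open>X\<close> for each coset of \<open>nM\<close> that has one.\<close>

lemma theorem_of_finite_classes:
  assumes X: "definable_pred (\<lambda>e. e 0 \<in> X)" and n: "0 < n" and fin: "finite {x. finite {y. same_run n X x y}}"
  shows "\<exists>(n::nat) E. definable_rel L M E \<and> convex_equiv E \<and>
    finite {C \<in> UNIV // E. finite C} \<and>
    (\<forall>a. \<exists>B. finite B \<and> E `` {a} \<inter> X = E `` {a} \<inter> (\<Union>b\<in>B. (\<lambda>y. b + y) ` multiples n))"
proof (rule exI[of _ n], rule exI[of _ "run_rel n X"], intro conjI allI)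
  let ?E = "run_rel n X"
  have cls: "?E `` {x} = {y. same_run n X x y}" for x by (auto simp: run_rel_def)
  show "definable_rel L M ?E" by (rule definable_run_rel[OF X])
  show "convex_equiv ?E" by (rule convex_equiv_run_rel)
  have "{C \<in> UNIV // ?E. finite C} \<subseteq> (\<lambda>x. ?E `` {x}) ` {x. finite {y. same_run n X x y}}"
  proof
    fix C assume "C \<in> {C \<in> UNIV // ?E. finite C}"
    moreover from this obtain x where "C = ?E `` {x}" by (auto elim: quotientE)
    ultimately show "C \<in> (\<lambda>x. ?E `` {x}) ` {x. finite {y. same_run n X x y}}" by (auto simp: cls)
  qed
  from finite_surj[OF fin this] show "finite {C \<in> UNIV // ?E. finite C}" .
  fix a
  from finite_index[OF n] obtain G :: "'a set" where G: "finite G" "\<forall>x. \<exists>g\<in>G. x - g \<in> multiples n"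
    by (elim exE conjE)
  let ?Q = "\<lambda>g b. b \<in> X \<and> same_run n X a b \<and> b - g \<in> multiples n"
  define B where "B = (\<lambda>g. SOME b. ?Q g b) ` {g \<in> G. \<exists>b. ?Q g b}"
  have f: "?Q g (SOME b. ?Q g b)" if "\<exists>b. ?Q g b" for g using someI_ex[OF that] .
  have "finite B" using G(1) by (simp add: B_def)
  moreover have "?E `` {a} \<inter> X = ?E `` {a} \<inter> (\<Union>b\<in>B. (\<lambda>y. b + y) ` multiples n)"
  proof (intro equalityI subsetI)
    fix z assume z: "z \<in> ?E `` {a} \<inter> X"
    obtain g where g: "g \<in> G" "z - g \<in> multiples n" using G(2) by blast
    have ex: "\<exists>b. ?Q g b" using z g(2) by (auto simp: cls)
    let ?b = "SOME b. ?Q g b"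
    have "?b \<in> B" unfolding B_def using g(1) ex by blast
    moreover have "z - ?b \<in> multiples n" using f[OF ex] g(2) multiples_cong_trans multiples_cong_sym by blast
    then have "z \<in> (\<lambda>y. ?b + y) ` multiples n" by (intro image_eqI[of _ _ "z - ?b"]) simp_all
    ultimately show "z \<in> ?E `` {a} \<inter> (\<Union>b\<in>B. (\<lambda>y. b + y) ` multiples n)" using z by blast
  next
    fix z assume z: "z \<in> ?E `` {a} \<inter> (\<Union>b\<in>B. (\<lambda>y. b + y) ` multiples n)"
    then obtain b y where b: "b \<in> B" "z = b + y" "y \<in> multiples n" by blast
    then obtain g where "b = (SOME b. ?Q g b)" "\<exists>b. ?Q g b" unfolding B_def by blast
    then have "b \<in> X" "same_run n X a b" using f[of g] by blast+
    moreover have "same_run n X a z" using z by (simp add: cls)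
    ultimately have "same_run n X b z" using same_run_sym same_run_trans by blast
    then have "z \<in> X" using \<open>b \<in> X\<close> b(2,3) by (intro same_run_mem[of n X b z]) simp_all
    then show "z \<in> ?E `` {a} \<inter> X" using z by blast
  qed
  ultimately show "\<exists>B. finite B \<and> ?E `` {a} \<inter> X = ?E `` {a} \<inter> (\<Union>b\<in>B. (\<lambda>y. b + y) ` multiples n)"
    by (intro exI[of _ B] conjI)
qed

end

section \<open>The discrete case\<close>

locale discrete_expansion = dp_minimal_expansion L M
  for L :: "('f, 'r) lang" and M :: "('a::linordered_ab_group_add, 'f, 'r) struct" +
  fixes u :: 'a
  assumes u_pos: "0 < u" and u_least: "\<And>x. 0 < x \<Longrightarrow> u \<le> x"
begin

lemma succ_le: "x < y \<Longrightarrow> x + u \<le> y"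
  using u_least[of "y - x"] by (simp add: le_diff_eq add.commute)

lemma nmult_u_inj: "nmult i u = nmult j u \<longleftrightarrow> i = j"
  using nmult_strict_mono[of i j u] nmult_strict_mono[of j i u] u_pos by (cases i j rule: linorder_cases) auto

lemma nmult_u_le: "nmult i u \<le> nmult j u \<longleftrightarrow> i \<le> j"
  using nmult_strict_mono[of j i u] nmult_mono[of i j u] u_pos by (cases "i \<le> j") auto

lemma between_nmult: "0 \<le> x \<Longrightarrow> x \<le> nmult m u \<Longrightarrow> \<exists>q\<le>m. x = nmult q u"
proof (induction m)
  case (Suc m)
  show ?case
  proof (cases "x \<le> nmult m u")
    case True
    then show ?thesis using Suc le_SucI by blast
  next
    case False
    then have "x = nmult (Suc m) u" using succ_le[of "nmult m u" x] Suc.prems by simp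
    then show ?thesis by blast
  qed
qed auto

lemma multiple_of_u:
  assumes "0 < n" "nmult k u \<in> multiples n"
  shows "\<exists>q. k = n * q"
proof -
  obtain y where y: "nmult k u = nmult n y" using assms(2) by (auto simp: multiples_iff)
  have "0 \<le> y"
  proof (rule ccontr)
    assume "\<not> 0 \<le> y"
    then have "0 < nmult n (- y)" using assms(1) by (intro nmult_strict) auto
    then have "nmult k u < 0" by (simp add: y nmult_uminus)
    then show False using nmult_nonneg[OF less_imp_le[OF u_pos], of k] by simp
  qed
  then have "y \<le> nmult k u" using nmult_mono[of 1 n y] assms(1) y by simp
  then obtain q where "y = nmult q u" using between_nmult[OF \<open>0 \<le> y\<close>] by blast
  then have "nmult k u = nmult (n * q) u" using y by (simp add: nmult_mult)
  then show ?thesis using nmult_u_inj by blast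
qed

lemma iterate_period:
  assumes "\<And>m. k \<le> m \<Longrightarrow> Q m \<longleftrightarrow> Q (m + d :: nat)" "k \<le> m"
  shows "Q m \<longleftrightarrow> Q (m + d * q)"
proof (induction q)
  case (Suc q)
  have "Q (m + d * q) \<longleftrightarrow> Q (m + d * q + d)" by (rule assms(1)) (use assms(2) in simp)
  moreover have "m + d * Suc q = m + d * q + d" by simp
  ultimately show ?case using Suc by metis
qed simp

text \<open>Finitely many germs at infinity of \<open>X - x\<close> along the multiples of \<open>u\<close>: otherwise, all pairs of the
  \<open>s\<^sub>i\<close> are separated between \<open>k\<^sub>j u\<close> and \<open>k\<^sub>j\<^sub>+\<^sub>1 u\<close> for suitable numbers \<open>k\<^sub>0 < k\<^sub>1 < \<dots>\<close>. If there are \<open>l\<close> germs,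
  two of \<open>x, x + u, \<dots>, x + l u\<close> have the same germ. Their distance \<open>d u\<close> is a period, and \<open>d\<close> divides \<open>l!\<close>.\<close>

lemma eventually_periodic:
  assumes X: "definable_pred (\<lambda>e. e 0 \<in> X)"
  shows "\<exists>n>0. \<forall>x. \<exists>k. \<forall>m\<ge>k. x + nmult m u \<in> X \<longleftrightarrow> x + nmult (m + n) u \<in> X"
proof -
  define R where "R y x \<longleftrightarrow> (\<exists>k. \<forall>m\<ge>k. y + nmult m u \<in> X \<longleftrightarrow> x + nmult m u \<in> X)" for x y
  have "\<exists>Y. finite Y \<and> (\<forall>x. \<exists>y\<in>Y. R y x)"
  proof (rule finite_representatives)
    fix s :: "nat \<Rightarrow> 'a" assume s: "\<And>i j. i < j \<Longrightarrow> \<not> R (s i) (s j)"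
    show False
    proof (rule pattern_False[of "\<lambda>a b. a + b \<in> X"])
      show "definable_pred (\<lambda>e. e 0 + e 1 \<in> X)" by (intro pred_subst1[OF X] pred_intros)
      fix N
      have "\<exists>K'>K. \<forall>i i'. i < i' \<and> i' < N \<longrightarrow>
          (\<exists>m. K \<le> m \<and> m < K' \<and> (s i + nmult m u \<in> X) \<noteq> (s i' + nmult m u \<in> X))" for K
      proof -
        have "\<exists>m\<ge>K. (s i + nmult m u \<in> X) \<noteq> (s i' + nmult m u \<in> X)" if "i < i'" for i i'
          using s[OF that] unfolding R_def by blast
        then obtain f where f: "\<And>i i'. i < i' \<Longrightarrow> K \<le> f i i' \<and>
            (s i + nmult (f i i') u \<in> X) \<noteq> (s i' + nmult (f i i') u \<in> X)"
          by metis
        define K' where "K' = Suc (Max (insert K ((\<lambda>(i, i'). f i i') ` ({..<N} \<times> {..<N}))))"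
        have K_less: "K < K'" unfolding K'_def by (simp add: less_Suc_eq_le)
        have f_less: "f i i' < K'" if "i < i'" "i' < N" for i i'
          unfolding K'_def less_Suc_eq_le by (rule Max_ge) (use that in auto)
        show ?thesis
        proof (rule exI[of _ K'], intro conjI allI impI K_less)
          fix i i' assume "i < i' \<and> i' < N"
          then show "\<exists>m\<ge>K. m < K' \<and> (s i + nmult m u \<in> X) \<noteq> (s i' + nmult m u \<in> X)"
            using f[of i i'] f_less[of i i'] by (intro exI[of _ "f i i'"]) simp
        qed
      qed
      then obtain F where F: "\<And>K. K < F K" "\<And>K i i'. i < i' \<Longrightarrow> i' < N \<Longrightarrow>
          \<exists>m. K \<le> m \<and> m < F K \<and> (s i + nmult m u \<in> X) \<noteq> (s i' + nmult m u \<in> X)"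
        by metis
      define h where "h j = nmult ((F ^^ j) 0) u" for j
      show "\<exists>a h. separated (\<lambda>a b. a + b \<in> X) N a h"
      proof (rule separatedI)
        show "h j < h (Suc j)" for j using F(1) u_pos by (auto simp: h_def intro: nmult_strict_mono)
        fix i i' j :: nat assume lt: "i < i'" "i' < N"
        obtain m where "(F ^^ j) 0 \<le> m" "m < F ((F ^^ j) 0)" "(s i + nmult m u \<in> X) \<noteq> (s i' + nmult m u \<in> X)"
          using F(2)[OF lt] by blast
        then show "\<exists>b. h j \<le> b \<and> b < h (Suc j) \<and> (s i + b \<in> X) \<noteq> (s i' + b \<in> X)" using u_pos
          by (intro exI[of _ "nmult m u"]) (auto simp: h_def nmult_u_le intro: nmult_strict_mono)
      qed
    qed
  qed
  then obtain Y where Y: "finite Y" "\<And>x. \<exists>y\<in>Y. R y x" by metis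
  define n :: nat where "n = fact (card Y)"
  have "\<exists>k. \<forall>m\<ge>k. x + nmult m u \<in> X \<longleftrightarrow> x + nmult (m + n) u \<in> X" for x
  proof -
    define f where "f i = (SOME y. y \<in> Y \<and> R y (x + nmult i u))" for i
    have f: "f i \<in> Y \<and> R (f i) (x + nmult i u)" for i
      unfolding f_def by (rule someI_ex) (use Y(2)[of "x + nmult i u"] in blast)
    from pigeonhole_le[OF Y(1), of f] f obtain i i' where ii: "i < i'" "i' \<le> card Y" "f i = f i'" by blast
    define d where "d = i' - i"
    have "R (f i) (x + nmult i u)" "R (f i) (x + nmult i' u)" using f ii(3) by metis+
    then obtain k1 k2 where k1: "\<forall>m\<ge>k1. f i + nmult m u \<in> X \<longleftrightarrow> x + nmult i u + nmult m u \<in> X"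
      and k2: "\<forall>m\<ge>k2. f i + nmult m u \<in> X \<longleftrightarrow> x + nmult i' u + nmult m u \<in> X"
      unfolding R_def by blast
    define k where "k = max k1 k2 + i"
    have step: "x + nmult m u \<in> X \<longleftrightarrow> x + nmult (m + d) u \<in> X" if "k \<le> m" for m
    proof -
      have "x + nmult i u + nmult (m - i) u \<in> X \<longleftrightarrow> x + nmult i' u + nmult (m - i) u \<in> X"
        using k1[rule_format, of "m - i"] k2[rule_format, of "m - i"] that by (simp add: k_def)
      moreover have "i + (m - i) = m" "i' + (m - i) = m + d"
        using that ii(1) by (simp_all add: k_def d_def)
      then have "nmult i u + nmult (m - i) u = nmult m u" "nmult i' u + nmult (m - i) u = nmult (m + d) u"
        by (simp_all only: nmult_add[symmetric])
      ultimately show ?thesis by (simp add: add.assoc)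
    qed
    have "d dvd n" unfolding n_def d_def by (rule dvd_fact) (use ii in auto)
    then obtain q where "n = d * q" by blast
    then show ?thesis
      using iterate_period[of k "\<lambda>m. x + nmult m u \<in> X" d _ q, OF step] by blast
  qed
  then show ?thesis by (intro exI[of _ n]) (simp add: n_def)
qed

lemma infinitely_many_cosets:
  assumes inf: "infinite D"
    and up: "\<And>x. finite {m. x + nmult m u \<in> D}" and down: "\<And>x. finite {m. x - nmult m u \<in> D}"
  shows "\<exists>s :: nat \<Rightarrow> 'a. \<forall>j. s j \<in> D \<and> (\<forall>i<j. \<forall>m. s j \<noteq> s i + nmult m u \<and> s j \<noteq> s i - nmult m u)"
proof (rule greedy_sequence)
  fix G :: "'a set" assume "finite G"
  then have "finite (\<Union>g\<in>G. (\<lambda>m. g + nmult m u) ` {m. g + nmult m u \<in> D} \<union> (\<lambda>m. g - nmult m u) ` {m. g - nmult m u \<in> D})"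
    using up down by simp
  then obtain x where "x \<in> D" "x \<notin> (\<Union>g\<in>G. (\<lambda>m. g + nmult m u) ` {m. g + nmult m u \<in> D} \<union> (\<lambda>m. g - nmult m u) ` {m. g - nmult m u \<in> D})"
    using inf by (meson finite_subset subsetI)
  then show "\<exists>x. x \<in> D \<and> (\<forall>g\<in>G. \<forall>m. x \<noteq> g + nmult m u \<and> x \<noteq> g - nmult m u)"
    by (intro exI[of _ x]) auto
qed

lemma infinitely_far:
  assumes "x < y" "\<And>m. y \<noteq> x + nmult m u"
  shows "x + nmult m u < y"
proof (induction m)
  case (Suc m)
  then have "x + nmult (Suc m) u \<le> y" using succ_le[of "x + nmult m u" y] by (simp add: add.assoc)
  then show ?case using assms(2)[of "Suc m"] by (simp add: order_less_le)
qed (use assms in simp)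

text \<open>Choose the \<open>e\<^sub>j\<close> in different cosets of \<open>\<int>u\<close> and \<open>K\<close> beyond all points of \<open>D\<close> on these cosets, relative to
  the \<open>e\<^sub>j\<close>. Then the multiples of \<open>(K + 1) u\<close> are shifts as required by \<open>sparse_False\<close>.\<close>

lemma finite_defect:
  assumes D: "definable_pred (\<lambda>e. e 0 \<in> D)"
    and up: "\<And>x. finite {m. x + nmult m u \<in> D}" and down: "\<And>x. finite {m. x - nmult m u \<in> D}"
  shows "finite D"
proof (rule ccontr)
  assume "infinite D"
  then obtain s :: "nat \<Rightarrow> 'a" where s: "\<And>j. s j \<in> D"
    "\<And>i j m. i < j \<Longrightarrow> s j \<noteq> s i + nmult m u \<and> s j \<noteq> s i - nmult m u"
    using infinitely_many_cosets[OF _ up down] by blast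
  have far: "s j \<noteq> s i + nmult m u" if "i \<noteq> j" for i j m
  proof (cases "i < j")
    case False
    then have "s i \<noteq> s j - nmult m u" using s(2)[of j i m] that by simp
    then show ?thesis by (auto simp: eq_diff_eq)
  qed (use s in blast)
  have "inj s"
  proof (rule injI, rule ccontr)
    fix i j assume "s i = s j" "i \<noteq> j"
    then show False using far[of i j 0] by simp
  qed
  show False
  proof (rule sparse_False[OF D])
    fix N
    define S where "S = s ` {..N}"
    have S: "finite S" "card S = Suc N" using \<open>inj s\<close> by (simp_all add: S_def card_image inj_on_subset)
    obtain e where e: "\<forall>j\<le>N. e j \<in> S" "\<forall>j<N. e j < e (Suc j)" using increasing_enumeration[OF S] by blast
    have e_in: "e j \<in> S" if "j \<le> N" for j using e(1) that by blast
    have e_less: "e j < e (Suc j)" if "j < N" for j using e(2) that by blast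
    have e_far: "e j + nmult m u < e (Suc j)" if "j < N" for j m
    proof (rule infinitely_far[OF e_less[OF that]])
      fix m
      from e_in[of j] that obtain i where "e j = s i" by (auto simp: S_def)
      moreover from e_in[of "Suc j"] that obtain i' where "e (Suc j) = s i'" by (auto simp: S_def)
      moreover from calculation have "i \<noteq> i'" using e_less[OF that] by auto
      ultimately show "e (Suc j) \<noteq> e j + nmult m u" using far by simp
    qed
    have "finite (\<Union>j\<in>{..N}. {m. e j + nmult m u \<in> D})" using up by simp
    then obtain K where "(\<Union>j\<in>{..N}. {m. e j + nmult m u \<in> D}) \<subseteq> {..<K}"
      unfolding finite_nat_iff_bounded ..
    then have K: "e j + nmult m u \<notin> D" if "j \<le> N" "K \<le> m" for j m
      using that by fastforce
    \<comment> \<open>\<open>Suc K\<close> instead of \<open>K\<close> excludes the step width \<open>0\<close>.\<close>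
    define t where "t i = nmult (i * Suc K) u" for i
    have "e j + (t i' - t i) \<notin> D" if "i < i'" "j < N" for i i' j
    proof -
      have "t i' - t i = nmult ((i' - i) * Suc K) u"
        using that nmult_diff[of "i * Suc K" "i' * Suc K" u] by (simp add: t_def diff_mult_distrib del: mult_Suc_right)
      moreover have "K \<le> (i' - i) * Suc K" using that(1) by (cases "i' - i") auto
      ultimately show ?thesis using K that by simp
    qed
    moreover have "0 \<le> t i" for i using u_pos by (simp add: t_def nmult_nonneg)
    moreover have "e j \<in> D" if "j \<le> N" for j using e_in[OF that] s by (auto simp: S_def)
    moreover have "e j + t i < e (Suc j)" if "j < N" for i j using e_far[OF that] by (simp add: t_def)
    ultimately show "\<exists>e t. (\<forall>j\<le>N. e j \<in> D) \<and> (\<forall>j<N. e j < e (Suc j)) \<and> (\<forall>i<N. 0 \<le> t i) \<and>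
        (\<forall>i<N. \<forall>j<N. e j + t i < e (Suc j)) \<and>
        (\<forall>i i' j. i < i' \<and> i' < N \<and> j < N \<longrightarrow> e j + (t i' - t i) \<notin> D)"
      using e_less by (rule_tac exI[of _ e], rule_tac exI[of _ t]) simp
  qed
qed

lemma range_convex:
  assumes v: "v = u \<or> v = - u" and "a \<in> range (\<lambda>m. y + nmult m v)" "d \<in> range (\<lambda>m. y + nmult m v)" "a \<le> c" "c \<le> d"
  shows "c \<in> range (\<lambda>m. y + nmult m v)"
proof -
  obtain m k where mk: "a = y + nmult m v" "d = y + nmult k v" using assms(2,3) by blast
  have pos: "0 \<le> nmult i u" for i by (rule nmult_nonneg[OF less_imp_le[OF u_pos]])
  from v show ?thesis
  proof
    assume v: "v = u"
    have "y \<le> a" using pos by (simp add: mk v)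
    then have "y \<le> c" using assms(4) by (rule order_trans)
    moreover have "c \<le> y + nmult k u" using assms(5) by (simp add: mk v)
    ultimately have "0 \<le> c - y" "c - y \<le> nmult k u" by (simp_all add: algebra_simps)
    then obtain q where "c - y = nmult q u" using between_nmult by blast
    then have "c = y + nmult q v" by (simp add: v algebra_simps)
    then show ?thesis by blast
  next
    assume v: "v = - u"
    have "d \<le> y" using pos by (simp add: mk v nmult_uminus)
    with assms(5) have "c \<le> y" by (rule order_trans)
    moreover have "y - nmult m u \<le> c" using assms(4) by (simp add: mk v nmult_uminus)
    ultimately have "0 \<le> y - c" "y - c \<le> nmult m u" by (simp_all add: algebra_simps)
    then obtain q where "y - c = nmult q u" using between_nmult by blast
    then have "c = y + nmult q v" by (simp add: v nmult_uminus algebra_simps)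
    then show ?thesis by blast
  qed
qed

text \<open>The points \<open>b, b + v, b + 2v, \<dots>\<close> form a convex set on which \<open>X\<close> is \<open>nM\<close>-invariant. The ray starts \<open>n\<close>
  steps before \<open>x\<close>, so that for \<open>v = u\<close> each coset of \<open>nM\<close> that meets it does so at or below \<open>x\<close>.\<close>

lemma infinite_class_of_ray:
  assumes n: "0 < n" and v: "v = u \<or> v = - u" and x: "x = b + nmult n v"
    and per: "\<And>m. b + nmult m v \<in> X \<longleftrightarrow> b + nmult (m + n) v \<in> X"
  shows "infinite {y. same_run n X x y}"
proof -
  define C where "C = range (\<lambda>m. b + nmult m v)"
  define C' where "C' = range (\<lambda>m. x + nmult m v)"
  have bx: "b + nmult (n + m) v = x + nmult m v" for m by (simp add: x nmult_add add.assoc)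
  have sub: "C' \<subseteq> C" unfolding C_def C'_def by (auto simp flip: bx)
  have inv_le: "b + nmult k v \<in> X \<longleftrightarrow> b + nmult m v \<in> X"
    if "k \<le> m" and mult: "nmult (m - k) v \<in> multiples n" for m k
  proof -
    have "nmult (m - k) u \<in> multiples n"
      using v mult multiples_uminus[OF mult] by (auto simp: nmult_uminus)
    then obtain q where "m - k = n * q" using multiple_of_u[OF n] by blast
    then have "m = k + n * q" using \<open>k \<le> m\<close> by simp
    then show ?thesis using iterate_period[of 0 "\<lambda>m. b + nmult m v \<in> X" n k q, OF per] by simp
  qed
  have inv: "z \<in> X" if zy: "y \<in> C" "z \<in> C" "y - z \<in> multiples n" "y \<in> X" for y z
  proof -
    obtain m k where mk: "y = b + nmult m v" "z = b + nmult k v" using zy(1,2) unfolding C_def by blast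
    show ?thesis
    proof (cases "k \<le> m")
      case True
      then have "y - z = nmult (m - k) v" by (simp add: mk nmult_diff)
      then show ?thesis using inv_le[OF True] zy(3,4) by (simp add: mk)
    next
      case False
      then have "z - y = nmult (k - m) v" by (simp add: mk nmult_diff)
      then show ?thesis using inv_le[of m k] False multiples_cong_sym[OF zy(3)] zy(4) by (simp add: mk)
    qed
  qed
  have coin: "\<exists>w'\<in>C. w' - w \<in> multiples n \<and> w' \<le> z" if zw: "z \<in> C'" "w \<in> C" for z w
  proof -
    obtain m k where mk: "z = b + nmult (n + m) v" "w = b + nmult k v"
      using zw unfolding C_def C'_def bx by blast
    from v show ?thesis
    proof
      assume v: "v = u"
      have "w - (b + nmult (k mod n) u) = nmult n (nmult (k div n) u)"
        using nmult_add[of "n * (k div n)" "k mod n" u] by (simp add: mk v nmult_mult)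
      then have "b + nmult (k mod n) u - w \<in> multiples n" using multiples_cong_sym multiples_nmult by metis
      moreover have "k mod n \<le> n + m" using n by (meson mod_less_divisor less_imp_le trans_le_add1)
      then have "b + nmult (k mod n) u \<le> z" unfolding mk v using nmult_u_le by simp
      ultimately show ?thesis unfolding C_def v by blast
    next
      assume v: "v = - u"
      have "b + nmult (k + n * (n + m)) v - w = - nmult n (nmult (n + m) u)"
        by (simp only: mk v nmult_add[of k] nmult_mult nmult_uminus) simp
      then have "b + nmult (k + n * (n + m)) v - w \<in> multiples n" using multiples_uminus multiples_nmult by metis
      moreover have "n + m \<le> k + n * (n + m)" using n by (cases n) auto
      then have "b + nmult (k + n * (n + m)) v \<le> z" unfolding mk v nmult_uminus using nmult_u_le by simp
      ultimately show ?thesis unfolding C_def by blast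
    qed
  qed
  have "inj (\<lambda>m. x + nmult m v)" using v by (auto intro!: injI simp: nmult_u_inj nmult_uminus)
  then have "infinite C'" unfolding C'_def by (rule range_inj_infinite)
  moreover have xC: "x \<in> C'" unfolding C'_def by (rule range_eqI[of _ _ 0]) simp
  have "same_run n X x y" if "y \<in> C'" for y
  proof (rule same_runI[where C = C and C' = C'])
    show "b' \<in> C" if "a \<in> C" "c \<in> C" "a \<le> b'" "b' \<le> c" for a b' c
      using that unfolding C_def by (rule range_convex[OF v])
    show "b' \<in> C'" if "a \<in> C'" "c \<in> C'" "a \<le> b'" "b' \<le> c" for a b' c
      using that unfolding C'_def by (rule range_convex[OF v])
  qed (use inv coin xC sub that in auto)
  then have "C' \<subseteq> {y. same_run n X x y}" by blast
  ultimately show ?thesis using finite_subset by blast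
qed

text \<open>If the class of \<open>x\<close> is finite, then neither ray through \<open>x\<close> avoids the defect set \<open>D\<close>. So \<open>x\<close> lies,
  up to \<open>n\<close> steps, between two points of \<open>D\<close> in the same coset of \<open>\<int>u\<close>.\<close>

theorem finite_classes_discrete:
  assumes X: "definable_pred (\<lambda>e. e 0 \<in> X)"
  shows "\<exists>n>0. finite {x. finite {y. same_run n X x y}}"
proof -
  obtain n1 where n1: "0 < n1" "\<And>x. \<exists>k. \<forall>m\<ge>k. x + nmult m u \<in> X \<longleftrightarrow> x + nmult (m + n1) u \<in> X"
    using eventually_periodic[OF X] by metis
  have "definable_pred (\<lambda>e. 0 - e 0 \<in> X)" by (intro pred_subst1[OF X] pred_intros)
  then have X': "definable_pred (\<lambda>e. e 0 \<in> {x. 0 - x \<in> X})" by simp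
  obtain n2 where n2: "0 < n2"
    "\<And>x. \<exists>k. \<forall>m\<ge>k. x + nmult m u \<in> {x. 0 - x \<in> X} \<longleftrightarrow> x + nmult (m + n2) u \<in> {x. 0 - x \<in> X}"
    using eventually_periodic[OF X'] by metis
  define n where "n = n1 * n2"
  have n: "0 < n" using n1(1) n2(1) by (simp add: n_def)
  define D where "D = {c. (c \<in> X) \<noteq> (c + nmult n u \<in> X)}"
  have "definable_pred (\<lambda>e. \<not> (e 0 \<in> X \<longleftrightarrow> e 0 + nmult n u \<in> X))"
    by (intro pred_not pred_iff pred_subst1[OF X] pred_intros)
  then have D: "definable_pred (\<lambda>e. e 0 \<in> D)" by (simp add: D_def)
  have up: "finite {m. x + nmult m u \<in> D}" for x
  proof -
    obtain k where k: "\<And>m. k \<le> m \<Longrightarrow> x + nmult m u \<in> X \<longleftrightarrow> x + nmult (m + n1) u \<in> X" using n1(2) by metis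
    have "x + nmult m u \<in> X \<longleftrightarrow> x + nmult (m + n) u \<in> X" if "k \<le> m" for m
      unfolding n_def by (rule iterate_period[of k "\<lambda>m. x + nmult m u \<in> X" n1, OF k that])
    then have "{m. x + nmult m u \<in> D} \<subseteq> {..<k}"
      by (force simp: D_def nmult_add add.assoc not_less[symmetric])
    then show ?thesis using finite_subset by blast
  qed
  have down: "finite {m. x - nmult m u \<in> D}" for x
  proof -
    from n2(2)[of "- x"] obtain k where
      "\<forall>m\<ge>k. - x + nmult m u \<in> {x. 0 - x \<in> X} \<longleftrightarrow> - x + nmult (m + n2) u \<in> {x. 0 - x \<in> X}" ..
    moreover have "- x + nmult m u \<in> {x. 0 - x \<in> X} \<longleftrightarrow> x - nmult m u \<in> X" for m by simp
    ultimately have k: "\<And>m. k \<le> m \<Longrightarrow> x - nmult m u \<in> X \<longleftrightarrow> x - nmult (m + n2) u \<in> X" by blast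
    have per: "x - nmult m u \<in> X \<longleftrightarrow> x - nmult (m + n) u \<in> X" if "k \<le> m" for m
      unfolding n_def mult.commute[of n1] by (rule iterate_period[of k "\<lambda>m. x - nmult m u \<in> X" n2, OF k that])
    have "m < k + n" if "x - nmult m u \<in> D" for m
    proof (rule ccontr)
      assume "\<not> m < k + n"
      then have m: "n \<le> m" "k \<le> m - n" "m - n + n = m" by auto
      have eq: "x - nmult m u + nmult n u = x - nmult (m - n) u"
        unfolding nmult_diff[OF m(1)] by (simp add: algebra_simps)
      have "x - nmult m u \<in> X \<longleftrightarrow> x - nmult (m - n) u \<in> X"
        using per[OF m(2)] by (simp only: m(3))
      then show False using that unfolding D_def mem_Collect_eq eq by blast
    qed
    then have "{m. x - nmult m u \<in> D} \<subseteq> {..<k + n}" by auto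
    then show ?thesis using finite_subset by blast
  qed
  have finD: "finite D" by (rule finite_defect[OF D up down])
  have below: "infinite {y. same_run n X x y}" if no: "\<And>m. x - nmult m u \<notin> D" for x
  proof (rule infinite_class_of_ray[OF n])
    show "- u = u \<or> - u = - u" by simp
    show "x = (x + nmult n u) + nmult n (- u)" by (simp add: nmult_uminus)
    show "x + nmult n u + nmult m (- u) \<in> X \<longleftrightarrow> x + nmult n u + nmult (m + n) (- u) \<in> X" for m
      using no[of m] by (auto simp: D_def nmult_uminus nmult_add algebra_simps)
  qed
  have above: "infinite {y. same_run n X x y}" if no: "\<And>m. x - nmult n u + nmult m u \<notin> D" for x
  proof (rule infinite_class_of_ray[OF n])
    show "u = u \<or> u = - u" by simp
    show "x = (x - nmult n u) + nmult n u" by simp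
    show "x - nmult n u + nmult m u \<in> X \<longleftrightarrow> x - nmult n u + nmult (m + n) u \<in> X" for m
      using no[of m] by (auto simp: D_def nmult_add add.assoc)
  qed
  have fin: "finite {m. \<exists>k. d + nmult m u - nmult n u + nmult k u \<in> D}" for d
  proof -
    obtain K where K: "{i. d + nmult i u \<in> D} \<subseteq> {..<K}" using up[of d] unfolding finite_nat_iff_bounded ..
    have "m < K + n" if "d + nmult m u - nmult n u + nmult k u \<in> D" for m k
    proof (rule ccontr)
      assume m: "\<not> m < K + n"
      then have "d + nmult m u - nmult n u + nmult k u = d + nmult (m - n + k) u"
        by (simp add: nmult_add nmult_diff algebra_simps)
      then have "m - n + k \<in> {i. d + nmult i u \<in> D}" using that by (simp only: mem_Collect_eq)
      then have "m - n + k < K" using K by blast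
      then show False using m by simp
    qed
    then have "{m. \<exists>k. d + nmult m u - nmult n u + nmult k u \<in> D} \<subseteq> {..<K + n}" by auto
    then show ?thesis using finite_subset by blast
  qed
  have "{x. finite {y. same_run n X x y}} \<subseteq>
      (\<Union>d\<in>D. (\<lambda>m. d + nmult m u) ` {m. \<exists>k. d + nmult m u - nmult n u + nmult k u \<in> D})"
  proof
    fix x assume "x \<in> {x. finite {y. same_run n X x y}}"
    then obtain m k where mk: "x - nmult m u \<in> D" "x - nmult n u + nmult k u \<in> D"
      using below[of x] above[of x] by auto
    have "x = (x - nmult m u) + nmult m u" by simp
    then show "x \<in> (\<Union>d\<in>D. (\<lambda>m. d + nmult m u) ` {m. \<exists>k. d + nmult m u - nmult n u + nmult k u \<in> D})"
      using mk by (intro UN_I[OF mk(1)] image_eqI[of _ _ m]) auto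
  qed
  then have "finite {x. finite {y. same_run n X x y}}"
    by (rule finite_subset) (use finD fin in auto)
  with n show ?thesis by blast
qed

end

section \<open>The dense case\<close>

locale dense_expansion = dp_minimal_expansion L M
  for L :: "('f, 'r) lang" and M :: "('a::linordered_ab_group_add, 'f, 'r) struct" +
  assumes dense0: "\<And>x :: 'a. 0 < x \<Longrightarrow> \<exists>y. 0 < y \<and> y < x" and nontrivial: "\<exists>x :: 'a. 0 < x"
begin

lemma between: "x < y \<Longrightarrow> \<exists>z. x < z \<and> z < (y :: 'a)"
proof -
  assume "x < y"
  then obtain d where "0 < d" "d < y - x" using dense0[of "y - x"] by auto
  then show ?thesis by (intro exI[of _ "x + d"]) (simp add: less_diff_eq add.commute)
qed

lemma infinite_interval:
  assumes "x < (y :: 'a)"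
  shows "infinite {x<..<y}"
proof
  assume fin: "finite {x<..<y}"
  have "{x<..<y} \<noteq> {}" using between[OF assms] by auto
  then have "Max {x<..<y} \<in> {x<..<y}" using fin by (rule Max_in[rotated])
  then obtain z where z: "Max {x<..<y} < z" "z < y" "x < Max {x<..<y}" using between by auto
  then have "z \<in> {x<..<y}" by auto
  then have "z \<le> Max {x<..<y}" using fin by (intro Max_ge)
  then show False using z(1) by simp
qed

lemma positive_lower_bound:
  assumes "finite T" "\<And>t. t \<in> T \<Longrightarrow> 0 < t"
  shows "\<exists>d>0. \<forall>t\<in>T. d \<le> (t :: 'a)"
proof -
  obtain p :: 'a where "0 < p" using nontrivial by blast
  then have "0 < Min (insert p T)" using assms by (subst Min_gr_iff) auto
  moreover have "\<forall>t\<in>T. Min (insert p T) \<le> t" using assms(1) by (auto intro: Min_le)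
  ultimately show ?thesis by blast
qed

lemma half_exists: "0 < x \<Longrightarrow> \<exists>y>0. y + y \<le> (x :: 'a)"
proof -
  assume "0 < x"
  then obtain y where y: "0 < y" "y < x" using dense0 by blast
  show ?thesis
  proof (cases "y + y \<le> x")
    case False
    then have "(x - y) + (x - y) \<le> x" by (simp add: algebra_simps)
    then show ?thesis using y by (intro exI[of _ "x - y"]) simp
  qed (use y in blast)
qed

lemma divisor_exists: "0 < x \<Longrightarrow> \<exists>y>0. nmult n y \<le> (x :: 'a)"
proof (induction n arbitrary: x)
  case 0
  then show ?case by auto
next
  case (Suc n)
  obtain x' where x': "0 < x'" "x' + x' \<le> x" using half_exists[OF Suc.prems] by blast
  obtain y where y: "0 < y" "nmult n y \<le> x'" using Suc.IH[OF x'(1)] by blast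
  have "nmult n (min y x') + min y x' \<le> x' + x'"
  proof (rule add_mono)
    have "nmult n (min y x') + nmult n (y - min y x') = nmult n y" by (simp flip: nmult_plus)
    moreover have "0 \<le> nmult n (y - min y x')" by (rule nmult_nonneg) simp
    ultimately show "nmult n (min y x') \<le> x'" using y(2) by (metis le_add_same_cancel1 order_trans)
  qed simp
  then show ?case using x' y(1) by (intro exI[of _ "min y x'"]) (auto intro: order_trans)
qed

definition invariant_on :: "nat \<Rightarrow> 'a set \<Rightarrow> 'a \<Rightarrow> 'a \<Rightarrow> bool" where
  "invariant_on n X p q \<longleftrightarrow> (\<forall>z w. p < z \<and> z < q \<and> p < w \<and> w < q \<and> z - w \<in> multiples n \<longrightarrow> (z \<in> X \<longleftrightarrow> w \<in> X))"

text \<open>The value \<open>t = 0\<close> is excluded: it cannot serve to separate germs in shells \<open>d' \<le> t < d\<close> that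
  shrink to \<open>0\<close>.\<close>

definition agree :: "'a set \<Rightarrow> 'a \<Rightarrow> 'a \<Rightarrow> 'a \<Rightarrow> bool" where
  "agree X x y d \<longleftrightarrow> (\<forall>t. 0 < t \<and> t < d \<longrightarrow> (x + t \<in> X \<longleftrightarrow> y + t \<in> X))"

lemma agree_mono: "agree X x y d \<Longrightarrow> d' \<le> d \<Longrightarrow> agree X x y d'"
  unfolding agree_def by (meson less_le_trans)

text \<open>If the \<open>s\<^sub>i\<close> have pairwise different germs, then every shell \<open>[d', d)\<close> with sufficiently small \<open>d'\<close>
  contains differences for all pairs among the first \<open>N\<close>. The cut points are built downwards from a fixed
  \<open>p > 0\<close>.\<close>

lemma finitely_many_germs:
  assumes X: "definable_pred (\<lambda>e. e 0 \<in> X)"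
  shows "\<exists>Y. finite Y \<and> (\<forall>x. \<exists>y\<in>Y. \<exists>d>0. agree X y x d)"
proof (rule finite_representatives)
  fix s :: "nat \<Rightarrow> 'a" assume s: "\<And>i j. i < j \<Longrightarrow> \<not> (\<exists>d>0. agree X (s i) (s j) d)"
  show False
  proof (rule pattern_False[of "\<lambda>a b. a + b \<in> X"])
    show "definable_pred (\<lambda>e. e 0 + e 1 \<in> X)" by (intro pred_subst1[OF X] pred_intros)
    fix N
    have "\<exists>d'. 0 < d' \<and> d' < d \<and> (\<forall>i i'. i < i' \<and> i' < N \<longrightarrow>
        (\<exists>t. d' \<le> t \<and> t < d \<and> (s i + t \<in> X) \<noteq> (s i' + t \<in> X)))" if d: "0 < d" for d
    proof -
      have "\<exists>t. 0 < t \<and> t < d \<and> (s i + t \<in> X) \<noteq> (s i' + t \<in> X)" if "i < i'" for i i'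
        using s[OF that] d unfolding agree_def by blast
      note ex = this
      define f where "f i i' = (SOME t. 0 < t \<and> t < d \<and> (s i + t \<in> X) \<noteq> (s i' + t \<in> X))" for i i'
      have f: "0 < f i i' \<and> f i i' < d \<and> (s i + f i i' \<in> X) \<noteq> (s i' + f i i' \<in> X)" if "i < i'" for i i'
        unfolding f_def by (rule someI_ex[OF ex[OF that]])
      obtain d0 where d0: "0 < d0" "d0 < d" using dense0[OF d] by blast
      have fin: "finite (insert d0 ((\<lambda>(i, i'). f i i') ` {(i, i'). i < i' \<and> i' < N}))"
      proof -
        have "finite {(i, i'). i < i' \<and> i' < N}"
          by (rule finite_subset[of _ "{..<N} \<times> {..<N}"]) auto
        then show ?thesis by simp
      qed
      have "\<exists>d'>0. \<forall>t\<in>insert d0 ((\<lambda>(i, i'). f i i') ` {(i, i'). i < i' \<and> i' < N}). d' \<le> t"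
        by (rule positive_lower_bound[OF fin]) (use f d0 in auto)
      then obtain d' where d': "0 < d'" "\<forall>t\<in>insert d0 ((\<lambda>(i, i'). f i i') ` {(i, i'). i < i' \<and> i' < N}). d' \<le> t"
        by blast
      have le: "d' \<le> f i i'" if "i < i'" "i' < N" for i i' using d'(2) that by auto
      show ?thesis
      proof (rule exI[of _ d'], intro conjI allI impI)
        show "0 < d'" by (rule d'(1))
        have "d' \<le> d0" using d'(2) by simp
        then show "d' < d" using d0(2) by (rule le_less_trans)
        fix i i' assume "i < i' \<and> i' < N"
        then show "\<exists>t. d' \<le> t \<and> t < d \<and> (s i + t \<in> X) \<noteq> (s i' + t \<in> X)"
          using f[of i i'] le[of i i'] by (intro exI[of _ "f i i'"]) simp
      qed
    qed
    then obtain F where F: "\<And>d. 0 < d \<Longrightarrow> 0 < F d" "\<And>d. 0 < d \<Longrightarrow> F d < d"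
      "\<And>d i i'. 0 < d \<Longrightarrow> i < i' \<Longrightarrow> i' < N \<Longrightarrow> \<exists>t. F d \<le> t \<and> t < d \<and> (s i + t \<in> X) \<noteq> (s i' + t \<in> X)"
      by metis
    obtain p :: 'a where p: "0 < p" using nontrivial by blast
    define h where "h j = (F ^^ (N - j)) p" for j
    have pos: "0 < (F ^^ j) p" for j using p F(1) by (induction j) auto
    have h_F: "h j = F (h (Suc j))" if "j < N" for j
    proof -
      have "N - j = Suc (N - Suc j)" using that by simp
      then show ?thesis by (simp add: h_def)
    qed
    have h_pos: "0 < h j" for j using pos by (simp add: h_def)
    show "\<exists>a h. separated (\<lambda>a b. a + b \<in> X) N a h"
    proof (rule separatedI)
      show "h j < h (Suc j)" if "j < N" for j using F(2)[OF h_pos] h_F[OF that] by simp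
      fix i i' j assume "i < i'" "i' < N" "j < N"
      then show "\<exists>b. h j \<le> b \<and> b < h (Suc j) \<and> (s i + b \<in> X) \<noteq> (s i' + b \<in> X)"
        using F(3)[OF h_pos[of "Suc j"], of i i'] h_F[of j] by simp
    qed
  qed
qed

text \<open>Otherwise the points that do not admit the distance \<open>d\<close> are dense in \<open>(p, q)\<close> for every \<open>d > 0\<close>. Choose
  any cut points, and then successively distances \<open>a\<^sub>0 \<ge> a\<^sub>1 \<ge> \<dots>\<close> such that each interval contains a point
  that admits \<open>a\<^sub>i\<^sub>+\<^sub>1\<close> but not \<open>a\<^sub>i\<close>. This is a pattern.\<close>

lemma uniform_radius:
  assumes X: "definable_pred (\<lambda>e. e 0 \<in> X)" and Y: "finite Y" "\<And>x. \<exists>y\<in>Y. \<exists>d>0. agree X y x d" and pq: "p < q"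
  shows "\<exists>p' q' d. p \<le> p' \<and> p' < q' \<and> q' \<le> q \<and> 0 < d \<and> (\<forall>b. p' < b \<and> b < q' \<longrightarrow> (\<exists>y\<in>Y. agree X y b d))"
proof (rule ccontr)
  assume nex: "\<not> ?thesis"
  define A where "A d = {b. \<exists>y\<in>Y. agree X y b d}" for d
  have bad: "\<exists>b. p' < b \<and> b < q' \<and> b \<notin> A d" if "p \<le> p'" "p' < q'" "q' \<le> q" "0 < d" for p' q' d
    using nex that unfolding A_def by blast
  have A_mono: "A d \<subseteq> A d'" if "d' \<le> d" for d d' using that agree_mono unfolding A_def by blast
  have A_ex: "\<exists>d>0. b \<in> A d" for b using Y(2)[of b] unfolding A_def by blast
  show False
  proof (rule pattern_False[of "\<lambda>d b. b \<in> A d"])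
    show "definable_pred (\<lambda>e. e 1 \<in> A (e 0))"
      unfolding A_def mem_Collect_eq agree_def by (intro pred_finite_bex[OF Y(1)] pred_intros pred_subst1[OF X])
    fix N
    obtain w where w: "p < w" "w < q" using between[OF pq] by blast
    have "\<forall>w. \<exists>z. w < q \<longrightarrow> w < z \<and> z < q" using between by blast
    from choice[OF this] obtain F where "\<forall>w. w < q \<longrightarrow> w < F w \<and> F w < q" ..
    then have F: "\<And>w. w < q \<Longrightarrow> w < F w \<and> F w < q" by blast
    define h where "h j = (F ^^ j) w" for j
    have h: "p < h j \<and> h j < q" for j
    proof (induction j)
      case (Suc j)
      then show ?case using F[of "h j"] by (auto simp: h_def intro: less_trans)
    qed (use w in \<open>simp add: h_def\<close>)
    have h_less: "h j < h (Suc j)" for j using F[of "h j"] h[of j] by (simp add: h_def)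
    have "\<exists>d'>0. d' \<le> d \<and> (\<forall>j<N. \<exists>b. h j < b \<and> b < h (Suc j) \<and> b \<notin> A d \<and> b \<in> A d')" if d: "0 < d" for d
    proof -
      have "\<exists>b. h j < b \<and> b < h (Suc j) \<and> b \<notin> A d" for j
        by (rule bad) (use h less_imp_le h_less d in auto)
      then obtain b where b: "\<And>j. h j < b j \<and> b j < h (Suc j) \<and> b j \<notin> A d" by metis
      have "\<forall>j. \<exists>r. 0 < r \<and> b j \<in> A r" using A_ex by blast
      from choice[OF this] obtain r where r: "\<forall>j. 0 < r j \<and> b j \<in> A (r j)" ..
      have "finite (insert d (r ` {..<N}))" by simp
      then obtain d' where d': "0 < d'" "\<forall>t\<in>insert d (r ` {..<N}). d' \<le> t"
        using positive_lower_bound[of "insert d (r ` {..<N})"] r d by auto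
      have "b j \<in> A d'" if "j < N" for j using d'(2) r A_mono[of d' "r j"] that by auto
      then show ?thesis using d' b by (intro exI[of _ d']) auto
    qed
    then obtain G where G: "\<And>d. 0 < d \<Longrightarrow> 0 < G d" "\<And>d. 0 < d \<Longrightarrow> G d \<le> d"
      "\<And>d j. 0 < d \<Longrightarrow> j < N \<Longrightarrow> \<exists>b. h j < b \<and> b < h (Suc j) \<and> b \<notin> A d \<and> b \<in> A (G d)"
      by metis
    obtain d0 :: 'a where d0: "0 < d0" using nontrivial by blast
    define a where "a i = (G ^^ i) d0" for i
    have a_pos: "0 < a i" for i using d0 G(1) by (induction i) (auto simp: a_def)
    have a_Suc: "a (Suc i) = G (a i)" for i by (simp add: a_def)
    have a_anti: "a j \<le> a i" if "i \<le> j" for i j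
      using that
    proof (induction rule: dec_induct)
      case (step k)
      then show ?case using G(2)[OF a_pos[of k]] by (simp add: a_Suc)
    qed simp
    show "\<exists>a h. separated (\<lambda>d b. b \<in> A d) N a h"
    proof (rule separatedI)
      show "h j < h (Suc j)" for j by (rule h_less)
      fix i i' j assume ij: "i < i'" "i' < N" "j < N"
      then obtain b where b: "h j < b" "b < h (Suc j)" "b \<notin> A (a i)" "b \<in> A (a (Suc i))"
        using G(3)[OF a_pos[of i], of j] a_Suc by auto
      have "b \<in> A (a i')" using A_mono[OF a_anti[of "Suc i" i']] b(4) ij by auto
      then show "\<exists>b. h j \<le> b \<and> b < h (Suc j) \<and> (b \<in> A (a i)) \<noteq> (b \<in> A (a i'))"
        using b by (intro exI[of _ b]) auto
    qed
  qed
qed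

text \<open>Inside \<open>(p, q)\<close>, two points with the same representative look the same to their right, so their
  difference is a period of \<open>X\<close> there. Among \<open>r, r + s, \<dots>, r + k s\<close> with \<open>k = card Y\<close>, two points have the same
  representative; their difference is \<open>i s\<close> with \<open>i \<le> k\<close>, so \<open>k! s\<close> is a multiple of it. The new interval starts to the right of all
  these points.\<close>

lemma somewhere_invariant:
  assumes Y: "finite Y" and pq: "p < q" and d: "0 < d"
    and Yd: "\<And>b. p < b \<Longrightarrow> b < q \<Longrightarrow> \<exists>y\<in>Y. agree X y b d"
  shows "\<exists>p' q'. p \<le> p' \<and> p' < q' \<and> q' \<le> q \<and> invariant_on (fact (card Y)) X p' q'"
proof -
  define n :: nat where "n = fact (card Y)"
  have "0 < min d (q - p)" using pq d by simp
  then obtain l1 where l1: "0 < l1" "nmult 4 l1 \<le> min d (q - p)" using divisor_exists[of _ 4] by blast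
  define r where "r = p + l1"
  have four: "nmult 4 l1 = l1 + l1 + l1 + l1" by (simp add: numeral_eq_Suc)
  have end_le: "r + l1 + l1 < q"
  proof -
    have "l1 + l1 + l1 < nmult 4 l1" using l1(1) by (simp add: four)
    also have "\<dots> \<le> q - p" using l1(2) by simp
    finally show ?thesis by (simp add: r_def algebra_simps)
  qed
  have len: "r + l1 + l1 - p \<le> d"
  proof -
    have "r + l1 + l1 - p \<le> nmult 4 l1" using l1(1) by (simp add: r_def four)
    also have "\<dots> \<le> d" using l1(2) by simp
    finally show ?thesis .
  qed
  have main: "w \<in> X \<longleftrightarrow> w + nmult n s \<in> X"
    if s: "0 < s" and w: "r + l1 < w" "w + nmult n s < r + l1 + l1" for w s
  proof -
    have "r + l1 + nmult n s < r + l1 + l1" using add_strict_right_mono[OF w(1), of "nmult n s"] w(2) by (rule less_trans)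
    then have ns: "nmult n s < l1" by (simp only: add_less_cancel_left)
    have cn: "card Y \<le> n" unfolding n_def by (rule fact_ge_self)
    have pt: "r + nmult i s < r + l1" if "i \<le> card Y" for i
    proof -
      have "nmult i s \<le> nmult n s" by (rule nmult_mono) (use that cn s in auto)
      then have "nmult i s < l1" using ns by (rule le_less_trans)
      then show ?thesis by simp
    qed
    have in_I: "p < r + nmult i s" "r + nmult i s < q" if "i \<le> card Y" for i
    proof -
      show "p < r + nmult i s" using l1(1) nmult_nonneg[OF less_imp_le[OF s], of i] by (simp add: r_def add.assoc add_pos_nonneg)
      have "r + nmult i s < r + l1 + l1" using pt[OF that] l1(1) by (auto intro: less_trans)
      then show "r + nmult i s < q" using end_le by (rule less_trans)
    qed
    define f where "f i = (SOME y. y \<in> Y \<and> agree X y (r + nmult i s) d)" for i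
    have f: "f i \<in> Y \<and> agree X (f i) (r + nmult i s) d" if "i \<le> card Y" for i
      unfolding f_def by (rule someI_ex) (use Yd[OF in_I[OF that]] in blast)
    from pigeonhole_le[OF Y, of f] f obtain i i' where ii: "i < i'" "i' \<le> card Y" "f i = f i'" by blast
    define k where "k = i' - i"
    have agr: "agree X (r + nmult i s) (r + nmult i' s) d"
      using f[of i] f[of i'] ii unfolding agree_def by simp
    have step: "z \<in> X \<longleftrightarrow> z + nmult k s \<in> X" if z: "r + l1 < z" "z < r + l1 + l1" for z
    proof -
      let ?t = "z - (r + nmult i s)"
      have "i \<le> card Y" using ii by simp
      from pt[OF this] z(1) have "r + nmult i s < z" by (rule less_trans)
      then have "0 < ?t" by simp
      moreover have "?t < d"
      proof -
        have "?t < r + l1 + l1 - p"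
          using z(2) in_I(1)[of i] ii by (intro diff_strict_mono) auto
        then show ?thesis using len by (rule less_le_trans)
      qed
      ultimately have "r + nmult i s + ?t \<in> X \<longleftrightarrow> r + nmult i' s + ?t \<in> X"
        using agr unfolding agree_def by blast
      moreover have "r + nmult i' s + ?t = z + nmult k s"
        using ii(1) by (simp add: k_def nmult_diff algebra_simps)
      ultimately show ?thesis by simp
    qed
    have "k dvd n" unfolding n_def k_def by (rule dvd_fact) (use ii in auto)
    then obtain q' where q': "n = k * q'" by blast
    have "w \<in> X \<longleftrightarrow> w + nmult (k * j) s \<in> X" if "j \<le> q'" for j
      using that
    proof (induction j)
      case (Suc j)
      have "k * j \<le> n" using Suc.prems unfolding q' by simp
      then have "w + nmult (k * j) s \<le> w + nmult n s" using s by (simp add: nmult_mono)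
      then have "w + nmult (k * j) s < r + l1 + l1" using w(2) by (rule le_less_trans)
      moreover have "r + l1 < w + nmult (k * j) s"
        by (rule less_le_trans[OF w(1)]) (use nmult_nonneg[OF less_imp_le[OF s], of "k * j"] in simp)
      ultimately have "w + nmult (k * j) s \<in> X \<longleftrightarrow> w + nmult (k * j) s + nmult k s \<in> X" by (intro step)
      moreover have "w + nmult (k * j) s + nmult k s = w + nmult (k * Suc j) s" by (simp add: nmult_add add.assoc add.commute)
      ultimately show ?case using Suc by simp
    qed simp
    from this[of q'] show ?thesis by (simp add: q')
  qed
  have inv: "z \<in> X \<longleftrightarrow> w \<in> X"
    if zw: "r + l1 < w" "w < z" "z < r + l1 + l1" "z - w \<in> multiples n" for z w
  proof -
    obtain s where s: "z - w = nmult n s" using zw(4) by (auto simp: multiples_iff)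
    have "0 < s"
    proof (rule ccontr)
      assume "\<not> 0 < s"
      then have "0 \<le> nmult n (- s)" by (intro nmult_nonneg) simp
      then have "z - w \<le> 0" by (simp add: s nmult_uminus)
      then show False using zw(2) by simp
    qed
    moreover have "z = w + nmult n s" using s by (simp add: algebra_simps)
    ultimately show ?thesis using main[of s w] zw by simp
  qed
  have "invariant_on n X (r + l1) (r + l1 + l1)"
    unfolding invariant_on_def
  proof (intro allI impI, elim conjE)
    fix z w assume zw: "r + l1 < z" "z < r + l1 + l1" "r + l1 < w" "w < r + l1 + l1" "z - w \<in> multiples n"
    show "z \<in> X \<longleftrightarrow> w \<in> X"
    proof (cases z w rule: linorder_cases)
      case less
      then show ?thesis using inv[of z w] zw multiples_cong_sym by blast
    next
      case greater
      then show ?thesis using inv[of w z] zw by blast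
    qed simp
  qed
  moreover have "p \<le> r + l1" "r + l1 < r + l1 + l1" "r + l1 + l1 \<le> q"
    using l1(1) end_le by (simp_all add: r_def add.assoc)
  ultimately show ?thesis unfolding n_def by blast
qed

lemma avoid_translates:
  assumes "finite T" and nd: "\<And>p q. p < q \<Longrightarrow> \<exists>p' q'. p \<le> p' \<and> p' < q' \<and> q' \<le> q \<and> (\<forall>x. p' < x \<and> x < q' \<longrightarrow> x \<notin> S)"
    and pq: "p < (q :: 'a)"
  shows "\<exists>p' q'. p \<le> p' \<and> p' < q' \<and> q' \<le> q \<and> (\<forall>t\<in>T. \<forall>x. p' < x \<and> x < q' \<longrightarrow> t + x \<notin> S)"
  using assms(1)
proof (induction T rule: finite_induct)
  case empty
  then show ?case using pq by blast
next
  case (insert t T)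
  then obtain p1 q1 where 1: "p \<le> p1" "p1 < q1" "q1 \<le> q" "\<forall>t\<in>T. \<forall>x. p1 < x \<and> x < q1 \<longrightarrow> t + x \<notin> S"
    by blast
  obtain p2 q2 where 2: "t + p1 \<le> p2" "p2 < q2" "q2 \<le> t + q1" "\<forall>x. p2 < x \<and> x < q2 \<longrightarrow> x \<notin> S"
    using nd[of "t + p1" "t + q1"] 1(2) by auto
  have le: "p1 \<le> p2 - t" "p2 - t < q2 - t" "q2 - t \<le> q1"
    using 2(1-3) by (simp_all add: algebra_simps)
  have "t' + x \<notin> S" if "t' \<in> insert t T" "p2 - t < x" "x < q2 - t" for t' x
  proof (cases "t' = t")
    case True
    have "p2 < t + x" "t + x < q2" using that by (simp_all add: algebra_simps)
    then show ?thesis using 2(4) True by blast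
  next
    case False
    then show ?thesis using 1(4) that le by (auto intro: le_less_trans less_le_trans)
  qed
  then show ?case using 1 le by (intro exI[of _ "p2 - t"] exI[of _ "q2 - t"]) (auto intro: order_trans)
qed

text \<open>Choose \<open>N + 1\<close> points \<open>e\<^sub>j\<close> of \<open>S\<close> and then shifts \<open>t\<^sub>i\<close> below all gaps one after the other. For each new
  \<open>t\<^sub>i\<^sub>'\<close> the finitely many sets \<open>S - e\<^sub>j + t\<^sub>i\<close> must be avoided, and they are nowhere dense.\<close>

lemma finite_nowhere_dense:
  assumes S: "definable_pred (\<lambda>e. e 0 \<in> S)"
    and nd: "\<And>p q. p < q \<Longrightarrow> \<exists>p' q'. p \<le> p' \<and> p' < q' \<and> q' \<le> q \<and> (\<forall>x. p' < x \<and> x < q' \<longrightarrow> x \<notin> S)"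
  shows "finite S"
proof (rule ccontr)
  assume inf: "infinite S"
  show False
  proof (rule sparse_False[OF S])
    fix N
    obtain S' where S': "S' \<subseteq> S" "finite S'" "card S' = Suc N"
      using infinite_arbitrarily_large[OF inf] by blast
    obtain e where e: "\<forall>j\<le>N. e j \<in> S'" "\<forall>j<N. e j < e (Suc j)"
      using increasing_enumeration[OF S'(2,3)] by blast
    have e_in: "e j \<in> S" if "j \<le> N" for j using e(1) S'(1) that by blast
    have e_less: "e j < e (Suc j)" if "j < N" for j using e(2) that by blast
    have "\<exists>d>0. \<forall>t\<in>(\<lambda>j. e (Suc j) - e j) ` {..<N}. d \<le> t"
      by (rule positive_lower_bound) (use e_less in auto)
    then obtain d where d: "0 < d" "\<forall>t\<in>(\<lambda>j. e (Suc j) - e j) ` {..<N}. d \<le> t" by blast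
    have "\<exists>t. (0 < t \<and> t < d) \<and> (\<forall>g\<in>G. \<forall>j<N. e j + (t - g) \<notin> S)" if "finite G" for G
    proof -
      have fin: "finite ((\<lambda>(g, j). e j - g) ` (G \<times> {..<N}))" using that by simp
      have "\<exists>p q. 0 \<le> p \<and> p < q \<and> q \<le> d \<and>
          (\<forall>t\<in>(\<lambda>(g, j). e j - g) ` (G \<times> {..<N}). \<forall>x. p < x \<and> x < q \<longrightarrow> t + x \<notin> S)"
        by (rule avoid_translates[OF fin]) (rule nd, assumption, rule d(1))
      then obtain p q where
        pq: "0 \<le> p" "p < q" "q \<le> d" "\<forall>t\<in>(\<lambda>(g, j). e j - g) ` (G \<times> {..<N}). \<forall>x. p < x \<and> x < q \<longrightarrow> t + x \<notin> S"
        by (elim exE conjE)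
      obtain t where t: "p < t" "t < q" using between[OF pq(2)] by blast
      have "e j - g + t \<notin> S" if "g \<in> G" "j < N" for g j
        using pq(4) t that by force
      then have "e j + (t - g) \<notin> S" if "g \<in> G" "j < N" for g j
        using that by (simp add: algebra_simps)
      then show ?thesis using t pq by (intro exI[of _ t]) (auto intro: le_less_trans less_le_trans)
    qed
    from greedy_sequence[OF this] obtain t :: "nat \<Rightarrow> 'a" where t: "\<forall>i'. (0 < t i' \<and> t i' < d) \<and> (\<forall>i<i'. \<forall>j<N. e j + (t i' - t i) \<notin> S)" ..
    have "e j + t i < e (Suc j)" if "j < N" for i j
    proof -
      have "t i < e (Suc j) - e j" using t d(2) that by (auto intro: less_le_trans)
      then show ?thesis by (simp add: algebra_simps)
    qed
    then show "\<exists>e t. (\<forall>j\<le>N. e j \<in> S) \<and> (\<forall>j<N. e j < e (Suc j)) \<and> (\<forall>i<N. 0 \<le> t i) \<and>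
        (\<forall>i<N. \<forall>j<N. e j + t i < e (Suc j)) \<and>
        (\<forall>i i' j. i < i' \<and> i' < N \<and> j < N \<longrightarrow> e j + (t i' - t i) \<notin> S)"
      using e_in e_less t by (rule_tac exI[of _ e], rule_tac exI[of _ t]) (simp add: less_imp_le)
  qed
qed

text \<open>A coset of \<open>nM\<close> either has elements arbitrarily close to \<open>0\<close> or avoids an interval around \<open>0\<close>. As there
  are finitely many cosets, in some interval \<open>(-d, d)\<close> only cosets of the first kind occur. If \<open>g\<close> is a small
  element of the coset of \<open>w\<close>, then \<open>w - g \<in> nM\<close> is close to \<open>w\<close>.\<close>

lemma multiples_dense_near_0:
  assumes n: "0 < n"
  shows "\<exists>d>0. \<forall>w. - d < w \<and> w < d \<longrightarrow> (\<forall>r>0. \<exists>g :: 'a. - r < g \<and> g < r \<and> g - w \<in> multiples n)"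
proof -
  obtain G :: "'a set" where G: "finite G" "\<And>x. \<exists>g\<in>G. x - g \<in> multiples n" using finite_index[OF n] by metis
  define near where "near r g \<longleftrightarrow> (\<exists>y. - r < y \<and> y < r \<and> y - g \<in> multiples n)" for r g :: 'a
  define acc where "acc g \<longleftrightarrow> (\<forall>r>0. near r g)" for g
  define r where "r g = (SOME r. 0 < r \<and> \<not> near r g)" for g
  have r: "0 < r g \<and> \<not> near (r g) g" if "\<not> acc g" for g
    unfolding r_def by (rule someI_ex) (use that in \<open>auto simp: acc_def\<close>)
  obtain d where d: "0 < d" "\<forall>t\<in>r ` {g \<in> G. \<not> acc g}. d \<le> t"
    using positive_lower_bound[of "r ` {g \<in> G. \<not> acc g}"] r G(1) by auto
  have "\<exists>g. - \<rho> < g \<and> g < \<rho> \<and> g - w \<in> multiples n" if w: "- d < w" "w < d" and \<rho>: "0 < \<rho>" for w \<rho>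
  proof -
    obtain g where g: "g \<in> G" "w - g \<in> multiples n" using G(2) by blast
    have "acc g"
    proof (rule ccontr)
      assume na: "\<not> acc g"
      then have "d \<le> r g" using d(2) g(1) by blast
      then have "- r g < w" "w < r g" using w by (auto intro: less_le_trans le_less_trans[of "- r g" "- d" w])
      then have "near (r g) g"
        unfolding near_def using g(2) by blast
      then show False using r[OF na] by blast
    qed
    then obtain y where y: "- \<rho> < y" "y < \<rho>" "y - g \<in> multiples n"
      using \<rho> unfolding acc_def near_def by blast
    then have "y - w \<in> multiples n" using g(2) multiples_cong_trans multiples_cong_sym by blast
    then show ?thesis using y by blast
  qed
  with d(1) show ?thesis by blast
qed

lemma infinite_class:
  assumes n: "0 < n" and r: "0 < r" and inv: "invariant_on n X (x - r) (x + r)"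
  shows "infinite {y. same_run n X x y}"
proof -
  obtain d where d: "0 < d" "\<And>w \<rho>. - d < w \<Longrightarrow> w < d \<Longrightarrow> 0 < \<rho> \<Longrightarrow> \<exists>g :: 'a. - \<rho> < g \<and> g < \<rho> \<and> g - w \<in> multiples n"
    using multiples_dense_near_0[OF n] by metis
  obtain d' where d': "0 < d'" "d' + d' \<le> d" using half_exists[OF d(1)] by blast
  define \<rho> where "\<rho> = min r d'"
  have \<rho>: "0 < \<rho>" "\<rho> \<le> r" "\<rho> + \<rho> \<le> d"
  proof -
    show "0 < \<rho>" "\<rho> \<le> r" using r d' by (simp_all add: \<rho>_def)
    have "\<rho> + \<rho> \<le> d' + d'" by (rule add_mono) (simp_all add: \<rho>_def)
    then show "\<rho> + \<rho> \<le> d" using d'(2) by (rule order_trans)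
  qed
  let ?C = "{x - \<rho> <..< x + \<rho>}"
  have sub: "x - r \<le> x - \<rho>" "x + \<rho> \<le> x + r" using \<rho>(2) by simp_all
  have coin: "\<exists>w'\<in>?C. w' - w \<in> multiples n \<and> w' \<le> z" if zw: "z \<in> ?C" "w \<in> ?C" for z w
  proof -
    obtain v where v: "x - \<rho> < v" "v < z" using between zw(1) by auto
    have width: "(x + \<rho>) - (x - \<rho>) = \<rho> + \<rho>" by (simp add: algebra_simps)
    have "v < x + \<rho>" using v(2) zw(1) by auto
    have "v - w < (x + \<rho>) - (x - \<rho>)" using \<open>v < x + \<rho>\<close> zw(2) by (intro diff_strict_mono) auto
    then have "v - w < \<rho> + \<rho>" unfolding width .
    then have "v - w < d" using \<rho>(3) by (rule less_le_trans)
    moreover have "w - v < (x + \<rho>) - (x - \<rho>)" using v(1) zw(2) by (intro diff_strict_mono) auto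
    then have "w - v < \<rho> + \<rho>" unfolding width .
    then have "w - v < d" using \<rho>(3) by (rule less_le_trans)
    then have "- d < v - w" by (simp add: algebra_simps)
    moreover have "0 < min (z - v) (v - (x - \<rho>))" using v by simp
    ultimately obtain g where g: "- min (z - v) (v - (x - \<rho>)) < g" "g < min (z - v) (v - (x - \<rho>))" "g - (v - w) \<in> multiples n"
      using d(2) by blast
    have "- (z - v) \<le> - min (z - v) (v - (x - \<rho>))" by (simp only: neg_le_iff_le min.cobounded1)
    then have "- (z - v) < g" using g(1) by (rule le_less_trans)
    then have "v - g < z" by (simp add: algebra_simps)
    moreover have "g < v - (x - \<rho>)" using g(2) by simp
    then have "x - \<rho> < v - g" by (simp add: algebra_simps)
    moreover have eq: "- (g - (v - w)) = v - g - w" by (simp add: algebra_simps)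
    have "v - g - w \<in> multiples n" using multiples_uminus[OF g(3)] unfolding eq .
    ultimately show ?thesis using zw(1) by (intro bexI[of _ "v - g"]) auto
  qed
  have invC: "z \<in> X" if "y \<in> ?C" "z \<in> ?C" "y - z \<in> multiples n" "y \<in> X" for y z
  proof -
    have "x - r < y" "y < x + r" "x - r < z" "z < x + r"
      using that(1,2) le_less_trans[OF sub(1)] less_le_trans[OF _ sub(2)] by auto
    then show ?thesis using inv that(3,4) unfolding invariant_on_def by blast
  qed
  have "same_run n X x y" if "y \<in> ?C" for y
  proof (rule same_runI[where C = ?C and C' = ?C])
    show "b \<in> ?C" if "a \<in> ?C" "c \<in> ?C" "a \<le> b" "b \<le> c" for a b c
      using that by (auto intro: less_le_trans le_less_trans)
    then show "b \<in> ?C" if "a \<in> ?C" "c \<in> ?C" "a \<le> b" "b \<le> c" for a b c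
      using that by blast
    show "x \<in> ?C" using \<rho>(1) by simp
  qed (use invC coin that in blast)+
  then have "?C \<subseteq> {y. same_run n X x y}" by blast
  moreover have "x - \<rho> < x" "x < x + \<rho>" using \<rho>(1) by simp_all
  then have "infinite ?C" by (intro infinite_interval) (rule less_trans)
  ultimately show ?thesis using finite_subset by blast
qed

theorem finite_classes_dense:
  assumes X: "definable_pred (\<lambda>e. e 0 \<in> X)"
  shows "\<exists>n>0. finite {x. finite {y. same_run n X x y}}"
proof -
  obtain Y where Y: "finite Y" "\<And>x. \<exists>y\<in>Y. \<exists>d>0. agree X y x d" using finitely_many_germs[OF X] by metis
  define n :: nat where "n = fact (card Y)"
  have n: "0 < n" by (simp add: n_def)
  define S where "S = {x. \<forall>r. 0 < r \<longrightarrow> \<not> invariant_on n X (x - r) (x + r)}"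
  have "finite S"
  proof (rule finite_nowhere_dense)
    show "definable_pred (\<lambda>e. e 0 \<in> S)"
      unfolding S_def mem_Collect_eq invariant_on_def by (intro pred_intros pred_subst1[OF X])
    fix p q :: 'a assume "p < q"
    from uniform_radius[OF X Y this] obtain p1 q1 d where 1: "p \<le> p1" "p1 < q1" "q1 \<le> q" "0 < d"
      "\<forall>b. p1 < b \<and> b < q1 \<longrightarrow> (\<exists>y\<in>Y. agree X y b d)" by (elim exE conjE)
    then obtain p2 q2 where 2: "p1 \<le> p2" "p2 < q2" "q2 \<le> q1" "invariant_on n X p2 q2"
      using somewhere_invariant[OF Y(1) 1(2) 1(4), of X] unfolding n_def by blast
    have "x \<notin> S" if x: "p2 < x" "x < q2" for x
    proof -
      let ?r = "min (x - p2) (q2 - x)"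
      have "?r \<le> x - p2" "?r \<le> q2 - x" by simp_all
      then have le: "p2 \<le> x - ?r" "x + ?r \<le> q2" by (simp_all only: le_diff_eq add.commute[of x] add.commute[of p2])
      have "invariant_on n X (x - ?r) (x + ?r)"
        unfolding invariant_on_def
      proof (intro allI impI, elim conjE)
        fix z w assume zw: "x - ?r < z" "z < x + ?r" "x - ?r < w" "w < x + ?r" "z - w \<in> multiples n"
        have "p2 < z" "p2 < w" using le(1) zw(1,3) by (auto intro: le_less_trans)
        moreover have "z < q2" "w < q2" using le(2) zw(2,4) by (auto intro: less_le_trans)
        ultimately show "z \<in> X \<longleftrightarrow> w \<in> X" using 2(4) zw(5) unfolding invariant_on_def by blast
      qed
      moreover have "0 < ?r" using x by simp
      ultimately show ?thesis unfolding S_def by blast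
    qed
    then show "\<exists>p' q'. p \<le> p' \<and> p' < q' \<and> q' \<le> q \<and> (\<forall>x. p' < x \<and> x < q' \<longrightarrow> x \<notin> S)"
      using 1 2 by (intro exI[of _ p2] exI[of _ q2]) (auto intro: order_trans)
  qed
  moreover have "{x. finite {y. same_run n X x y}} \<subseteq> S"
    using infinite_class[OF n] unfolding S_def by blast
  ultimately show ?thesis using n finite_subset by blast
qed

end

theorem theorem2p8:
  fixes L :: "('f, 'r) lang"
    and M :: "('a::linordered_ab_group_add, 'f, 'r) struct"
    and X :: "'a set"
  assumes "expands_ordered_group L M"
    and "dp_minimal L M"
    and "definable_set L M X"
  shows "\<exists>(n::nat) E. definable_rel L M E \<and> convex_equiv E \<and>
    finite {C \<in> UNIV // E. finite C} \<and>
    (\<forall>a. \<exists>B. finite B \<and> E `` {a} \<inter> X = E `` {a} \<inter> (\<Union>b\<in>B. (\<lambda>y. b + y) ` multiples n))"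
proof -
  interpret dp_minimal_expansion L M by unfold_locales (fact assms)+
  have X: "definable_pred (\<lambda>e. e 0 \<in> X)" by (rule pred_definable_set[OF assms(3)])
  have "\<exists>n>0. finite {x. finite {y. same_run n X x y}}"
  proof (cases "\<exists>x :: 'a. 0 < x")
    case False
    then have "x = 0" for x :: 'a by (metis linorder_neqE neg_0_less_iff_less)
    then have "UNIV = {0 :: 'a}" by blast
    then have "finite (UNIV :: 'a set)" by (metis finite.emptyI finite.insertI)
    then show ?thesis by (intro exI[of _ 1]) (auto intro: finite_subset[OF subset_UNIV])
  next
    case True
    show ?thesis
    proof (cases "\<forall>x :: 'a. 0 < x \<longrightarrow> (\<exists>y. 0 < y \<and> y < x)")
      case dense: True
      interpret dense_expansion L M by unfold_locales (use dense True in blast)+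
      show ?thesis by (rule finite_classes_dense[OF X])
    next
      case False
      then obtain u :: 'a where u: "0 < u" "\<forall>y. 0 < y \<longrightarrow> \<not> y < u" by blast
      interpret discrete_expansion L M u by unfold_locales (use u in auto)
      show ?thesis by (rule finite_classes_discrete[OF X])
    qed
  qed
  then obtain n where "0 < n" "finite {x. finite {y. same_run n X x y}}" by blast
  from theorem_of_finite_classes[OF X this] show ?thesis .
qed


end
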